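(* Let $\Omega$, $v$, $X$, $\Omega^{\pm}(0)$, $\Sigma(0)$, $\Sigma(t)$, $\phi^0\in C^0(\bar\Omega;\mathbb{R})$, and the function $R:[0,\infty)\times\bar\Omega\times\mathbb{R}^3\to\mathbb{R}$ be as in the context, and let $T>0$ be arbitrary. Then there exists a function $\phi\in C^0([0,T)\times\bar\Omega;\mathbb{R})$ which is a viscosity solution of $$\frac{\partial\phi}{\partial t}(t,x)+v(t,x)\cdot\nabla\phi(t,x)=\phi(t,x)\,R(t,x,\nabla\phi(t,x))\quad\text{in }(0,T)\times\Omega$$ and satisfies pointwise (strictly) the initial and boundary conditions $$\phi(0,x)=\phi^0(x)\ \text{ on }\Omega,\qquad \phi(t,x)=\phi^0(X(0,t,x))\ \text{ on }[0,T)\times\partial\Omega .$$ Such a viscosity solution is unique. Furthermore, $$\{x\in\Omega \mid \phi(t,x)=0\}=\Sigma(t)\qquad\text{for all }t\in[0,T).$$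
   Context: Domain and velocity. $\Omega\subset\mathbb{R}^3$ is a bounded connected open set. $v\in C^0([0,\infty)\times\bar\Omega;\mathbb{R}^3)\cap C^1([0,\infty)\times\Omega;\mathbb{R}^3)$ is locally Lipschitz in $x\in\bar\Omega$ (for every $(t_0,x_0)$ there are $\delta,L>0$ with $|v(t,x)-v(t,\bar x)|\le L|x-\bar x|$ for $t\ge0$, $|t-t_0|<\delta$, and $x,\bar x\in\bar\Omega$ within distance $\delta$ of $x_0$) and satisfies: (H2) $\pm v(s,x)\in T_{\partial\Omega}(x)$ for all $s\in[0,\infty)$, $x\in\partial\Omega$, where for closed $K\subset\mathbb{R}^d$ and $x\in K$, $T_K(x):=\{z\in\mathbb{R}^d \mid \liminf_{h\to0+}h^{-1}\mathrm{dist}(x+hz,K)=0\}$; (H3) $|\partial v_i/\partial x_j|$ ($i,j=1,2,3$) are bounded on $[0,\infty)\times\Omega$. Here $\nabla$ is the gradient in $x$ and $(\nabla v)_{ij}=\partial v_i/\partial x_j$. Flow. For each $(\tau,\xi)\in[0,\infty)\times\bar\Omega$ the ODE $x'(s)=v(s,x(s))$, $x(\tau)=\xi$ has a unique solution on $[0,\infty)$ staying in $\bar\Omega$, whose value at $s$ is denoted $X(s,\tau,\xi)$; $\bar\Omega,\partial\Omega,\Omega$ are invariant under this flow. Initial configuration. $\Omega^+(0)\subsetneq\Omega$ is a connected open set with $\partial\Omega^+(0)\cap\partial\Omega=\emptyset$; $\Omega^-(0):=\Omega\setminus\overline{\Omega^+(0)}$ is also connected; $\Sigma(0):=\partial\Omega^+(0)=\partial\Omega^+(0)\cap\partial\Omega^-(0)\subset\Omega$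 is a closed 2-dimensional surface (compact topological manifold without boundary). $\phi^0:\bar\Omega\to\mathbb{R}$ is continuous with $\phi^0>0$ on $\Omega^+(0)$, $\phi^0<0$ on $\Omega^-(0)$ and $\{x\in\Omega \mid \phi^0(x)=0\}=\Sigma(0)$. For $t\ge0$: $\Omega^\pm(t):=X(t,0,\Omega^\pm(0))$ and $\Sigma(t):=X(t,0,\Sigma(0))$, so that $\Sigma(t)\cap\partial\Omega=\emptyset$. The cut-off nonlinearity $R$. For $\varepsilon>0$ let $K_\varepsilon\subset\bar\Omega$ be the intersection of $\bar\Omega$ with the $\varepsilon$-neighborhood of $\partial\Omega$. Fix a smooth function $\varepsilon:[0,\infty)\to\mathbb{R}_{>0}$ with $K_{3\varepsilon(t)}\cap\Sigma(t)=\emptyset$ for all $t\ge0$ (one exists), a smooth function $\eta_1:[0,\infty)\times\bar\Omega\to[0,1]$ with $\eta_1(t,x)=1$ for $x\notin K_{3\varepsilon(t)}$ and $\eta_1(t,x)=0$ for $x\in K_{2\varepsilon(t)}$, and a smooth function $\eta_2:[0,\infty)\to[0,1]$ with $\eta_2(r)=1$ for $\frac23\le r\le\frac43$, $\eta_2(r)=0$ for $r\le\frac13$ or $r\ge\frac53$, and monotone on each of $[\frac13,\frac23]$ and $[\frac43,\frac53]$. Define $$R(t,x,p):=\eta_1(t,x)\,\eta_2(|p|)\,\Big\langle(\nabla v(t,x))\frac{p}{|p|},\frac{p}{|p|}\Big\rangle,$$ understood as $0$ where $\eta_1(t,x)\eta_2(|p|)=0$ (in particular for $p=0$ and for $x\in\partial\Omega$).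 $R$ is continuous and bounded. Viscosity solutions. Let $O\subset\mathbb{R}^N$ be open and $G:O\times\mathbb{R}\times\mathbb{R}^N\to\mathbb{R}$ continuous. For locally bounded $u:O\to\mathbb{R}$ put $u^*(z):=\lim_{r\to0}\sup\{u(y) \mid y\in O,\,|y-z|\le r\}$ and $u_*(z):=\lim_{r\to0}\inf\{u(y) \mid y\in O,\,|y-z|\le r\}$. $u$ is a viscosity subsolution (resp. supersolution) of $G(z,u(z),\nabla_zu(z))=0$ in $O$ if $u^*$ is bounded from above (resp. $u_*$ is bounded from below) and, whenever $\varphi\in C^1(O;\mathbb{R})$ and $z\in O$ are such that $u^*-\varphi$ attains its maximum over $O$ at $z$ (resp. $u_*-\varphi$ attains its minimum over $O$ at $z$), one has $G(z,u^*(z),\nabla_z\varphi(z))\le0$ (resp. $G(z,u_*(z),\nabla_z\varphi(z))\ge0$). A viscosity solution is a function that is both a sub- and a supersolution. The equation of the theorem is of this form with $z=(t,x)$, $O=(0,T)\times\Omega$ and $G(t,x,u,(q_0,q))=q_0+v(t,x)\cdot q-u\,R(t,x,q)$. *)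

theory Defs
  imports "HOL-Analysis.Analysis"
begin

section \<open>Regularity\<close>

text \<open>Derivatives are taken within \<open>S\<close>, so that \<open>S\<close> may be \<open>[0,\<infinity>) \<times> \<Omega>\<close> (one-sided
  in time at \<open>t = 0\<close>).\<close>

definition C1_on :: "'a::real_normed_vector set \<Rightarrow> ('a \<Rightarrow> 'b::real_normed_vector) \<Rightarrow> bool" where
  "C1_on S f \<longleftrightarrow>
     (\<exists>f' :: 'a \<Rightarrow> 'a \<Rightarrow>\<^sub>L 'b.
        (\<forall>z\<in>S. (f has_derivative blinfun_apply (f' z)) (at z within S)) \<and> continuous_on S f')"

text \<open>\<open>C\<^sup>n\<close> on an open set. The recursion is over directional derivatives, because iterated
  Frechet derivatives would change the type at each step; in finite dimension the two notions
  agree.\<close>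

primrec Cn_on_open :: "nat \<Rightarrow> 'a::real_normed_vector set \<Rightarrow> ('a \<Rightarrow> 'b::real_normed_vector) \<Rightarrow> bool" where
  "Cn_on_open 0 U f \<longleftrightarrow> continuous_on U f"
| "Cn_on_open (Suc n) U f \<longleftrightarrow>
     (\<forall>x\<in>U. f differentiable (at x)) \<and>
     (\<forall>h. Cn_on_open n U (\<lambda>x. frechet_derivative f (at x) h))"

text \<open>Smooth on an arbitrary set: restriction of a function that is \<open>C\<^sup>\<infinity>\<close> on an open
  neighbourhood.\<close>

definition smooth_on :: "'a::real_normed_vector set \<Rightarrow> ('a \<Rightarrow> 'b::real_normed_vector) \<Rightarrow> bool" where
  "smooth_on S f \<longleftrightarrow>
     (\<exists>U g. open U \<and> S \<subseteq> U \<and> (\<forall>n. Cn_on_open n U g) \<and> (\<forall>x\<in>S. g x = f x))"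


section \<open>Geometry\<close>

definition contingent_cone :: "'a::euclidean_space set \<Rightarrow> 'a \<Rightarrow> 'a set" where
  "contingent_cone K x =
     {z. Liminf (at_right (0::real)) (\<lambda>h. ereal (infdist (x + h *\<^sub>R z) K / h)) = 0}"

text \<open>Compact 2-dimensional topological manifold without boundary, embedded in a Euclidean space
  (hence automatically Hausdorff and second countable). It need not be connected.\<close>

definition closed_surface :: "'a::euclidean_space set \<Rightarrow> bool" where
  "closed_surface S \<longleftrightarrow> compact S \<and>
     (\<forall>x\<in>S. \<exists>U. \<exists>V :: (real^2) set.
        openin (top_of_set S) U \<and> x \<in> U \<and> open V \<and> U homeomorphic V)"

definition boundary_layer :: "'a::euclidean_space set \<Rightarrow> real \<Rightarrow> 'a set" where
  "boundary_layer \<Omega> e = {x \<in> closure \<Omega>. infdist x (frontier \<Omega>) < e}"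


section \<open>Flow\<close>

definition ode_solution ::
  "'a::euclidean_space set \<Rightarrow> (real \<Rightarrow> 'a \<Rightarrow> 'a) \<Rightarrow> real \<Rightarrow> 'a \<Rightarrow> (real \<Rightarrow> 'a) \<Rightarrow> bool" where
  "ode_solution \<Omega> v \<tau> \<xi> x \<longleftrightarrow> x \<tau> = \<xi> \<and>
     (\<forall>s\<ge>0. x s \<in> closure \<Omega> \<and> (x has_vector_derivative v s (x s)) (at s within {0..}))"

text \<open>Solutions are only determined on \<open>[0,\<infinity>)\<close>, so the unique object is the value at
  \<open>s\<close> and not the total function.\<close>

definition flow ::
  "'a::euclidean_space set \<Rightarrow> (real \<Rightarrow> 'a \<Rightarrow> 'a) \<Rightarrow> real \<Rightarrow> real \<Rightarrow> 'a \<Rightarrow> 'a" where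
  "flow \<Omega> v s \<tau> \<xi> = (THE y. \<exists>x. ode_solution \<Omega> v \<tau> \<xi> x \<and> x s = y)"


section \<open>Viscosity solutions\<close>

definition locally_bounded_on :: "'a::euclidean_space set \<Rightarrow> ('a \<Rightarrow> real) \<Rightarrow> bool" where
  "locally_bounded_on O' u \<longleftrightarrow> (\<forall>z\<in>O'. \<exists>r>0. bounded (u ` (O' \<inter> cball z r)))"

text \<open>The suprema and infima are real; for \<open>u\<close> locally bounded they are meaningful for all
  sufficiently small \<open>r\<close>.\<close>

definition usc_envelope :: "'a::euclidean_space set \<Rightarrow> ('a \<Rightarrow> real) \<Rightarrow> 'a \<Rightarrow> real" where
  "usc_envelope O' u z = Lim (at_right (0::real)) (\<lambda>r. SUP y\<in>O' \<inter> cball z r. u y)"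

definition lsc_envelope :: "'a::euclidean_space set \<Rightarrow> ('a \<Rightarrow> real) \<Rightarrow> 'a \<Rightarrow> real" where
  "lsc_envelope O' u z = Lim (at_right (0::real)) (\<lambda>r. INF y\<in>O' \<inter> cball z r. u y)"

text \<open>In the test-function conditions \<open>D\<close> is the gradient of \<open>\<psi>\<close>, and its continuity says that
  \<open>\<psi>\<close> is \<open>C\<^sup>1\<close> on the open set \<open>O'\<close>.\<close>

definition viscosity_subsolution ::
  "'a::euclidean_space set \<Rightarrow> ('a \<Rightarrow> real \<Rightarrow> 'a \<Rightarrow> real) \<Rightarrow> ('a \<Rightarrow> real) \<Rightarrow> bool" where
  "viscosity_subsolution O' G u \<longleftrightarrow>
     locally_bounded_on O' u \<and>
     bdd_above (usc_envelope O' u ` O') \<and>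
     (\<forall>\<psi> D z.
        (\<forall>y\<in>O'. GDERIV \<psi> y :> D y) \<and> continuous_on O' D \<and> z \<in> O' \<and>
        (\<forall>y\<in>O'. usc_envelope O' u y - \<psi> y \<le> usc_envelope O' u z - \<psi> z)
        \<longrightarrow> G z (usc_envelope O' u z) (D z) \<le> 0)"

definition viscosity_supersolution ::
  "'a::euclidean_space set \<Rightarrow> ('a \<Rightarrow> real \<Rightarrow> 'a \<Rightarrow> real) \<Rightarrow> ('a \<Rightarrow> real) \<Rightarrow> bool" where
  "viscosity_supersolution O' G u \<longleftrightarrow>
     locally_bounded_on O' u \<and>
     bdd_below (lsc_envelope O' u ` O') \<and>
     (\<forall>\<psi> D z.
        (\<forall>y\<in>O'. GDERIV \<psi> y :> D y) \<and> continuous_on O' D \<and> z \<in> O' \<and>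
        (\<forall>y\<in>O'. lsc_envelope O' u z - \<psi> z \<le> lsc_envelope O' u y - \<psi> y)
        \<longrightarrow> G z (lsc_envelope O' u z) (D z) \<ge> 0)"

definition viscosity_solution ::
  "'a::euclidean_space set \<Rightarrow> ('a \<Rightarrow> real \<Rightarrow> 'a \<Rightarrow> real) \<Rightarrow> ('a \<Rightarrow> real) \<Rightarrow> bool" where
  "viscosity_solution O' G u \<longleftrightarrow> viscosity_subsolution O' G u \<and> viscosity_supersolution O' G u"


section \<open>The level-set equation\<close>

text \<open>The case distinction is needed because at \<open>x \<in> \<partial>\<Omega>\<close> and at \<open>p = 0\<close> the third factor has
  no meaning. The \<open>(i,j)\<close> entry of \<open>jacobian (v t) (at x)\<close> is the derivative of the \<open>i\<close>-th
  component of \<open>v\<close> with respect to \<open>x\<^sub>j\<close>.\<close>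

definition cutoff_R ::
  "(real \<Rightarrow> real^3 \<Rightarrow> real^3) \<Rightarrow> (real \<Rightarrow> real^3 \<Rightarrow> real) \<Rightarrow> (real \<Rightarrow> real) \<Rightarrow>
   real \<Rightarrow> real^3 \<Rightarrow> real^3 \<Rightarrow> real" where
  "cutoff_R v \<eta>1 \<eta>2 t x p =
     (if \<eta>1 t x * \<eta>2 (norm p) = 0 then 0
      else \<eta>1 t x * \<eta>2 (norm p) *
           ((jacobian (v t) (at x) *v (p /\<^sub>R norm p)) \<bullet> (p /\<^sub>R norm p)))"

definition level_set_G ::
  "(real \<Rightarrow> real^3 \<Rightarrow> real^3) \<Rightarrow> (real \<Rightarrow> real^3 \<Rightarrow> real^3 \<Rightarrow> real) \<Rightarrow>
   real \<times> (real^3) \<Rightarrow> real \<Rightarrow> real \<times> (real^3) \<Rightarrow> real" where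
  "level_set_G v R = (\<lambda>(t, x) u (q0, q). q0 + v t x \<bullet> q - u * R t x q)"

definition level_set_solution ::
  "(real^3) set \<Rightarrow> (real \<Rightarrow> real^3 \<Rightarrow> real^3) \<Rightarrow> (real \<Rightarrow> real^3 \<Rightarrow> real^3 \<Rightarrow> real) \<Rightarrow>
   (real^3 \<Rightarrow> real) \<Rightarrow> real \<Rightarrow> (real \<times> (real^3) \<Rightarrow> real) \<Rightarrow> bool" where
  "level_set_solution \<Omega> v R \<phi>0 T \<phi> \<longleftrightarrow>
     continuous_on ({0..<T} \<times> closure \<Omega>) \<phi> \<and>
     viscosity_solution ({0<..<T} \<times> \<Omega>) (level_set_G v R) \<phi> \<and>
     (\<forall>x\<in>\<Omega>. \<phi> (0, x) = \<phi>0 x) \<and>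
     (\<forall>t\<in>{0..<T}. \<forall>x\<in>frontier \<Omega>. \<phi> (t, x) = \<phi>0 (flow \<Omega> v 0 t x))"

end

theory Submission
  imports Defs
begin

text \<open>Along the flow the equation reads \<open>d\<phi>/dt = \<phi> R\<close>, and \<open>R\<close> is bounded and vanishes near
  \<open>\<partial>\<Omega>\<close>. Hence, for a suitable \<open>k \<ge> 0\<close> vanishing on \<open>\<partial>\<Omega>\<close>, multiplying the transported
  datum \<open>\<phi>\<^sup>0(X(0,t,x))\<close> by \<open>exp (\<plusminus> t * k (X(0,t,x)))\<close>, with the sign chosen according to the sign of
  \<open>\<phi>\<^sup>0(X(0,t,x))\<close>, yields a continuous supersolution and a continuous subsolution. They take the same
  initial and lateral boundary values and both have zero set \<open>\<Sigma>(t)\<close>. Perron's method between these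
  two barriers, together with a comparison principle for semicontinuous functions proved by doubling
  the variables, gives existence, uniqueness and the description of the zero set. That
  \<open>\<Omega>\<close> and \<open>\<partial>\<Omega>\<close> are invariant under the flow is Nagumo's theorem, applied forwards and
  backwards in time to a Lipschitz extension of \<open>v\<close>.\<close>

section \<open>Ordinary differential equations\<close>

text \<open>\<open>R\<close> depends on the gradient of \<phi>, so the equation is not an ODE along
  trajectories and \<phi> cannot be written down. The bound on \<open>R\<close>, however, can be
  expressed through the starting point X(0,t,x), which is constant along a trajectory, and dy/dt = k
  |y|, dy/dt = - k |y| are solved explicitly: these solutions are the barriers. The layer where
  \<open>R\<close> vanishes is attached to (t,x) and varies with t, so finding such a
  \<open>k\<close> needs a Lipschitz bound for the flow. Perron's method alone gives no continuity.
  Comparison between the upper envelope of the Perron function (a subsolution) and its lower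
  envelope (a supersolution) forces them to coincide, so continuity comes from the inequality that
  also gives uniqueness. An obstacle there is that the gradients of the penalty may be unbounded;
  this is harmless because \<open>R\<close> vanishes for large gradients. Uniqueness holds among all
  continuous solutions: the one-sided bounds in the definition of sub- and supersolutions supply the
  boundedness that comparison uses.\<close>

lemma picard_forward:
  fixes f :: "real \<Rightarrow> 'a::euclidean_space \<Rightarrow> 'a"
  assumes cont: "continuous_on UNIV (\<lambda>(t, x). f t x)"
    and lip: "\<And>t x y. norm (f t x - f t y) \<le> L * norm (x - y)"
    and L: "L > 0"
    and bd: "\<And>t. norm (f t \<xi>) \<le> B"
  obtains x where "x 0 = \<xi>"
    and "\<And>t. t \<ge> 0 \<Longrightarrow> (x has_vector_derivative f t (x t)) (at t within {0..})"
proof -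
  have B0: "B \<ge> 0" using bd[of 0] norm_ge_zero order_trans by blast
  \<comment> \<open>The unknown is x(s) = \<xi> + exp(2Ls) u(s) with u bounded, so the sup norm of u
    is an exponentially weighted norm of x - \<xi>. With the weight 2L the Picard map contracts by
    the factor 1/2 on the whole half-line, and no local solutions have to be glued.\<close>
  define F where "F u s = f s (\<xi> + exp (2 * L * s) *\<^sub>R apply_bcontfun u s)" for u :: "real \<Rightarrow>\<^sub>C 'a" and s
  \<comment> \<open>\<open>max 0 t\<close> extends the image to negative times, because bounded
    continuous functions here live on all of the reals.\<close>
  define P where "P u t = exp (- 2 * L * max 0 t) *\<^sub>R integral {0..max 0 t} (F u)" for u t
  have F_cont: "continuous_on S (F u)" for u S
  proof -
    have "continuous_on S (\<lambda>s. (\<lambda>(t, x). f t x) (s, \<xi> + exp (2 * L * s) *\<^sub>R apply_bcontfun u s))"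
      by (rule continuous_on_compose2[OF cont]) (auto intro!: continuous_intros)
    then show ?thesis unfolding F_def by simp
  qed
  have F_int: "F u integrable_on {a..b}" for u a b
    by (rule integrable_continuous_real[OF F_cont])
  have expint: "((\<lambda>s. exp (2 * L * s)) has_integral (exp (2 * L * t) - 1) / (2 * L)) {0..t}" if "t \<ge> 0" for t
  proof -
    have "((\<lambda>s. exp (2 * L * s)) has_integral exp (2 * L * t) / (2 * L) - exp (2 * L * 0) / (2 * L)) {0..t}"
      by (rule fundamental_theorem_of_calculus[OF that])
        (use L in \<open>auto intro!: derivative_eq_intros simp: has_real_derivative_iff_has_vector_derivative[symmetric]\<close>)
    then show ?thesis by (simp add: diff_divide_distrib)
  qed
  have F_diff: "norm (integral {0..t} (F u) - integral {0..t} (F w)) \<le> (exp (2 * L * t) - 1) / 2 * dist u w"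
    if "t \<ge> 0" for u w t
  proof -
    have "norm (integral {0..t} (\<lambda>s. F u s - F w s)) \<le> integral {0..t} (\<lambda>s. exp (2 * L * s) * (L * dist u w))"
    proof (rule integral_norm_bound_integral)
      show "(\<lambda>s. F u s - F w s) integrable_on {0..t}" by (intro integrable_diff F_int)
      show "(\<lambda>s. exp (2 * L * s) * (L * dist u w)) integrable_on {0..t}"
        using expint[OF that] by (intro integrable_on_mult_left) auto
      fix s assume "s \<in> {0..t}"
      have "norm (F u s - F w s) \<le> L * norm (exp (2 * L * s) *\<^sub>R (apply_bcontfun u s - apply_bcontfun w s))"
        using lip[of s "\<xi> + exp (2 * L * s) *\<^sub>R apply_bcontfun u s" "\<xi> + exp (2 * L * s) *\<^sub>R apply_bcontfun w s"]
        by (simp add: F_def scaleR_diff_right)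
      also have "\<dots> = L * (exp (2 * L * s) * dist (apply_bcontfun u s) (apply_bcontfun w s))"
        by (simp add: dist_norm)
      also have "\<dots> \<le> L * (exp (2 * L * s) * dist u w)"
        using L by (intro mult_left_mono dist_bounded) auto
      finally show "norm (F u s - F w s) \<le> exp (2 * L * s) * (L * dist u w)" by (simp add: mult_ac)
    qed
    also have "\<dots> = (exp (2 * L * t) - 1) / (2 * L) * (L * dist u w)"
      using expint[OF that] by (intro integral_unique has_integral_mult_left)
    also have "\<dots> = (exp (2 * L * t) - 1) / 2 * dist u w" using L by simp
    finally show ?thesis by (simp add: integral_diff[OF F_int F_int])
  qed
  have P_lip: "norm (P u t - P w t) \<le> 1/2 * dist u w" for u w t
  proof -
    let ?t = "max 0 t"
    have "norm (P u t - P w t) = exp (- 2 * L * ?t) * norm (integral {0..?t} (F u) - integral {0..?t} (F w))"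
      unfolding P_def by (simp flip: scaleR_diff_right)
    also have "\<dots> \<le> exp (- 2 * L * ?t) * ((exp (2 * L * ?t) - 1) / 2 * dist u w)"
      by (intro mult_left_mono F_diff) auto
    also have "\<dots> = (1 - exp (- 2 * L * ?t)) / 2 * dist u w"
      by (simp add: algebra_simps flip: exp_add)
    also have "\<dots> \<le> 1 / 2 * dist u w"
      by (intro mult_right_mono) auto
    finally show ?thesis .
  qed
  \<comment> \<open>The image of 0 is bounded since y exp(-y) \<le> 1 for y = 2Lt; with the
    contraction estimate this makes every \<open>P u\<close> bounded.\<close>
  have P0: "norm (P 0 t) \<le> B / (2 * L)" for t
  proof -
    let ?t = "max 0 t"
    have "norm (integral {0..?t} (F 0)) \<le> B * (?t - 0)"
      by (rule integral_bound) (use F_cont[of _ 0] bd in \<open>auto simp: F_def[of 0] cong: continuous_on_cong\<close>)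
    then have "norm (P 0 t) \<le> exp (- 2 * L * ?t) * (B * ?t)"
      unfolding P_def by (simp add: mult_left_mono)
    also have "\<dots> = B / (2 * L) * (exp (- 2 * L * ?t) * (2 * L * ?t))" using L by (simp add: field_simps)
    also have "\<dots> \<le> B / (2 * L) * 1"
    proof (intro mult_left_mono)
      have "2 * L * ?t \<le> exp (2 * L * ?t)" using exp_ge_add_one_self[of "2 * L * ?t"] by linarith
      then have "exp (- 2 * L * ?t) * (2 * L * ?t) \<le> exp (- 2 * L * ?t) * exp (2 * L * ?t)"
        by (intro mult_left_mono) auto
      also have "\<dots> = 1" by (simp flip: exp_add)
      finally show "exp (- 2 * L * ?t) * (2 * L * ?t) \<le> 1" .
    qed (use B0 L in auto)
    finally show ?thesis by simp
  qed
  have I_deriv: "((\<lambda>t. integral {0..t} (F u)) has_vector_derivative F u t) (at t within {0..})" if "t \<ge> 0" for u t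
  proof -
    have "((\<lambda>t. integral {0..t} (F u)) has_vector_derivative F u t) (at t within {0..t+1})"
      by (rule integral_has_vector_derivative[OF F_cont]) (use that in auto)
    moreover have "at t within {0..t+1} = at t within {0..}"
      by (rule at_within_nhd[of _ "{..<t+1}"]) (use that in auto)
    ultimately show ?thesis by simp
  qed
  have P_cont: "continuous_on UNIV (P u)" for u
  proof -
    have "continuous_on {0..} (\<lambda>t. integral {0..t} (F u))"
      using I_deriv has_vector_derivative_continuous continuous_on_eq_continuous_within by (metis atLeast_iff)
    then have "continuous_on UNIV (\<lambda>t. integral {0..max 0 t} (F u))"
      by (rule continuous_on_compose2) (auto intro!: continuous_intros)
    then show ?thesis unfolding P_def by (intro continuous_intros)
  qed
  have P_bcont: "P u \<in> bcontfun" for u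
  proof (rule bcontfun_normI[OF P_cont])
    fix t
    have "norm (P u t) \<le> norm (P u t - P 0 t) + norm (P 0 t)" by norm
    also have "\<dots> \<le> 1/2 * dist u 0 + B / (2 * L)" by (intro add_mono P_lip P0)
    finally show "norm (P u t) \<le> 1/2 * dist u 0 + B / (2 * L)" .
  qed
  have "\<exists>!u. Bcontfun (P u) = u"
  proof (rule banach_fix_type[where c="1/2"])
    show "\<forall>u w. dist (Bcontfun (P u)) (Bcontfun (P w)) \<le> 1/2 * dist u w"
      by (intro allI dist_bound) (use P_lip P_bcont in \<open>simp add: Bcontfun_inverse dist_norm\<close>)
  qed auto
  then obtain u where u: "Bcontfun (P u) = u" by auto
  then have uP: "apply_bcontfun u t = P u t" for t using Bcontfun_inverse[OF P_bcont] by metis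
  define x where "x t = \<xi> + integral {0..t} (F u)" for t
  have xF: "F u t = f t (x t)" if "t \<ge> 0" for t
    using that by (simp add: F_def uP P_def x_def flip: exp_add)
  show thesis
  proof
    show "x 0 = \<xi>" by (simp add: x_def)
    show "(x has_vector_derivative f t (x t)) (at t within {0..})" if "t \<ge> 0" for t
    proof -
      have "(x has_vector_derivative F u t) (at t within {0..})"
        using I_deriv[OF that, of u] unfolding x_def[abs_def] by (auto intro!: derivative_eq_intros)
      then show ?thesis by (simp only: xF[OF that])
    qed
  qed
qed

text \<open>The backward half is the forward theorem for the reversed field - f(\<tau> - t). The
  halves are glued at \<tau>, where both one-sided derivatives equal f(\<tau>, \<xi>).\<close>

lemma picard_global:
  fixes f :: "real \<Rightarrow> 'a::euclidean_space \<Rightarrow> 'a"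
  assumes cont: "continuous_on UNIV (\<lambda>(t, x). f t x)"
    and lip: "\<And>t x y. norm (f t x - f t y) \<le> L * norm (x - y)"
    and L: "L > 0"
    and bd: "\<And>t. norm (f t \<xi>) \<le> B"
  obtains x where "x \<tau> = \<xi>" and "\<And>t. (x has_vector_derivative f t (x t)) (at t)"
proof -
  have c1: "continuous_on UNIV (\<lambda>(t, x). f (\<tau> + t) x)"
  proof -
    have "continuous_on UNIV (\<lambda>z. (\<lambda>(t, x). f t x) (\<tau> + fst z, snd z))"
      by (rule continuous_on_compose2[OF cont]) (auto intro!: continuous_intros)
    then show ?thesis by (auto simp: case_prod_beta intro!: continuous_intros)
  qed
  have c2: "continuous_on UNIV (\<lambda>(t, x). - f (\<tau> - t) x)"
  proof -
    have "continuous_on UNIV (\<lambda>z. (\<lambda>(t, x). f t x) (\<tau> - fst z, snd z))"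
      by (rule continuous_on_compose2[OF cont]) (auto intro!: continuous_intros)
    then show ?thesis by (auto simp: case_prod_beta intro!: continuous_intros)
  qed
  obtain x where x: "x 0 = \<xi>" "\<And>t. t \<ge> 0 \<Longrightarrow> (x has_vector_derivative f (\<tau> + t) (x t)) (at t within {0..})"
    using picard_forward[OF c1 lip L bd] by metis
  have lip': "norm (- f t x - - f t y) \<le> L * norm (x - y)" for t x y
    using lip[of t x y] by (metis minus_diff_minus norm_minus_cancel)
  obtain y where y: "y 0 = \<xi>" "\<And>t. t \<ge> 0 \<Longrightarrow> (y has_vector_derivative - f (\<tau> - t) (y t)) (at t within {0..})"
    using picard_forward[OF c2 lip' L, of \<xi> B] bd by auto
  define z where "z t = (if t \<ge> \<tau> then x (t - \<tau>) else y (\<tau> - t))" for t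
  have zr: "(z has_vector_derivative f t (z t)) (at t within {\<tau>..})" if "t \<ge> \<tau>" for t
  proof -
    have x': "(x has_vector_derivative f (\<tau> + (t - \<tau>)) (x (t - \<tau>))) (at (t - \<tau>) within (\<lambda>t. t - \<tau>) ` {\<tau>..})"
      by (rule has_vector_derivative_within_subset[OF x(2)]) (use that in auto)
    have "((x \<circ> (\<lambda>t. t - \<tau>)) has_vector_derivative 1 *\<^sub>R f (\<tau> + (t - \<tau>)) (x (t - \<tau>))) (at t within {\<tau>..})"
      by (rule vector_diff_chain_within[OF _ x']) (auto intro!: derivative_eq_intros)
    then have "((\<lambda>t. x (t - \<tau>)) has_vector_derivative f t (z t)) (at t within {\<tau>..})"
      using that by (simp add: o_def z_def)
    then show ?thesis
      by (rule has_vector_derivative_transform[rotated 2]) (use that in \<open>auto simp: z_def\<close>)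
  qed
  have zl: "(z has_vector_derivative f t (z t)) (at t within {..\<tau>})" if "t \<le> \<tau>" for t
  proof -
    have y': "(y has_vector_derivative - f (\<tau> - (\<tau> - t)) (y (\<tau> - t))) (at (\<tau> - t) within (\<lambda>t. \<tau> - t) ` {..\<tau>})"
      by (rule has_vector_derivative_within_subset[OF y(2)]) (use that in auto)
    have "((y \<circ> (\<lambda>t. \<tau> - t)) has_vector_derivative (-1) *\<^sub>R (- f (\<tau> - (\<tau> - t)) (y (\<tau> - t)))) (at t within {..\<tau>})"
      by (rule vector_diff_chain_within[OF _ y']) (auto intro!: derivative_eq_intros)
    then have "((\<lambda>t. y (\<tau> - t)) has_vector_derivative f t (z t)) (at t within {..\<tau>})"
      using that x(1) y(1) by (cases "t = \<tau>") (simp_all add: o_def z_def)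
    then show ?thesis
      by (rule has_vector_derivative_transform[rotated 2]) (use that x(1) y(1) in \<open>auto simp: z_def\<close>)
  qed
  show thesis
  proof
    show "z \<tau> = \<xi>" by (simp add: z_def x)
    fix t
    consider "t < \<tau>" | "t = \<tau>" | "t > \<tau>" by linarith
    then show "(z has_vector_derivative f t (z t)) (at t)"
    proof cases
      case 1
      then have "at t within {..\<tau>} = at t" by (intro at_within_interior) (simp add: interior_real_atMost)
      with zl[of t] 1 show ?thesis by simp
    next
      case 2
      have "(z has_derivative (\<lambda>h. h *\<^sub>R f t (z t))) (at t within {..\<tau>} \<union> {\<tau>..})"
        using zl[of t] zr[of t] 2 unfolding has_vector_derivative_def has_derivative_within
        by (auto intro: Lim_Un)
      moreover have "{..\<tau>} \<union> {\<tau>..} = UNIV" by auto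
      ultimately show ?thesis by (simp add: has_vector_derivative_def)
    next
      case 3
      then have "at t within {\<tau>..} = at t" by (intro at_within_interior) (simp add: interior_real_atLeast)
      with zr[of t] 3 show ?thesis by simp
    qed
  qed
qed

text \<open>The squared distance \<open>h\<close> is differentiable also where the curves meet, and
  its derivative is bounded by 2Lh in absolute value: exp(-2Lt) h is nonincreasing and exp(2Lt) h is
  nondecreasing. Hence the estimate runs forwards and backwards in time.\<close>

lemma flow_gronwall:
  fixes x y :: "real \<Rightarrow> 'a::real_inner"
  assumes x: "\<And>t. t \<in> {a..b} \<Longrightarrow> (x has_vector_derivative F t) (at t within {a..b})"
    and y: "\<And>t. t \<in> {a..b} \<Longrightarrow> (y has_vector_derivative G t) (at t within {a..b})"
    and FG: "\<And>t. t \<in> {a..b} \<Longrightarrow> norm (F t - G t) \<le> L * norm (x t - y t)"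
    and st: "s \<in> {a..b}" "t \<in> {a..b}"
  shows "norm (x t - y t) \<le> exp (L * \<bar>t - s\<bar>) * norm (x s - y s)"
proof -
  define h where "h t = (x t - y t) \<bullet> (x t - y t)" for t
  have h: "(h has_real_derivative 2 * ((x t - y t) \<bullet> (F t - G t))) (at t within {a..b})" if "t \<in> {a..b}" for t
    unfolding h_def has_field_derivative_def
    using x[OF that] y[OF that] unfolding has_vector_derivative_def
    by (auto intro!: derivative_eq_intros simp: inner_commute algebra_simps)
  have hb: "\<bar>2 * ((x t - y t) \<bullet> (F t - G t))\<bar> \<le> 2 * L * h t" if "t \<in> {a..b}" for t
  proof -
    have "\<bar>(x t - y t) \<bullet> (F t - G t)\<bar> \<le> norm (x t - y t) * (L * norm (x t - y t))"
      using Cauchy_Schwarz_ineq2 FG[OF that] by (meson mult_left_mono norm_ge_zero order_trans)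
    then show ?thesis by (simp add: h_def dot_square_norm power2_eq_square mult_ac)
  qed
  have sq: "norm (x q - y q) \<le> exp (L * d) * norm (x p - y p)"
    if "h q \<le> exp (2 * L * d) * h p" for p q d
  proof (rule power2_le_imp_le)
    show "(norm (x q - y q))\<^sup>2 \<le> (exp (L * d) * norm (x p - y p))\<^sup>2"
      using that by (simp add: h_def dot_square_norm power_mult_distrib exp_double[symmetric] mult_ac)
  qed auto
  have dn: "h q \<le> exp (2 * L * (q - p)) * h p" if "p \<le> q" "p \<in> {a..b}" "q \<in> {a..b}" for p q
  proof -
    have "exp (- 2 * L * q) * h q \<le> exp (- 2 * L * p) * h p"
    proof (rule DERIV_nonpos_imp_decreasing_open[OF that(1)])
      fix r assume r: "p < r" "r < q"
      then have rab: "r \<in> {a..b}" "at r within {a..b} = at r"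
        using that by (auto intro!: at_within_interior)
      have "((\<lambda>t. exp (- 2 * L * t) * h t) has_real_derivative
          exp (- 2 * L * r) * (2 * ((x r - y r) \<bullet> (F r - G r)) - 2 * L * h r)) (at r)"
        using h[OF rab(1)] unfolding rab(2) by (auto intro!: derivative_eq_intros simp: algebra_simps)
      moreover have "exp (- 2 * L * r) * (2 * ((x r - y r) \<bullet> (F r - G r)) - 2 * L * h r) \<le> 0"
        using hb[OF rab(1)] by (intro mult_nonneg_nonpos) auto
      ultimately show "\<exists>d. ((\<lambda>t. exp (- 2 * L * t) * h t) has_real_derivative d) (at r) \<and> d \<le> 0" by blast
    next
      have "continuous_on {a..b} h"
        using h DERIV_continuous continuous_on_eq_continuous_within by blast
      then show "continuous_on {p..q} (\<lambda>t. exp (- 2 * L * t) * h t)"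
        using that by (intro continuous_intros) (auto elim: continuous_on_subset)
    qed
    then have "exp (2 * L * q) * (exp (- 2 * L * q) * h q) \<le> exp (2 * L * q) * (exp (- 2 * L * p) * h p)"
      by (intro mult_left_mono) auto
    then show ?thesis by (simp add: algebra_simps flip: exp_add mult.assoc)
  qed
  have up: "h p \<le> exp (2 * L * (q - p)) * h q" if "p \<le> q" "p \<in> {a..b}" "q \<in> {a..b}" for p q
  proof -
    have "exp (2 * L * p) * h p \<le> exp (2 * L * q) * h q"
    proof (rule DERIV_nonneg_imp_increasing_open[OF that(1)])
      fix r assume r: "p < r" "r < q"
      then have rab: "r \<in> {a..b}" "at r within {a..b} = at r"
        using that by (auto intro!: at_within_interior)
      have "((\<lambda>t. exp (2 * L * t) * h t) has_real_derivative
          exp (2 * L * r) * (2 * ((x r - y r) \<bullet> (F r - G r)) + 2 * L * h r)) (at r)"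
        using h[OF rab(1)] unfolding rab(2) by (auto intro!: derivative_eq_intros simp: algebra_simps)
      moreover have "exp (2 * L * r) * (2 * ((x r - y r) \<bullet> (F r - G r)) + 2 * L * h r) \<ge> 0"
        using hb[OF rab(1)] by (intro mult_nonneg_nonneg) auto
      ultimately show "\<exists>d. ((\<lambda>t. exp (2 * L * t) * h t) has_real_derivative d) (at r) \<and> 0 \<le> d" by blast
    next
      have "continuous_on {a..b} h"
        using h DERIV_continuous continuous_on_eq_continuous_within by blast
      then show "continuous_on {p..q} (\<lambda>t. exp (2 * L * t) * h t)"
        using that by (intro continuous_intros) (auto elim: continuous_on_subset)
    qed
    then have "exp (- 2 * L * p) * (exp (2 * L * p) * h p) \<le> exp (- 2 * L * p) * (exp (2 * L * q) * h q)"
      by (intro mult_left_mono) auto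
    then show ?thesis by (simp add: algebra_simps flip: exp_add mult.assoc)
  qed
  show ?thesis
    by (cases "s \<le> t") (use dn[of s t] up[of t s] st in \<open>auto intro!: sq\<close>)
qed


section \<open>Nagumo's invariance theorem\<close>

text \<open>The last hypothesis says that the lower right Dini derivative is at most 0. After
  subtracting a line of small slope, the last point at which the function is at most its initial
  value cannot precede \<open>b\<close>, because the Dini condition provides a later one.\<close>

lemma lower_Dini_decreasing:
  fixes f :: "real \<Rightarrow> real"
  assumes ab: "a \<le> b"
    and cont: "continuous_on {a..b} f"
    and dini: "\<And>t e d. a \<le> t \<Longrightarrow> t < b \<Longrightarrow> 0 < e \<Longrightarrow> 0 < d \<Longrightarrow> \<exists>h. 0 < h \<and> h < d \<and> f (t + h) \<le> f t + e * h"
  shows "f b \<le> f a"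
proof (rule ccontr)
  assume "\<not> f b \<le> f a"
  then have fab: "f a < f b" and ab: "a < b" using ab by (auto simp: less_le)
  \<comment> \<open>Half the mean slope: positive, yet small enough that the tilted function is
    still larger at \<open>b\<close> than at \<open>a\<close>.\<close>
  define e where "e = (f b - f a) / 2 / (b - a)"
  have e: "e > 0" "2 * e * (b - a) = f b - f a" using fab ab by (simp_all add: e_def del: right_diff_distrib_numeral left_diff_distrib_numeral)
  define g' where "g' t = f t - e * (t - a)" for t
  have g'c: "continuous_on {a..b} g'" unfolding g'_def by (intro continuous_intros cont)
  have gb: "g' a < g' b" using e fab ab by (simp add: g'_def algebra_simps)
  define S where "S = {a..b} \<inter> g' -` {..g' a}"
  have S: "closed S"
    unfolding S_def by (rule continuous_closed_preimage[OF g'c]) auto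
  have aS: "a \<in> S" using ab by (simp add: S_def)
  have bdd: "bdd_above S" by (rule bdd_aboveI[of _ b]) (auto simp: S_def)
  define t where "t = Sup S"
  have tS: "t \<in> S" unfolding t_def using closed_contains_Sup[OF _ bdd S] aS by auto
  then have t: "a \<le> t" "t < b" "g' t \<le> g' a" using gb by (auto simp: S_def less_le)
  obtain h where h: "0 < h" "h < b - t" "f (t + h) \<le> f t + e * h"
    using dini[of t e "b - t"] t e by auto
  then have "g' (t + h) \<le> g' t" by (simp add: g'_def algebra_simps)
  then have "t + h \<in> S" using t h by (auto simp: S_def)
  then have "t + h \<le> t" unfolding t_def by (rule cSup_upper[OF _ bdd])
  then show False using h by simp
qed

lemma contingent_cone_approx:
  fixes K :: "'a::euclidean_space set"
  assumes "z \<in> contingent_cone K y" "0 < e" "0 < d"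
  obtains h where "0 < h" "h < d" "infdist (y + h *\<^sub>R z) K \<le> e * h"
proof (rule ccontr)
  assume "\<not> thesis"
  then have "e * h < infdist (y + h *\<^sub>R z) K" if "0 < h" "h < d" for h
    using that \<open>\<And>h. \<lbrakk>0 < h; h < d; infdist (y + h *\<^sub>R z) K \<le> e * h\<rbrakk> \<Longrightarrow> thesis\<close> by force
  then have "ereal e \<le> ereal (infdist (y + h *\<^sub>R z) K / h)" if "0 < h" "h < d" for h
    using that by (simp add: pos_le_divide_eq less_imp_le)
  then have "eventually (\<lambda>h. ereal e \<le> ereal (infdist (y + h *\<^sub>R z) K / h)) (at_right 0)"
    unfolding eventually_at_right_field using assms(3) by blast
  then have "ereal e \<le> Liminf (at_right 0) (\<lambda>h. ereal (infdist (y + h *\<^sub>R z) K / h))"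
    by (rule Liminf_bounded)
  then show False using assms(1,2) by (simp add: contingent_cone_def)
qed

text \<open>With \<open>y \<in> K\<close> nearest to \<open>x t\<close>, moving \<open>y\<close> along \<open>f t y\<close> stays close to \<open>K\<close>, so
  the lower Dini derivative of the distance \<open>g\<close> is at most \<open>L * g\<close>.\<close>

lemma nagumo_invariance:
  fixes K :: "'a::euclidean_space set"
  assumes K: "compact K"
    and x: "\<And>t. t \<in> {a..b} \<Longrightarrow> (x has_vector_derivative f t (x t)) (at t within {a..b})"
    and lip: "\<And>t y z. t \<in> {a..b} \<Longrightarrow> norm (f t y - f t z) \<le> L * norm (y - z)"
    and tan: "\<And>t y. t \<in> {a..b} \<Longrightarrow> y \<in> K \<Longrightarrow> f t y \<in> contingent_cone K y"
    and xa: "x a \<in> K" and L: "L > 0"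
    and t: "t \<in> {a..b}"
  shows "x t \<in> K"
proof -
  define g where "g t = infdist (x t) K" for t
  have xc: "continuous_on {a..b} x"
    using x has_vector_derivative_continuous continuous_on_eq_continuous_within by blast
  have gc: "continuous_on {a..b} g"
    unfolding g_def by (intro continuous_on_infdist xc)
  have Kne: "K \<noteq> {}" using xa by auto
  \<comment> \<open>The error \<open>e * h\<close> is one half from the differentiability of
    \<open>x\<close> and one half from the tangency at the nearest point; the Lipschitz bound
    between \<open>x s\<close> and that point contributes \<open>L * h * g s\<close>.\<close>
  have step: "\<exists>h. 0 < h \<and> h < d \<and> g (s + h) \<le> (1 + L * h) * g s + e * h"
    if s: "a \<le> s" "s < b" and e: "0 < e" and d: "0 < d" for s e d
  proof -
    obtain y where y: "y \<in> K" "g s = dist (x s) y"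
      unfolding g_def using infdist_attains_inf[OF compact_imp_closed[OF K] Kne] by blast
    have "((\<lambda>r. (x r - x s - (r - s) *\<^sub>R f s (x s)) /\<^sub>R norm (r - s)) \<longlongrightarrow> 0) (at s within {a..b})"
      using x[of s] s unfolding has_vector_derivative_def has_derivative_within
      by (simp add: diff_diff_eq divide_inverse)
    then have "eventually (\<lambda>r. dist ((x r - x s - (r - s) *\<^sub>R f s (x s)) /\<^sub>R norm (r - s)) 0 < e/2) (at s within {a..b})"
      using e by (intro tendstoD) auto
    then obtain d1 where d1: "d1 > 0"
      "\<And>r. r \<in> {a..b} \<Longrightarrow> r \<noteq> s \<Longrightarrow> dist r s < d1 \<Longrightarrow> norm ((x r - x s - (r - s) *\<^sub>R f s (x s)) /\<^sub>R norm (r - s)) < e/2"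
      unfolding eventually_at by auto
    obtain h where h: "0 < h" "h < min d (min d1 (b - s))" "infdist (y + h *\<^sub>R f s y) K \<le> e/2 * h"
      using contingent_cone_approx[OF tan[of s y], of "e/2" "min d (min d1 (b - s))"] y s e d d1(1) by auto
    have hn: "norm (x (s + h) - x s - h *\<^sub>R f s (x s)) \<le> e/2 * h"
    proof -
      have "norm ((x (s + h) - x s - h *\<^sub>R f s (x s)) /\<^sub>R h) < e/2"
        using d1(2)[of "s + h"] h s by (simp add: dist_real_def)
      moreover have "norm ((x (s + h) - x s - h *\<^sub>R f s (x s)) /\<^sub>R h) = norm (x (s + h) - x s - h *\<^sub>R f s (x s)) / h"
        using h(1) by (simp add: divide_inverse mult.commute)
      ultimately show ?thesis using h(1) by (simp only: pos_divide_less_eq less_imp_le)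
    qed
    have "g (s + h) \<le> infdist (y + h *\<^sub>R f s y) K + dist (x (s + h)) (y + h *\<^sub>R f s y)"
      unfolding g_def by (rule infdist_triangle)
    also have "dist (x (s + h)) (y + h *\<^sub>R f s y) \<le>
        norm (x (s + h) - x s - h *\<^sub>R f s (x s)) + norm (x s - y) + norm (h *\<^sub>R (f s (x s) - f s y))"
    proof -
      have eq: "x (s + h) - (y + h *\<^sub>R f s y) =
          (x (s + h) - x s - h *\<^sub>R f s (x s)) + (x s - y) + h *\<^sub>R (f s (x s) - f s y)"
        by (simp add: algebra_simps)
      show ?thesis unfolding dist_norm eq
        by (rule order_trans[OF norm_triangle_ineq add_right_mono[OF norm_triangle_ineq]])
    qed
    also have "norm (h *\<^sub>R (f s (x s) - f s y)) \<le> h * (L * norm (x s - y))"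
      using h(1) lip[of s "x s" y] s by (simp add: mult_left_mono)
    finally have "g (s + h) \<le> (1 + L * h) * g s + e * h"
      using hn h(3) y(2) by (simp add: dist_norm algebra_simps)
    then show ?thesis using h by auto
  qed
  have "exp (- L * t) * g t \<le> exp (- L * a) * g a"
  proof (rule lower_Dini_decreasing[where a=a and b=t and f="\<lambda>t. exp (- L * t) * g t"])
    show "a \<le> t" using t by simp
    show "continuous_on {a..t} (\<lambda>t. exp (- L * t) * g t)"
      by (intro continuous_intros continuous_on_subset[OF gc]) (use t in auto)
    fix s e d :: real assume s: "a \<le> s" "s < t" and e: "0 < e" and d: "0 < d"
    have sb: "s < b" using s t by simp
    \<comment> \<open>With this choice the slack \<open>2 * e' * h\<close> found below becomes
      exactly \<open>e * h\<close> after multiplication by exp(-Ls).\<close>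
    define e' where "e' = e * exp (L * s) / 2"
    have e': "e' > 0" using e by (simp add: e'_def)
    \<comment> \<open>The contributions of exp(-Lh) and 1 + Lh to the derivative at 0 cancel, so
      only \<open>e'\<close> remains, and the difference quotient is below \<open>2 * e'\<close> for
      small h.\<close>
    have "((\<lambda>h. exp (- L * h) * (1 + L * h) * g s + exp (- L * h) * e' * h) has_real_derivative e') (at 0)"
      by (rule derivative_eq_intros refl)+ simp
    then have "((\<lambda>h. ((exp (- L * h) * (1 + L * h) * g s + exp (- L * h) * e' * h) - g s) / h) \<longlongrightarrow> e') (at 0)"
      by (simp add: DERIV_def)
    then have "eventually (\<lambda>h. ((exp (- L * h) * (1 + L * h) * g s + exp (- L * h) * e' * h) - g s) / h < 2 * e') (at 0)"
      using e' by (intro order_tendstoD) auto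
    then obtain d2 where d2: "d2 > 0" "\<And>h. h \<noteq> 0 \<Longrightarrow> dist h 0 < d2 \<Longrightarrow>
        ((exp (- L * h) * (1 + L * h) * g s + exp (- L * h) * e' * h) - g s) / h < 2 * e'"
      unfolding eventually_at by auto
    obtain h where h: "0 < h" "h < min d d2" "g (s + h) \<le> (1 + L * h) * g s + e' * h"
      using step[OF s(1) sb e', of "min d d2"] d d2 by auto
    have "exp (- L * h) * g (s + h) \<le> exp (- L * h) * ((1 + L * h) * g s + e' * h)"
      using h(3) by (intro mult_left_mono) auto
    also have "\<dots> \<le> g s + 2 * e' * h"
    proof -
      have "((exp (- L * h) * (1 + L * h) * g s + exp (- L * h) * e' * h) - g s) / h < 2 * e'"
        using d2(2)[of h] h by simp
      then have "(exp (- L * h) * (1 + L * h) * g s + exp (- L * h) * e' * h) - g s < 2 * e' * h"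
        by (simp only: pos_divide_less_eq[OF h(1)])
      then show ?thesis by (simp only: distrib_left distrib_right mult.assoc)
    qed
    finally have "exp (- L * s) * (exp (- L * h) * g (s + h)) \<le> exp (- L * s) * (g s + 2 * e' * h)"
      by (intro mult_left_mono) auto
    also have "\<dots> = exp (- L * s) * g s + e * h"
      by (simp add: e'_def algebra_simps flip: exp_add)
    finally have "exp (- L * (s + h)) * g (s + h) \<le> exp (- L * s) * g s + e * h"
      by (simp add: algebra_simps flip: exp_add mult.assoc)
    then show "\<exists>h. 0 < h \<and> h < d \<and> exp (- L * (s + h)) * g (s + h) \<le> exp (- L * s) * g s + e * h"
      using h by auto
  qed
  then have "g t \<le> 0" using xa by (simp add: g_def mult_le_0_iff)
  then have "infdist (x t) K = 0" using infdist_nonneg[of "x t" K] by (simp add: g_def)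
  then show ?thesis using in_closed_iff_infdist_zero[OF compact_imp_closed[OF K] Kne] by simp
qed

text \<open>McShane's formula, applied to each component.\<close>

lemma lipschitz_extension:
  fixes f :: "real \<Rightarrow> 'a::euclidean_space \<Rightarrow> 'a"
  assumes K: "compact K" "K \<noteq> {}" and I: "compact I"
    and cont: "continuous_on (I \<times> K) (\<lambda>(t, x). f t x)"
    and lip: "\<And>t x y. t \<in> I \<Longrightarrow> x \<in> K \<Longrightarrow> y \<in> K \<Longrightarrow> norm (f t x - f t y) \<le> L * norm (x - y)"
    and L: "L > 0"
  obtains g L' where "continuous_on (I \<times> UNIV) (\<lambda>(t, x). g t x)"
    and "\<And>t x y. t \<in> I \<Longrightarrow> norm (g t x - g t y :: 'a) \<le> L' * norm (x - y)" "L' > 0"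
    and "\<And>t x. t \<in> I \<Longrightarrow> x \<in> K \<Longrightarrow> g t x = f t x"
proof -
  define m where "m b t x = (INF y\<in>K. f t y \<bullet> b + L * dist x y)" for b t x
  have bdd: "bdd_below ((\<lambda>y. f t y \<bullet> b + L * dist x y) ` K)" if "t \<in> I" for t b x
  proof -
    have "continuous_on K (\<lambda>y. (\<lambda>(t, x). f t x) (t, y))"
      by (rule continuous_on_compose2[OF cont]) (use that in \<open>auto intro!: continuous_intros\<close>)
    then have "continuous_on K (\<lambda>y. f t y \<bullet> b + L * dist x y)" by (auto intro!: continuous_intros)
    then have "compact ((\<lambda>y. f t y \<bullet> b + L * dist x y) ` K)" using K by (intro compact_continuous_image)
    then show ?thesis by (intro bounded_imp_bdd_below compact_imp_bounded)
  qed
  \<comment> \<open>One estimate for two purposes: with equal times and \<open>e = 0\<close> it is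
    the Lipschitz bound in x, and with \<open>e\<close> a modulus of continuity in time it gives
    joint continuity.\<close>
  have m_le: "m b t x \<le> m b t' x' + L * dist x x' + e"
    if "t \<in> I" "t' \<in> I" and le: "\<And>y. y \<in> K \<Longrightarrow> f t y \<bullet> b \<le> f t' y \<bullet> b + e" for b t t' x x' e
  proof -
    have "m b t x - L * dist x x' - e \<le> m b t' x'"
      unfolding m_def[of b t' x']
    proof (rule cINF_greatest[OF K(2)])
      fix y assume y: "y \<in> K"
      have "m b t x \<le> f t y \<bullet> b + L * dist x y"
        unfolding m_def by (rule cINF_lower[OF bdd y]) fact
      also have "L * dist x y \<le> L * (dist x x' + dist x' y)"
        using L by (intro mult_left_mono dist_triangle) auto
      finally show "m b t x - L * dist x x' - e \<le> f t' y \<bullet> b + L * dist x' y"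
        using le[OF y] by (simp add: algebra_simps)
    qed
    then show ?thesis by simp
  qed
  have m_lip: "\<bar>m b t x - m b t y\<bar> \<le> L * norm (x - y)" if "t \<in> I" for b t x y
    using m_le[of t t b 0 x y] m_le[of t t b 0 y x] that by (simp add: dist_norm norm_minus_commute abs_le_iff)
  have m_eq: "m b t x = f t x \<bullet> b" if t: "t \<in> I" and x: "x \<in> K" and b: "b \<in> Basis" for b t x
  proof (rule antisym)
    show "m b t x \<le> f t x \<bullet> b"
      using cINF_lower[OF bdd[OF t] x, of b x] by (simp add: m_def)
    show "f t x \<bullet> b \<le> m b t x"
      unfolding m_def
    proof (rule cINF_greatest[OF K(2)])
      fix y assume y: "y \<in> K"
      have "(f t x - f t y) \<bullet> b \<le> norm (f t x - f t y)"
        using Basis_le_norm[OF b] abs_le_D1 by blast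
      also have "\<dots> \<le> L * norm (x - y)" by (rule lip[OF t x y])
      finally show "f t x \<bullet> b \<le> f t y \<bullet> b + L * dist x y" by (simp add: inner_diff_left dist_norm)
    qed
  qed
  have m_cont: "continuous_on (I \<times> UNIV) (\<lambda>(t, x). m b t x)" if b: "b \<in> Basis" for b
    unfolding continuous_on_iff
  proof (intro ballI allI impI)
    fix z :: "real \<times> 'a" and e :: real assume z: "z \<in> I \<times> UNIV" and e: "0 < e"
    \<comment> \<open>The infimum runs over all y in \<open>K\<close>, so the modulus of continuity
      in time must not depend on y.\<close>
    have "uniformly_continuous_on (I \<times> K) (\<lambda>(t, x). f t x)"
      using cont K I by (intro compact_uniformly_continuous compact_Times)
    then obtain d where d: "d > 0" "\<And>p q. p \<in> I \<times> K \<Longrightarrow> q \<in> I \<times> K \<Longrightarrow> dist q p < d \<Longrightarrow>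
        dist (case q of (t, x) \<Rightarrow> f t x) (case p of (t, x) \<Rightarrow> f t x) < e/2"
      unfolding uniformly_continuous_on_def using e by (metis half_gt_zero)
    have td: "f t y \<bullet> b \<le> f t' y \<bullet> b + e/2" if "t \<in> I" "t' \<in> I" "y \<in> K" "dist t t' < d" for t t' y
    proof -
      have "(f t y - f t' y) \<bullet> b \<le> norm (f t y - f t' y)"
        using Basis_le_norm[OF b] abs_le_D1 by blast
      also have "\<dots> < e/2" using d(2)[of "(t', y)" "(t, y)"] that by (simp add: dist_Pair_Pair dist_norm)
      finally show ?thesis by (simp add: inner_diff_left)
    qed
    define d' where "d' = min d (e / (2 * L))"
    have "dist (m b t x) (m b (fst z) (snd z)) < e" if tx: "t \<in> I" "dist (t, x) z < d'" for t x
    proof -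
      obtain t' x' where z': "z = (t', x')" by (cases z)
      have dd: "dist t t' < d" "dist x x' < e / (2 * L)"
        using tx(2) dist_fst_le[of "(t, x)" z] dist_snd_le[of "(t, x)" z] by (auto simp: z' d'_def)
      then have "L * dist x x' < e / 2" using L by (simp add: field_simps)
      moreover have "m b t x \<le> m b t' x' + L * dist x x' + e/2"
        by (rule m_le) (use td dd tx z z' in auto)
      moreover have "m b t' x' \<le> m b t x + L * dist x' x + e/2"
        by (rule m_le) (use td dd tx z z' in \<open>auto simp: dist_commute\<close>)
      ultimately show ?thesis by (simp add: z' dist_real_def dist_commute abs_less_iff)
    qed
    then show "\<exists>d>0. \<forall>q\<in>I \<times> UNIV. dist q z < d \<longrightarrow> dist (case q of (t, x) \<Rightarrow> m b t x) (case z of (t, x) \<Rightarrow> m b t x) < e"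
      using d(1) e L by (intro exI[of _ d']) (auto simp: d'_def case_prod_beta)
  qed
  define g where "g t x = (\<Sum>b\<in>Basis. m b t x *\<^sub>R b)" for t and x :: 'a
  show thesis
  \<comment> \<open>Each component keeps the constant \<open>L\<close>; adding the components costs
    the factor \<open>DIM('a)\<close>.\<close>
  proof (rule that[of g "L * DIM('a)"])
    show "continuous_on (I \<times> UNIV) (\<lambda>(t, x). g t x)"
      using m_cont unfolding g_def case_prod_beta by (auto intro!: continuous_intros)
    show "0 < L * DIM('a)" using L by simp
    show "g t x = f t x" if "t \<in> I" "x \<in> K" for t x
      using that m_eq by (simp add: g_def euclidean_representation)
    fix t and x y :: 'a assume t: "t \<in> I"
    have "norm (g t x - g t y) = norm (\<Sum>b\<in>Basis. (m b t x - m b t y) *\<^sub>R b)"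
      by (simp add: g_def sum_subtractf scaleR_diff_left)
    also have "\<dots> \<le> (\<Sum>b\<in>(Basis::'a set). L * norm (x - y))"
      using m_lip[OF t] by (intro sum_norm_le) simp
    finally show "norm (g t x - g t y) \<le> L * DIM('a) * norm (x - y)" by (simp add: mult_ac)
  qed
qed

section \<open>The flow\<close>

locale tangential_field =
  fixes \<Omega> :: "'a::euclidean_space set" and v :: "real \<Rightarrow> 'a \<Rightarrow> 'a"
  assumes bounded_domain: "bounded \<Omega>" and open_domain: "open \<Omega>" and domain_nonempty: "\<Omega> \<noteq> {}"
    and field_cont: "continuous_on ({0..} \<times> closure \<Omega>) (\<lambda>(t, x). v t x)"
    and field_lipschitz: "local_lipschitz {0..} (closure \<Omega>) v"
    and tangent: "\<And>s x. s \<ge> 0 \<Longrightarrow> x \<in> frontier \<Omega> \<Longrightarrow>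
      v s x \<in> contingent_cone (frontier \<Omega>) x \<and> - v s x \<in> contingent_cone (frontier \<Omega>) x"
begin

section \<open>Topology of the domain and uniform bounds on finite time intervals\<close>

lemma compact_closure_domain: "compact (closure \<Omega>)"
  using bounded_domain by simp

lemma compact_frontier_domain: "compact (frontier \<Omega>)"
  using bounded_domain by (rule compact_frontier_bounded)

lemma closure_domain: "closure \<Omega> = \<Omega> \<union> frontier \<Omega>" and domain_frontier: "\<Omega> \<inter> frontier \<Omega> = {}"
  using open_domain closure_subset[of \<Omega>] by (auto simp: frontier_def interior_open)

lemma frontier_nonempty: "frontier \<Omega> \<noteq> {}"
  using bounded_domain domain_nonempty not_bounded_UNIV by (auto simp: frontier_eq_empty)

lemma field_cont_on: "I \<subseteq> {0..} \<Longrightarrow> continuous_on (I \<times> closure \<Omega>) (\<lambda>(t, x). v t x)"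
  by (rule continuous_on_subset[OF field_cont]) auto

lemma field_lipschitz_const:
  obtains L where "L > 0"
    and "\<And>t x y. t \<in> {0..N} \<Longrightarrow> x \<in> closure \<Omega> \<Longrightarrow> y \<in> closure \<Omega> \<Longrightarrow> norm (v t x - v t y) \<le> L * norm (x - y)"
proof -
  obtain L where L: "\<And>t. t \<in> {0..N} \<Longrightarrow> L-lipschitz_on (closure \<Omega>) (v t)"
  proof (rule local_lipschitz_compact_implies_lipschitz[where X="closure \<Omega>" and T="{0..N}" and f=v])
    show "local_lipschitz {0..N} (closure \<Omega>) v"
      by (rule local_lipschitz_subset[OF field_lipschitz]) auto
    fix x assume "x \<in> closure \<Omega>"
    then have "continuous_on {0..N} (\<lambda>t. (\<lambda>(t, x). v t x) (t, x))"
      by (intro continuous_on_compose2[OF field_cont]) (auto intro!: continuous_intros)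
    then show "continuous_on {0..N} (\<lambda>t. v t x)" by simp
  qed (use compact_closure_domain in auto)
  show thesis
  proof (rule that[of "\<bar>L\<bar> + 1"])
    fix t x y assume a: "t \<in> {0..N}" "x \<in> closure \<Omega>" "y \<in> closure \<Omega>"
    have "norm (v t x - v t y) \<le> L * norm (x - y)"
      using lipschitz_on_normD[OF L] a by blast
    also have "\<dots> \<le> (\<bar>L\<bar> + 1) * norm (x - y)" by (intro mult_right_mono) auto
    finally show "norm (v t x - v t y) \<le> (\<bar>L\<bar> + 1) * norm (x - y)" .
  qed simp
qed

lemma field_bound:
  obtains B where "B \<ge> 0" and "\<And>t x. t \<in> {0..N} \<Longrightarrow> x \<in> closure \<Omega> \<Longrightarrow> norm (v t x) \<le> B"
proof -
  have "compact ((\<lambda>(t, x). v t x) ` ({0..N} \<times> closure \<Omega>))"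
    by (intro compact_continuous_image field_cont_on compact_Times compact_closure_domain) auto
  then obtain B where B: "B > 0" "\<forall>z\<in>(\<lambda>(t, x). v t x) ` ({0..N} \<times> closure \<Omega>). norm z \<le> B"
    using compact_imp_bounded bounded_pos by metis
  show thesis
  proof (rule that[of B])
    fix t x assume "t \<in> {0..N}" "x \<in> closure \<Omega>"
    then have "v t x \<in> (\<lambda>(t, x). v t x) ` ({0..N} \<times> closure \<Omega>)"
      using imageI[of "(t, x)" "{0..N} \<times> closure \<Omega>" "\<lambda>(t, x). v t x"] by simp
    then show "norm (v t x) \<le> B" using B(2) by blast
  qed (use B(1) in simp)
qed

text \<open>The extension of \<open>v\<close> has two uses: \<open>picard_global\<close> needs a
  field on the whole space, and \<open>nagumo_invariance\<close> compares the field at the nearest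
  point with its value at a point not yet known to lie in the set. As both v and -v are tangential,
  a trajectory that meets \<partial>\<Omega> once lies in it at all times. A trajectory from
  \<Omega> thus never meets \<partial>\<Omega>, which by connectedness it would have to do in order
  to leave. So the solution stays where the extension agrees with \<open>v\<close>.\<close>

lemma local_solution:
  assumes \<tau>: "0 \<le> \<tau>" "\<tau> \<le> N" and \<xi>: "\<xi> \<in> closure \<Omega>"
  obtains x where "x \<tau> = \<xi>"
    and "\<And>t. t \<in> {0..N} \<Longrightarrow> (x has_vector_derivative v t (x t)) (at t within {0..N})"
    and "\<And>t. t \<in> {0..N} \<Longrightarrow> x t \<in> (if \<xi> \<in> \<Omega> then \<Omega> else frontier \<Omega>)"
proof -
  obtain L where L: "L > 0"
    "\<And>t x y. t \<in> {0..N} \<Longrightarrow> x \<in> closure \<Omega> \<Longrightarrow> y \<in> closure \<Omega> \<Longrightarrow> norm (v t x - v t y) \<le> L * norm (x - y)"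
    by (rule field_lipschitz_const[where N=N]) blast
  have "continuous_on ({0..N} \<times> closure \<Omega>) (\<lambda>(t, x). v t x)" by (rule field_cont_on) auto
  then obtain g L' where g: "continuous_on ({0..N} \<times> UNIV) (\<lambda>(t, x). g t x)"
    "\<And>t x y. t \<in> {0..N} \<Longrightarrow> norm (g t x - g t y :: 'a) \<le> L' * norm (x - y)" "L' > 0"
    "\<And>t x. t \<in> {0..N} \<Longrightarrow> x \<in> closure \<Omega> \<Longrightarrow> g t x = v t x"
    using lipschitz_extension[of "closure \<Omega>" "{0..N}" v L] compact_closure_domain domain_nonempty L
    by auto
  \<comment> \<open>Freezing the time outside [0,N] gives a continuous field for all times with the
    same Lipschitz constant.\<close>
  define clamp where "clamp t = min N (max 0 t)" for t
  have clamp: "clamp t \<in> {0..N}" "t \<in> {0..N} \<Longrightarrow> clamp t = t" for t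
    using \<tau> by (auto simp: clamp_def)
  define f where "f t = g (clamp t)" for t
  have f_lip: "norm (f t x - f t y) \<le> L' * norm (x - y)" for t x y
    unfolding f_def by (rule g(2)[OF clamp(1)])
  have f_v: "f t x = v t x" if "t \<in> {0..N}" "x \<in> closure \<Omega>" for t x
    using that by (simp add: f_def g clamp)
  have "continuous_on UNIV (\<lambda>z. (\<lambda>(t, x). g t x) (clamp (fst z), snd z))"
    by (rule continuous_on_compose2[OF g(1)]) (use clamp in \<open>auto intro!: continuous_intros simp: clamp_def[abs_def]\<close>)
  then have f_cont: "continuous_on UNIV (\<lambda>(t, x). f t x)" by (simp add: f_def case_prod_beta)
  obtain B where B: "\<And>t x. t \<in> {0..N} \<Longrightarrow> x \<in> closure \<Omega> \<Longrightarrow> norm (v t x) \<le> B" by (rule field_bound[where N=N]) blast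
  have f_bd: "norm (f t \<xi>) \<le> B" for t
    using B[OF clamp(1) \<xi>, of t] g(4)[OF clamp(1) \<xi>, of t] by (simp add: f_def)
  obtain x where x: "x \<tau> = \<xi>" "\<And>t. (x has_vector_derivative f t (x t)) (at t)"
    using picard_global[OF f_cont f_lip g(3) f_bd, of \<tau>] by blast
  have fr_closure: "y \<in> closure \<Omega>" if "y \<in> frontier \<Omega>" for y
    using that by (simp add: frontier_def)
  have fr: "x t \<in> frontier \<Omega>" if \<sigma>: "\<sigma> \<in> {0..N}" "x \<sigma> \<in> frontier \<Omega>" and t: "t \<in> {0..N}" for \<sigma> t
  proof (cases "\<sigma> \<le> t")
    case True
    show ?thesis
    proof (rule nagumo_invariance[OF compact_frontier_domain, of \<sigma> N x f L'])
      show "f t y \<in> contingent_cone (frontier \<Omega>) y" if "t \<in> {\<sigma>..N}" "y \<in> frontier \<Omega>" for t y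
        using that \<sigma> f_v[of t y] tangent[of t y] fr_closure by auto
    qed (use True \<sigma> t x f_lip g(3) in \<open>auto intro: has_vector_derivative_at_within\<close>)
  next
    case False
    have "(x \<circ> (\<lambda>s. \<sigma> - s)) (\<sigma> - t) \<in> frontier \<Omega>"
    proof (rule nagumo_invariance[OF compact_frontier_domain, of 0 \<sigma> _ "\<lambda>s y. - f (\<sigma> - s) y" L'])
      fix s assume s: "s \<in> {0..\<sigma>}"
      have "((x \<circ> (\<lambda>s. \<sigma> - s)) has_vector_derivative (-1) *\<^sub>R f (\<sigma> - s) (x (\<sigma> - s))) (at s)"
        by (rule vector_diff_chain_at[OF _ x(2)]) (auto intro!: derivative_eq_intros)
      then show "((x \<circ> (\<lambda>s. \<sigma> - s)) has_vector_derivative - f (\<sigma> - s) ((x \<circ> (\<lambda>s. \<sigma> - s)) s)) (at s within {0..\<sigma>})"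
        by (auto intro: has_vector_derivative_at_within)
      show "- f (\<sigma> - s) y \<in> contingent_cone (frontier \<Omega>) y" if "y \<in> frontier \<Omega>" for y
        using that s \<sigma> f_v[of "\<sigma> - s" y] tangent[of "\<sigma> - s" y] fr_closure by auto
      show "norm (- f (\<sigma> - s) y - - f (\<sigma> - s) z) \<le> L' * norm (y - z)" for y z
        using f_lip[of "\<sigma> - s" y z] by (metis minus_diff_minus norm_minus_cancel)
    qed (use False \<sigma> t g(3) in auto)
    then show ?thesis by simp
  qed
  have x_in: "x t \<in> (if \<xi> \<in> \<Omega> then \<Omega> else frontier \<Omega>)" if t: "t \<in> {0..N}" for t
  proof (cases "\<xi> \<in> \<Omega>")
    case True
    have "x t \<in> \<Omega>"
    proof (rule ccontr)
      assume "x t \<notin> \<Omega>"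
      have "continuous_on {0..N} x"
        using x(2) by (meson continuous_at_imp_continuous_on has_vector_derivative_continuous)
      then have "connected (x ` {0..N})" by (intro connected_continuous_image) auto
      moreover have "x ` {0..N} \<inter> \<Omega> \<noteq> {}" using True x(1) \<tau> by force
      moreover have "x ` {0..N} - \<Omega> \<noteq> {}" using t \<open>x t \<notin> \<Omega>\<close> by blast
      ultimately have "x ` {0..N} \<inter> frontier \<Omega> \<noteq> {}" by (rule connected_Int_frontier)
      then obtain \<sigma> where "\<sigma> \<in> {0..N}" "x \<sigma> \<in> frontier \<Omega>" by blast
      from fr[OF this, of \<tau>] have "\<xi> \<in> frontier \<Omega>" using \<tau> x(1) by simp
      then show False using True domain_frontier by blast
    qed
    then show ?thesis using True by simp
  next
    case False
    then have "x \<tau> \<in> frontier \<Omega>" using \<xi> closure_domain x(1) by blast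
    then show ?thesis using fr[of \<tau> t] \<tau> t False by simp
  qed
  show thesis
  proof
    show "x \<tau> = \<xi>" by fact
    fix t assume t: "t \<in> {0..N}"
    then have "x t \<in> closure \<Omega>" using x_in[OF t] closure_domain by (auto split: if_splits)
    then show "(x has_vector_derivative v t (x t)) (at t within {0..N})"
      using x(2)[of t] f_v[OF t] by (simp add: has_vector_derivative_at_within)
  qed (rule x_in)
qed

lemma solutions_gronwall:
  assumes x: "\<And>t. t \<in> {0..N} \<Longrightarrow> x t \<in> closure \<Omega> \<and> (x has_vector_derivative v t (x t)) (at t within {0..N})"
    and y: "\<And>t. t \<in> {0..N} \<Longrightarrow> y t \<in> closure \<Omega> \<and> (y has_vector_derivative v t (y t)) (at t within {0..N})"
    and L: "\<And>t x y. t \<in> {0..N} \<Longrightarrow> x \<in> closure \<Omega> \<Longrightarrow> y \<in> closure \<Omega> \<Longrightarrow> norm (v t x - v t y) \<le> L * norm (x - y)"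
    and st: "s \<in> {0..N}" "t \<in> {0..N}"
  shows "norm (x t - y t) \<le> exp (L * \<bar>t - s\<bar>) * norm (x s - y s)"
proof (rule flow_gronwall[where a=0 and b=N and F="\<lambda>t. v t (x t)" and G="\<lambda>t. v t (y t)"])
  fix t assume t: "t \<in> {0..N}"
  show "(x has_vector_derivative v t (x t)) (at t within {0..N})" using x[OF t] ..
  show "(y has_vector_derivative v t (y t)) (at t within {0..N})" using y[OF t] ..
  show "norm (v t (x t) - v t (y t)) \<le> L * norm (x t - y t)"
    by (rule L[OF t conjunct1[OF x[OF t]] conjunct1[OF y[OF t]]])
qed (fact st)+

lemma solutions_unique:
  assumes x: "\<And>t. t \<in> {0..N} \<Longrightarrow> x t \<in> closure \<Omega> \<and> (x has_vector_derivative v t (x t)) (at t within {0..N})"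
    and y: "\<And>t. t \<in> {0..N} \<Longrightarrow> y t \<in> closure \<Omega> \<and> (y has_vector_derivative v t (y t)) (at t within {0..N})"
    and st: "s \<in> {0..N}" "t \<in> {0..N}" and eq: "x s = y s"
  shows "x t = y t"
proof -
  obtain L where "L > 0" and L: "\<And>t x y. t \<in> {0..N} \<Longrightarrow> x \<in> closure \<Omega> \<Longrightarrow> y \<in> closure \<Omega> \<Longrightarrow> norm (v t x - v t y) \<le> L * norm (x - y)"
    by (rule field_lipschitz_const[where N=N]) blast
  from solutions_gronwall[where x=x and y=y and N=N, OF x y L st] show ?thesis using eq by simp
qed

text \<open>The Lipschitz constant, and with it the extension of the field, depends on the time
  horizon. So a solution is taken for each horizon \<open>N n\<close>; they agree on common
  intervals because all have the value \<xi> at \<tau>.\<close>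

lemma ode_solution_exists:
  assumes \<tau>: "0 \<le> \<tau>" and \<xi>: "\<xi> \<in> closure \<Omega>"
  obtains x where "ode_solution \<Omega> v \<tau> \<xi> x"
    and "\<And>s. s \<ge> 0 \<Longrightarrow> x s \<in> (if \<xi> \<in> \<Omega> then \<Omega> else frontier \<Omega>)"
proof -
  \<comment> \<open>Every horizon exceeds \<tau>, and t lies strictly below the horizon with index
    \<open>nat \<lceil>t\<rceil>\<close>; so the derivative at t within [0, N n] is also the one
    within the half-line.\<close>
  define N where "N n = \<tau> + 1 + real n" for n
  have "\<exists>x. x \<tau> = \<xi> \<and> (\<forall>t\<in>{0..N n}. (x has_vector_derivative v t (x t)) (at t within {0..N n}))
      \<and> (\<forall>t\<in>{0..N n}. x t \<in> (if \<xi> \<in> \<Omega> then \<Omega> else frontier \<Omega>))" for n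
    by (rule local_solution[of \<tau> "N n" \<xi>]) (use \<tau> \<xi> in \<open>auto simp: N_def\<close>)
  then obtain X where X: "\<And>n. X n \<tau> = \<xi>"
    "\<And>n t. t \<in> {0..N n} \<Longrightarrow> (X n has_vector_derivative v t (X n t)) (at t within {0..N n})"
    "\<And>n t. t \<in> {0..N n} \<Longrightarrow> X n t \<in> (if \<xi> \<in> \<Omega> then \<Omega> else frontier \<Omega>)"
    by metis
  have XK: "X n t \<in> closure \<Omega>" if "t \<in> {0..N n}" for n t
    using X(3)[OF that] closure_domain by (auto split: if_splits)
  have eq: "X m t = X n t" if "t \<in> {0..N m}" "t \<in> {0..N n}" for m n t
  proof (rule solutions_unique[of "min (N m) (N n)" "X m" "X n" \<tau>])
    fix r assume r: "r \<in> {0..min (N m) (N n)}"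
    show "X m r \<in> closure \<Omega> \<and> (X m has_vector_derivative v r (X m r)) (at r within {0..min (N m) (N n)})"
      using X(2)[of r m] XK[of r m] r by (auto intro: has_vector_derivative_within_subset)
    show "X n r \<in> closure \<Omega> \<and> (X n has_vector_derivative v r (X n r)) (at r within {0..min (N m) (N n)})"
      using X(2)[of r n] XK[of r n] r by (auto intro: has_vector_derivative_within_subset)
  qed (use that \<tau> X(1) in \<open>auto simp: N_def\<close>)
  define x where "x t = X (nat \<lceil>t\<rceil>) t" for t
  have ceil: "t \<in> {0..N (nat \<lceil>t\<rceil>)}" if "t \<ge> 0" for t
    using that \<tau> real_nat_ceiling_ge[of t] unfolding N_def atLeastAtMost_iff by linarith
  have xX: "x t = X n t" if "t \<in> {0..N n}" for n t
    unfolding x_def using that ceil[of t] by (intro eq) auto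
  have x_in: "x t \<in> (if \<xi> \<in> \<Omega> then \<Omega> else frontier \<Omega>)" if "t \<ge> 0" for t
    unfolding x_def by (rule X(3)[OF ceil[OF that]])
  show thesis
  proof (rule that[of x])
    show "ode_solution \<Omega> v \<tau> \<xi> x"
      unfolding ode_solution_def
    proof (intro conjI allI impI)
      have "\<tau> \<in> {0..N 0}" using \<tau> by (simp add: N_def)
      then show "x \<tau> = \<xi>" using xX[of \<tau> 0] X(1) by simp
      fix t :: real assume t: "t \<ge> 0"
      show "x t \<in> closure \<Omega>" using x_in[OF t] closure_domain by (auto split: if_splits)
      define n where "n = nat \<lceil>t\<rceil>"
      have tn: "t \<in> {0..N n}" "t < N n" using ceil[OF t] t \<tau> real_nat_ceiling_ge[of t] unfolding n_def N_def atLeastAtMost_iff by linarith+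
      have "(x has_vector_derivative v t (x t)) (at t within {0..N n})"
        unfolding xX[OF tn(1)]
        by (rule has_vector_derivative_transform[OF tn(1) _ X(2)[OF tn(1)]]) (rule xX)
      moreover have "at t within {0..N n} = at t within {0..}"
        by (rule at_within_nhd[of _ "{..<N n}"]) (use tn in auto)
      ultimately show "(x has_vector_derivative v t (x t)) (at t within {0..})" by simp
    qed
  qed (rule x_in)
qed

section \<open>The flow map and its group property\<close>

lemma ode_solution_on:
  assumes "ode_solution \<Omega> v \<tau> \<xi> x" "t \<in> {0..N}"
  shows "x t \<in> closure \<Omega> \<and> (x has_vector_derivative v t (x t)) (at t within {0..N})"
  using assms unfolding ode_solution_def by (auto intro: has_vector_derivative_within_subset)

lemma flow_eq_solution:
  assumes x: "ode_solution \<Omega> v \<tau> \<xi> x" and "\<tau> \<ge> 0" "s \<ge> 0"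
  shows "flow \<Omega> v s \<tau> \<xi> = x s"
  unfolding flow_def
proof (rule the_equality)
  show "\<exists>xa. ode_solution \<Omega> v \<tau> \<xi> xa \<and> xa s = x s" using x by blast
  fix y assume "\<exists>xa. ode_solution \<Omega> v \<tau> \<xi> xa \<and> xa s = y"
  then obtain z where z: "ode_solution \<Omega> v \<tau> \<xi> z" "z s = y" by blast
  have "z s = x s"
    by (rule solutions_unique[where x=z and y=x and N="max s \<tau>" and s=\<tau>, OF ode_solution_on[OF z(1)] ode_solution_on[OF x]])
      (use assms z in \<open>auto simp: ode_solution_def\<close>)
  then show "y = x s" using z by simp
qed

lemma flow_solution:
  assumes "\<tau> \<ge> 0" "\<xi> \<in> closure \<Omega>"
  shows "ode_solution \<Omega> v \<tau> \<xi> (\<lambda>s. flow \<Omega> v s \<tau> \<xi>)"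
proof -
  obtain x where x: "ode_solution \<Omega> v \<tau> \<xi> x" using ode_solution_exists[OF assms] by blast
  have eq: "flow \<Omega> v s \<tau> \<xi> = x s" if "s \<ge> 0" for s
    using flow_eq_solution[OF x assms(1) that] .
  have "((\<lambda>s. flow \<Omega> v s \<tau> \<xi>) has_vector_derivative v t (flow \<Omega> v t \<tau> \<xi>)) (at t within {0..})" if "t \<ge> 0" for t
    unfolding eq[OF that]
    by (rule has_vector_derivative_transform[of _ _ _ x]) (use x that eq in \<open>auto simp: ode_solution_def\<close>)
  then show ?thesis using x assms eq by (auto simp: ode_solution_def)
qed

lemma flow_self [simp]: "\<tau> \<ge> 0 \<Longrightarrow> \<xi> \<in> closure \<Omega> \<Longrightarrow> flow \<Omega> v \<tau> \<tau> \<xi> = \<xi>"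
  using flow_solution[of \<tau> \<xi>] by (simp add: ode_solution_def)

lemma flow_deriv:
  "\<tau> \<ge> 0 \<Longrightarrow> \<xi> \<in> closure \<Omega> \<Longrightarrow> t \<ge> 0 \<Longrightarrow> ((\<lambda>s. flow \<Omega> v s \<tau> \<xi>) has_vector_derivative v t (flow \<Omega> v t \<tau> \<xi>)) (at t within {0..})"
  using flow_solution[of \<tau> \<xi>] by (simp add: ode_solution_def)

lemma flow_in_domain: "\<tau> \<ge> 0 \<Longrightarrow> \<xi> \<in> \<Omega> \<Longrightarrow> s \<ge> 0 \<Longrightarrow> flow \<Omega> v s \<tau> \<xi> \<in> \<Omega>"
  and flow_in_frontier: "\<tau> \<ge> 0 \<Longrightarrow> \<xi> \<in> frontier \<Omega> \<Longrightarrow> s \<ge> 0 \<Longrightarrow> flow \<Omega> v s \<tau> \<xi> \<in> frontier \<Omega>"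
proof -
  have *: "flow \<Omega> v s \<tau> \<xi> \<in> (if \<xi> \<in> \<Omega> then \<Omega> else frontier \<Omega>)" if a: "\<tau> \<ge> 0" "\<xi> \<in> closure \<Omega>" "s \<ge> 0"
  proof -
    obtain x where x: "ode_solution \<Omega> v \<tau> \<xi> x" "\<And>s. s \<ge> 0 \<Longrightarrow> x s \<in> (if \<xi> \<in> \<Omega> then \<Omega> else frontier \<Omega>)"
      using ode_solution_exists[OF a(1,2)] by blast
    show ?thesis using flow_eq_solution[OF x(1) a(1,3)] x(2)[OF a(3)] by simp
  qed
  show "\<tau> \<ge> 0 \<Longrightarrow> \<xi> \<in> \<Omega> \<Longrightarrow> s \<ge> 0 \<Longrightarrow> flow \<Omega> v s \<tau> \<xi> \<in> \<Omega>" using * closure_domain by auto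
  show "\<tau> \<ge> 0 \<Longrightarrow> \<xi> \<in> frontier \<Omega> \<Longrightarrow> s \<ge> 0 \<Longrightarrow> flow \<Omega> v s \<tau> \<xi> \<in> frontier \<Omega>"
    using * closure_domain domain_frontier by (auto split: if_splits)
qed

lemma flow_in_closure: "\<tau> \<ge> 0 \<Longrightarrow> \<xi> \<in> closure \<Omega> \<Longrightarrow> s \<ge> 0 \<Longrightarrow> flow \<Omega> v s \<tau> \<xi> \<in> closure \<Omega>"
  unfolding closure_domain using flow_in_domain flow_in_frontier by auto

text \<open>A trajectory is also the solution through each of its own later or earlier points. No
  order of the times is assumed; for \<open>s = \<tau>\<close> this says that X(\<tau>,t,.) undoes
  X(t,\<tau>,.).\<close>

lemma flow_comp:
  assumes "\<tau> \<ge> 0" "\<xi> \<in> closure \<Omega>" "t \<ge> 0" "s \<ge> 0"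
  shows "flow \<Omega> v s t (flow \<Omega> v t \<tau> \<xi>) = flow \<Omega> v s \<tau> \<xi>"
proof -
  have "ode_solution \<Omega> v t (flow \<Omega> v t \<tau> \<xi>) (\<lambda>s. flow \<Omega> v s \<tau> \<xi>)"
    using flow_solution[OF assms(1,2)] unfolding ode_solution_def by blast
  from flow_eq_solution[OF this assms(3,4)] show ?thesis .
qed

section \<open>Lipschitz dependence of the flow on times and starting points\<close>

lemma flow_lipschitz:
  assumes L: "\<And>t x y. t \<in> {0..N} \<Longrightarrow> x \<in> closure \<Omega> \<Longrightarrow> y \<in> closure \<Omega> \<Longrightarrow> norm (v t x - v t y) \<le> L * norm (x - y)"
    and "L > 0" and st: "s \<in> {0..N}" "t \<in> {0..N}" and xy: "x \<in> closure \<Omega>" "y \<in> closure \<Omega>"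
  shows "norm (flow \<Omega> v s t x - flow \<Omega> v s t y) \<le> exp (L * N) * norm (x - y)"
proof -
  have "norm (flow \<Omega> v s t x - flow \<Omega> v s t y) \<le> exp (L * \<bar>s - t\<bar>) * norm (flow \<Omega> v t t x - flow \<Omega> v t t y)"
  proof (rule solutions_gronwall[where x="\<lambda>r. flow \<Omega> v r t x" and y="\<lambda>r. flow \<Omega> v r t y" and N=N])
    have t: "t \<ge> 0" using st by simp
    fix r assume r: "r \<in> {0..N}"
    show "flow \<Omega> v r t x \<in> closure \<Omega> \<and> ((\<lambda>r. flow \<Omega> v r t x) has_vector_derivative v r (flow \<Omega> v r t x)) (at r within {0..N})"
      by (rule ode_solution_on[OF flow_solution[OF t xy(1)] r])
    show "flow \<Omega> v r t y \<in> closure \<Omega> \<and> ((\<lambda>r. flow \<Omega> v r t y) has_vector_derivative v r (flow \<Omega> v r t y)) (at r within {0..N})"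
      by (rule ode_solution_on[OF flow_solution[OF t xy(2)] r])
  qed (fact L st)+
  also have "\<dots> \<le> exp (L * N) * norm (flow \<Omega> v t t x - flow \<Omega> v t t y)"
    using st \<open>L > 0\<close> by (intro mult_right_mono) auto
  finally show ?thesis using st xy by simp
qed

lemma flow_time_lipschitz:
  assumes B: "\<And>t x. t \<in> {0..N} \<Longrightarrow> x \<in> closure \<Omega> \<Longrightarrow> norm (v t x) \<le> B"
    and st: "s \<in> {0..N}" "t \<in> {0..N}" and x: "x \<in> closure \<Omega>" and \<tau>: "\<tau> \<ge> 0"
  shows "norm (flow \<Omega> v s \<tau> x - flow \<Omega> v t \<tau> x) \<le> B * \<bar>s - t\<bar>"
proof -
  have "norm (flow \<Omega> v s \<tau> x - flow \<Omega> v t \<tau> x) \<le> B * norm (s - t)"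
  proof (rule differentiable_bound[of "{0..N}"])
    fix r assume r: "r \<in> {0..N}"
    show "((\<lambda>s. flow \<Omega> v s \<tau> x) has_derivative (\<lambda>h. h *\<^sub>R v r (flow \<Omega> v r \<tau> x))) (at r within {0..N})"
      using ode_solution_on[OF flow_solution[OF \<tau> x] r] by (simp add: has_vector_derivative_def)
    show "onorm (\<lambda>h. h *\<^sub>R v r (flow \<Omega> v r \<tau> x)) \<le> B"
      using B[OF r, of "flow \<Omega> v r \<tau> x"] flow_in_closure[OF \<tau> x, of r] r
      by (intro onorm_le) (auto simp: mult.commute[of B] intro!: mult_left_mono)
  qed (use st in auto)
  then show ?thesis by simp
qed

text \<open>By X(0,t,x) = X(0,s,X(s,t,x)), changing the starting time from t to s amounts to moving
  the starting point from x to X(s,t,x), a distance of at most B|s - t|. The map is therefore even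
  Lipschitz.\<close>

lemma flow_cont: "continuous_on ({0..N} \<times> closure \<Omega>) (\<lambda>(t, x). flow \<Omega> v 0 t x)"
proof -
  obtain L where L: "L > 0"
    "\<And>t x y. t \<in> {0..N} \<Longrightarrow> x \<in> closure \<Omega> \<Longrightarrow> y \<in> closure \<Omega> \<Longrightarrow> norm (v t x - v t y) \<le> L * norm (x - y)"
    by (rule field_lipschitz_const[where N=N]) blast
  obtain B where B: "B \<ge> 0" "\<And>t x. t \<in> {0..N} \<Longrightarrow> x \<in> closure \<Omega> \<Longrightarrow> norm (v t x) \<le> B"
    by (rule field_bound[where N=N]) blast
  have "(exp (L * N) * (1 + B))-lipschitz_on ({0..N} \<times> closure \<Omega>) (\<lambda>(t, x). flow \<Omega> v 0 t x)"
  proof (rule lipschitz_onI)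
    fix p q assume "p \<in> {0..N} \<times> closure \<Omega>" "q \<in> {0..N} \<times> closure \<Omega>"
    then obtain t x s y where pq: "p = (t, x)" "q = (s, y)" "t \<in> {0..N}" "s \<in> {0..N}" "x \<in> closure \<Omega>" "y \<in> closure \<Omega>"
      by auto
    have "norm (flow \<Omega> v 0 t x - flow \<Omega> v 0 s y) = norm (flow \<Omega> v 0 s (flow \<Omega> v s t x) - flow \<Omega> v 0 s y)"
      using flow_comp[of t x s 0] pq by simp
    also have "\<dots> \<le> exp (L * N) * norm (flow \<Omega> v s t x - y)"
      using pq by (intro flow_lipschitz L) (auto intro: flow_in_closure)
    also have "norm (flow \<Omega> v s t x - y) \<le> norm (flow \<Omega> v s t x - flow \<Omega> v t t x) + norm (x - y)"
      using pq norm_triangle_ineq[of "flow \<Omega> v s t x - x" "x - y"] by simp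
    also have "\<dots> \<le> B * \<bar>s - t\<bar> + norm (x - y)"
      using flow_time_lipschitz[OF B(2), of N s t x t] pq by simp
    also have "\<dots> \<le> B * dist p q + dist p q"
      using dist_fst_le[of p q] dist_snd_le[of p q] pq B(1)
      by (intro add_mono mult_left_mono) (auto simp: dist_norm norm_minus_commute)
    finally show "dist (case p of (t, x) \<Rightarrow> flow \<Omega> v 0 t x) (case q of (t, x) \<Rightarrow> flow \<Omega> v 0 t x) \<le> exp (L * N) * (1 + B) * dist p q"
      by (simp add: pq dist_norm algebra_simps)
  qed (use B in auto)
  then show ?thesis by (rule lipschitz_on_continuous_on)
qed

text \<open>The boundary point nearest to x is carried to a boundary point, so the distance to
  \<partial>\<Omega> grows at most by the Lipschitz constant of the flow.\<close>

lemma flow_infdist_frontier: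
  assumes L: "\<And>t x y. t \<in> {0..N} \<Longrightarrow> x \<in> closure \<Omega> \<Longrightarrow> y \<in> closure \<Omega> \<Longrightarrow> norm (v t x - v t y) \<le> L * norm (x - y)"
    and "L > 0" and t: "t \<in> {0..N}" and x: "x \<in> closure \<Omega>"
  shows "infdist (flow \<Omega> v t 0 x) (frontier \<Omega>) \<le> exp (L * N) * infdist x (frontier \<Omega>)"
proof -
  obtain y where y: "y \<in> frontier \<Omega>" "infdist x (frontier \<Omega>) = dist x y"
    using infdist_attains_inf[OF compact_imp_closed[OF compact_frontier_domain] frontier_nonempty] by blast
  have "infdist (flow \<Omega> v t 0 x) (frontier \<Omega>) \<le> dist (flow \<Omega> v t 0 x) (flow \<Omega> v t 0 y)"
    using y t by (intro infdist_le flow_in_frontier) auto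
  also have "\<dots> \<le> exp (L * N) * dist x y"
    using flow_lipschitz[OF L \<open>L > 0\<close>, of N t 0 x y] t x y closure_domain by (auto simp: dist_norm)
  finally show ?thesis using y by simp
qed

end

section \<open>Semicontinuous envelopes\<close>

text \<open>Upper semicontinuity relative to \<open>S\<close>. Lower semicontinuity of f is always
  expressed as \<open>usc_on S (\<lambda>x. - f x)\<close>.\<close>

definition usc_on :: "'a::topological_space set \<Rightarrow> ('a \<Rightarrow> real) \<Rightarrow> bool" where
  "usc_on S f \<longleftrightarrow> (\<forall>x\<in>S. \<forall>a. f x < a \<longrightarrow> (\<forall>\<^sub>F y in nhds x. y \<in> S \<longrightarrow> f y < a))"

lemma usc_onD: "usc_on S f \<Longrightarrow> x \<in> S \<Longrightarrow> f x < a \<Longrightarrow> \<forall>\<^sub>F y in nhds x. y \<in> S \<longrightarrow> f y < a"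
  unfolding usc_on_def by blast

lemma usc_on_subset: "usc_on S f \<Longrightarrow> T \<subseteq> S \<Longrightarrow> usc_on T f"
  unfolding usc_on_def by (blast intro: eventually_mono)

lemma continuous_on_eventually_less:
  fixes f :: "'a::topological_space \<Rightarrow> real"
  assumes "continuous_on S f" "x \<in> S" "f x < a"
  shows "\<forall>\<^sub>F y in nhds x. y \<in> S \<longrightarrow> f y < a"
proof -
  have "(f \<longlongrightarrow> f x) (at x within S)"
    using assms(1,2) by (simp add: continuous_on_def)
  then have "\<forall>\<^sub>F y in at x within S. f y < a" using assms(3) by (rule order_tendstoD)
  then show ?thesis unfolding eventually_at_filter
    by (rule eventually_mono) (use assms(3) in auto)
qed

lemma continuous_imp_usc_on: "continuous_on S f \<Longrightarrow> usc_on S f"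
  unfolding usc_on_def using continuous_on_eventually_less by blast

lemma usc_on_add:
  assumes f: "usc_on S f" and g: "usc_on S g"
  shows "usc_on S (\<lambda>x. f x + g x)"
  unfolding usc_on_def
proof (intro ballI allI impI)
  fix x a assume x: "x \<in> S" and a: "f x + g x < a"
  define e where "e = (a - (f x + g x)) / 2"
  have e: "e > 0" "f x + e + (g x + e) = a" using a by (simp_all add: e_def field_simps)
  have "\<forall>\<^sub>F y in nhds x. y \<in> S \<longrightarrow> f y < f x + e" "\<forall>\<^sub>F y in nhds x. y \<in> S \<longrightarrow> g y < g x + e"
    using usc_onD[OF f x] usc_onD[OF g x] e by auto
  then show "\<forall>\<^sub>F y in nhds x. y \<in> S \<longrightarrow> f y + g y < a"
    by eventually_elim (use e in auto)
qed

lemma usc_on_max: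
  assumes f: "usc_on S f" and g: "usc_on S g"
  shows "usc_on S (\<lambda>x. max (f x) (g x))"
  unfolding usc_on_def
proof (intro ballI allI impI)
  fix x a assume x: "x \<in> S" and a: "max (f x) (g x) < a"
  have "\<forall>\<^sub>F y in nhds x. y \<in> S \<longrightarrow> f y < a" "\<forall>\<^sub>F y in nhds x. y \<in> S \<longrightarrow> g y < a"
    using usc_onD[OF f x] usc_onD[OF g x] a by auto
  then show "\<forall>\<^sub>F y in nhds x. y \<in> S \<longrightarrow> max (f y) (g y) < a"
    by eventually_elim auto
qed

lemma usc_on_mult_pos:
  assumes f: "usc_on S f" and g: "continuous_on S g" and pos: "\<And>x. x \<in> S \<Longrightarrow> g x > 0"
  shows "usc_on S (\<lambda>x. g x * f x)"
  unfolding usc_on_def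
proof (intro ballI allI impI)
  fix x a assume x: "x \<in> S" and a: "g x * f x < a"
  have "f x < a / g x" using a pos[OF x] by (simp add: pos_less_divide_eq mult.commute)
  \<comment> \<open>An intermediate level separates the two variations: near x both
    \<open>f y < b\<close> and \<open>g y * b < a\<close> hold, and positivity of \<open>g\<close>
    combines them.\<close>
  then obtain b where b: "f x < b" "b < a / g x" using dense by blast
  then have ba: "g x * b < a" using pos[OF x] by (simp add: pos_less_divide_eq mult.commute)
  have "\<forall>\<^sub>F y in nhds x. y \<in> S \<longrightarrow> g y * b < a"
    by (rule continuous_on_eventually_less[where f="\<lambda>y. g y * b", OF _ x ba]) (intro continuous_intros g)
  with usc_onD[OF f x b(1)] show "\<forall>\<^sub>F y in nhds x. y \<in> S \<longrightarrow> g y * f y < a"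
  proof eventually_elim
    case (elim y)
    show ?case
    proof
      assume y: "y \<in> S"
      then have "g y * f y \<le> g y * b" using elim pos by (intro mult_left_mono) (auto intro: less_imp_le)
      then show "g y * f y < a" using elim y by auto
    qed
  qed
qed

lemma usc_on_compose:
  assumes f: "usc_on S f" and g: "continuous_on T g" "g ` T \<subseteq> S"
  shows "usc_on T (\<lambda>x. f (g x))"
  unfolding usc_on_def
proof (intro ballI allI impI)
  fix x a assume x: "x \<in> T" and a: "f (g x) < a"
  have "\<forall>\<^sub>F y in nhds (g x). y \<in> S \<longrightarrow> f y < a" using usc_onD[OF f _ a] g(2) x by blast
  moreover have "(g \<longlongrightarrow> g x) (at x within T)"
    using g(1) x by (simp add: continuous_on_def)
  ultimately have "\<forall>\<^sub>F y in at x within T. g y \<in> S \<longrightarrow> f (g y) < a"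
    by (rule eventually_compose_filterlim)
  then show "\<forall>\<^sub>F y in nhds x. y \<in> T \<longrightarrow> f (g y) < a"
    unfolding eventually_at_filter
    by (rule eventually_mono) (use a g(2) in auto)
qed

text \<open>Without a maximum, the relatively open sets {f < f y} with y in K would cover K. The
  largest level of a finite subcover is the value of f at a point of K, which some member contains;
  so it lies below another level.\<close>

lemma usc_attains_max:
  assumes K: "compact K" "K \<noteq> {}" and f: "usc_on K f"
  obtains x where "x \<in> K" "\<And>y. y \<in> K \<Longrightarrow> f y \<le> f x"
proof (rule ccontr)
  assume contra: "\<not> thesis"
  note attained = that
  have nomax: "\<exists>y\<in>K. f x < f y" if "x \<in> K" for x
    using attained[OF that] contra by (meson not_le_imp_less)
  have "\<exists>V. open V \<and> x \<in> V \<and> (\<forall>w\<in>V. w \<in> K \<longrightarrow> f w < f y)" if "x \<in> K" "f x < f y" for x y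
    using usc_onD[OF f that] unfolding eventually_nhds by blast
  then have "\<forall>x\<in>K. \<exists>y V. y \<in> K \<and> open V \<and> x \<in> V \<and> (\<forall>w\<in>V. w \<in> K \<longrightarrow> f w < f y)"
    using nomax by meson
  then obtain y V where yV: "\<And>x. x \<in> K \<Longrightarrow> y x \<in> K" "\<And>x. x \<in> K \<Longrightarrow> open (V x)"
    "\<And>x. x \<in> K \<Longrightarrow> x \<in> V x" "\<And>x w. x \<in> K \<Longrightarrow> w \<in> V x \<Longrightarrow> w \<in> K \<Longrightarrow> f w < f (y x)"
    by metis
  have "K \<subseteq> (\<Union>x\<in>K. V x)" using yV(3) by blast
  then obtain C where C: "C \<subseteq> K" "finite C" "K \<subseteq> (\<Union>x\<in>C. V x)"
    using compactE_image[OF K(1), of K V] yV(2) by metis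
  have Cne: "C \<noteq> {}" using C(3) K(2) by auto
  obtain c where c: "c \<in> C" "\<And>x. x \<in> C \<Longrightarrow> f (y x) \<le> f (y c)"
  proof -
    have "Max ((\<lambda>x. f (y x)) ` C) \<in> (\<lambda>x. f (y x)) ` C" using C(2) Cne by (intro Max_in) auto
    then obtain c where c: "c \<in> C" "Max ((\<lambda>x. f (y x)) ` C) = f (y c)" by auto
    have "f (y x) \<le> f (y c)" if "x \<in> C" for x
      unfolding c(2)[symmetric] using C(2) that by (intro Max_ge) auto
    then show thesis using that c(1) by blast
  qed
  have yc: "y c \<in> K" using yV(1) C(1) c(1) by blast
  then obtain d where d: "d \<in> C" "y c \<in> V d" using C(3) by blast
  have "f (y c) < f (y d)" using yV(4)[of d "y c"] d yc C(1) by blast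
  then show False using c(2)[OF d(1)] by simp
qed

section \<open>Envelopes of locally bounded functions\<close>

lemma locally_bounded_on_between:
  fixes s S :: "'a::euclidean_space \<Rightarrow> real"
  assumes A: "open A" and s: "continuous_on A s" and S: "continuous_on A S"
    and u: "\<And>z. z \<in> A \<Longrightarrow> s z \<le> u z \<and> u z \<le> S z"
  shows "locally_bounded_on A u"
  unfolding locally_bounded_on_def
proof
  fix z assume "z \<in> A"
  then obtain r where r: "r > 0" "cball z r \<subseteq> A" using A open_contains_cball by blast
  have "bounded (s ` cball z r)" "bounded (S ` cball z r)"
    using r s S by (auto intro!: compact_imp_bounded compact_continuous_image intro: continuous_on_subset)
  then obtain a b where ab: "\<forall>y\<in>cball z r. \<bar>s y\<bar> \<le> a" "\<forall>y\<in>cball z r. \<bar>S y\<bar> \<le> b"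
    unfolding bounded_iff by auto
  have "\<bar>u y\<bar> \<le> a + b" if "y \<in> A \<inter> cball z r" for y
  proof -
    have "\<bar>s y\<bar> \<le> a" "\<bar>S y\<bar> \<le> b" "s y \<le> u y" "u y \<le> S y" using that ab u by auto
    then show ?thesis by linarith
  qed
  then have "bounded (u ` (A \<inter> cball z r))" unfolding bounded_iff by (intro exI[of _ "a + b"]) auto
  then show "\<exists>r>0. bounded (u ` (A \<inter> cball z r))" using r by blast
qed

text \<open>Real suprema are meaningful only over bounded sets of values, so everything happens
  below a radius \<open>r0\<close> at which \<open>u\<close> is bounded. There the supremum is
  monotone in r, and the limit at 0 is its infimum \<open>l\<close> over these radii.\<close>

lemma usc_envelope_facts:
  fixes u :: "'a::euclidean_space \<Rightarrow> real"
  assumes lb: "locally_bounded_on A u" and z: "z \<in> A"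
  shows usc_envelope_tendsto: "((\<lambda>r. SUP y\<in>A \<inter> cball z r. u y) \<longlongrightarrow> usc_envelope A u z) (at_right 0)"
    and usc_envelope_ge: "u z \<le> usc_envelope A u z"
    and usc_envelope_less: "usc_envelope A u z < a \<Longrightarrow> \<exists>r>0. \<forall>y\<in>A \<inter> cball z r. u y < a"
    and usc_envelope_approx: "a < usc_envelope A u z \<Longrightarrow> 0 < r \<Longrightarrow> \<exists>y\<in>A \<inter> cball z r. a < u y"
proof -
  obtain r0 where r0: "r0 > 0" "bounded (u ` (A \<inter> cball z r0))"
    using lb z unfolding locally_bounded_on_def by blast
  define h where "h r = (SUP y\<in>A \<inter> cball z r. u y)" for r
  have bdd: "bdd_above (u ` (A \<inter> cball z r))" if "r \<le> r0" for r
    by (rule bdd_above_mono[OF bounded_imp_bdd_above[OF r0(2)]]) (use that in auto)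
  have h_ge: "u y \<le> h r" if "r \<le> r0" "y \<in> A \<inter> cball z r" for r y
    unfolding h_def by (rule cSUP_upper[OF that(2) bdd[OF that(1)]])
  have h_mono: "h r \<le> h r'" if "0 < r" "r \<le> r'" "r' \<le> r0" for r r'
    unfolding h_def by (rule cSUP_subset_mono) (use that z bdd in auto)
  define l where "l = Inf (h ` {0<..r0})"
  have bl: "bdd_below (h ` {0<..r0})" by (rule bdd_belowI[of _ "u z"]) (use h_ge z in auto)
  have l_le: "l \<le> h r" if "0 < r" "r \<le> r0" for r
    unfolding l_def by (rule cINF_lower[OF bl]) (use that in auto)
  have l_less: "\<exists>r1. 0 < r1 \<and> r1 \<le> r0 \<and> h r1 < a" if "l < a" for a
    using that r0 unfolding l_def by (subst (asm) cINF_less_iff[OF _ bl]) auto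
  have lim: "(h \<longlongrightarrow> l) (at_right 0)"
  proof (rule order_tendstoI)
    fix a assume "a < l"
    then have "a < h r" if "0 < r" "r < r0" for r using l_le[of r] that by simp
    then show "eventually (\<lambda>r. a < h r) (at_right 0)"
      unfolding eventually_at_right_field using r0 by blast
  next
    fix a assume "l < a"
    then obtain r1 where r1: "0 < r1" "r1 \<le> r0" "h r1 < a" using l_less by blast
    then have "h r < a" if "0 < r" "r < r1" for r using h_mono[of r r1] that by simp
    then show "eventually (\<lambda>r. h r < a) (at_right 0)"
      unfolding eventually_at_right_field using r1 by blast
  qed
  have l: "usc_envelope A u z = l"
    unfolding usc_envelope_def using lim unfolding h_def[abs_def]
    by (intro tendsto_Lim) auto
  show "((\<lambda>r. SUP y\<in>A \<inter> cball z r. u y) \<longlongrightarrow> usc_envelope A u z) (at_right 0)"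
    using lim unfolding l h_def[abs_def] .
  show "u z \<le> usc_envelope A u z" unfolding l unfolding l_def
    by (rule cINF_greatest) (use r0 z h_ge in auto)
  show "\<exists>r>0. \<forall>y\<in>A \<inter> cball z r. u y < a" if "usc_envelope A u z < a"
  proof -
    have "l < a" using that l by simp
    from l_less[OF this] obtain r1 where r1: "0 < r1" "r1 \<le> r0" "h r1 < a" by blast
    then have "u y < a" if "y \<in> A \<inter> cball z r1" for y using h_ge[of r1 y] that by simp
    then show ?thesis using r1 by blast
  qed
  show "\<exists>y\<in>A \<inter> cball z r. a < u y" if a: "a < usc_envelope A u z" and r: "0 < r"
  proof -
    define r' where "r' = min r r0"
    have "a < h r'" using l_le[of r'] a r r0 by (simp add: r'_def l)
    moreover have r': "r' \<le> r0" "r' \<le> r" and ne: "A \<inter> cball z r' \<noteq> {}" using z r r0 by (auto simp: r'_def)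
    ultimately have "\<exists>y\<in>A \<inter> cball z r'. a < u y"
      unfolding h_def using less_cSUP_iff[OF ne bdd[OF r'(1)], of a] by blast
    then show ?thesis using r'(2) by auto
  qed
qed

lemma usc_envelope_usc:
  fixes u :: "'a::euclidean_space \<Rightarrow> real"
  assumes lb: "locally_bounded_on A u"
  shows "usc_on A (usc_envelope A u)"
  unfolding usc_on_def
proof (intro ballI allI impI)
  fix z a assume z: "z \<in> A" and "usc_envelope A u z < a"
  then obtain b where b: "usc_envelope A u z < b" "b < a" using dense by blast
  then obtain r where r: "r > 0" "\<And>y. y \<in> A \<inter> cball z r \<Longrightarrow> u y < b"
    using usc_envelope_less[OF lb z b(1)] by blast
  have "usc_envelope A u y < a" if y: "y \<in> A" "dist y z < r" for y
  proof (rule ccontr)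
    assume "\<not> usc_envelope A u y < a"
    then have "b < usc_envelope A u y" using b by simp
    then obtain w where w: "w \<in> A \<inter> cball y (r - dist y z)" "b < u w"
      using usc_envelope_approx[OF lb y(1), of b "r - dist y z"] y by auto
    have "dist z w \<le> r" using w(1) dist_triangle[of z w y] by (simp add: dist_commute)
    then show False using r(2)[of w] w by simp
  qed
  then show "\<forall>\<^sub>F y in nhds z. y \<in> A \<longrightarrow> usc_envelope A u y < a"
    unfolding eventually_nhds_metric using r(1) by blast
qed

text \<open>Together with \<open>usc_envelope_ge\<close> and \<open>usc_envelope_usc\<close> this
  characterises the envelope as the least upper semicontinuous majorant, the form in which envelopes
  are compared later.\<close>

lemma usc_envelope_least:
  fixes u :: "'a::euclidean_space \<Rightarrow> real"
  assumes lb: "locally_bounded_on A u" and g: "usc_on A g"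
    and le: "\<And>y. y \<in> A \<Longrightarrow> u y \<le> g y" and z: "z \<in> A"
  shows "usc_envelope A u z \<le> g z"
proof (rule ccontr)
  assume "\<not> ?thesis"
  then have "g z < usc_envelope A u z" by simp
  then obtain b where b: "g z < b" "b < usc_envelope A u z" using dense by blast
  obtain d where d: "d > 0" "\<And>y. dist y z < d \<Longrightarrow> y \<in> A \<Longrightarrow> g y < b"
    using usc_onD[OF g z b(1)] unfolding eventually_nhds_metric by blast
  obtain y where y: "y \<in> A \<inter> cball z (d/2)" "b < u y"
    using usc_envelope_approx[OF lb z b(2), of "d/2"] d by auto
  then have "g y < b" using d by (auto simp: dist_commute)
  then show False using y le[of y] by simp
qed

lemma usc_envelope_continuous:
  fixes u :: "'a::euclidean_space \<Rightarrow> real"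
  assumes A: "open A" and u: "continuous_on A u" and z: "z \<in> A"
  shows "usc_envelope A u z = u z"
proof -
  have lb: "locally_bounded_on A u" by (rule locally_bounded_on_between[OF A u u]) auto
  show ?thesis
    using usc_envelope_least[OF lb continuous_imp_usc_on[OF u] _ z] usc_envelope_ge[OF lb z] by force
qed

lemma locally_bounded_on_uminus:
  assumes "locally_bounded_on A u"
  shows "locally_bounded_on A (\<lambda>y. - u y)"
proof -
  have "bounded (u ` B) \<Longrightarrow> bounded ((\<lambda>y. - u y) ` B)" for B
    unfolding bounded_iff by auto
  then show ?thesis using assms unfolding locally_bounded_on_def by blast
qed

text \<open>Reduces lower envelopes to upper ones; a real infimum is the negated supremum of the
  negated values.\<close>

lemma lsc_envelope_uminus:
  fixes u :: "'a::euclidean_space \<Rightarrow> real"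
  assumes lb: "locally_bounded_on A u" and z: "z \<in> A"
  shows "lsc_envelope A u z = - usc_envelope A (\<lambda>y. - u y) z"
proof -
  have "((\<lambda>r. - (SUP y\<in>A \<inter> cball z r. - u y)) \<longlongrightarrow> - usc_envelope A (\<lambda>y. - u y) z) (at_right 0)"
    by (intro tendsto_minus usc_envelope_tendsto locally_bounded_on_uminus lb z)
  moreover have "- (SUP y\<in>B. - u y) = (INF y\<in>B. u y)" for B
    by (simp add: Inf_real_def image_image)
  ultimately show ?thesis
    unfolding lsc_envelope_def by (intro tendsto_Lim) auto
qed

lemma lsc_envelope_continuous:
  fixes u :: "'a::euclidean_space \<Rightarrow> real"
  assumes A: "open A" and u: "continuous_on A u" and z: "z \<in> A"
  shows "lsc_envelope A u z = u z"
proof -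
  have lb: "locally_bounded_on A u" by (rule locally_bounded_on_between[OF A u u]) auto
  show ?thesis unfolding lsc_envelope_uminus[OF lb z]
    using usc_envelope_continuous[OF A _ z, of "\<lambda>y. - u y"] u by (simp add: continuous_on_minus)
qed

section \<open>Perron's method\<close>

text \<open>The test-function clause of \<open>viscosity_subsolution\<close>, detached from
  envelopes and boundedness so that it can be stated for a function that is already semicontinuous,
  such as a barrier or an envelope.\<close>

definition sub_test :: "'a::euclidean_space set \<Rightarrow> ('a \<Rightarrow> real \<Rightarrow> 'a \<Rightarrow> real) \<Rightarrow> ('a \<Rightarrow> real) \<Rightarrow> bool" where
  "sub_test A G U \<longleftrightarrow>
     (\<forall>\<psi> D z. (\<forall>y\<in>A. GDERIV \<psi> y :> D y) \<and> continuous_on A D \<and> z \<in> A \<and>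
        (\<forall>y\<in>A. U y - \<psi> y \<le> U z - \<psi> z) \<longrightarrow> G z (U z) (D z) \<le> 0)"

definition super_test :: "'a::euclidean_space set \<Rightarrow> ('a \<Rightarrow> real \<Rightarrow> 'a \<Rightarrow> real) \<Rightarrow> ('a \<Rightarrow> real) \<Rightarrow> bool" where
  "super_test A G U \<longleftrightarrow>
     (\<forall>\<psi> D z. (\<forall>y\<in>A. GDERIV \<psi> y :> D y) \<and> continuous_on A D \<and> z \<in> A \<and>
        (\<forall>y\<in>A. U z - \<psi> z \<le> U y - \<psi> y) \<longrightarrow> G z (U z) (D z) \<ge> 0)"

lemma sub_testD:
  assumes "sub_test A G U" "\<And>y. y \<in> A \<Longrightarrow> GDERIV \<psi> y :> D y" "continuous_on A D" "z \<in> A"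
    "\<And>y. y \<in> A \<Longrightarrow> U y - \<psi> y \<le> U z - \<psi> z"
  shows "G z (U z) (D z) \<le> 0"
  using assms unfolding sub_test_def by blast

lemma super_testD:
  assumes "super_test A G U" "\<And>y. y \<in> A \<Longrightarrow> GDERIV \<psi> y :> D y" "continuous_on A D" "z \<in> A"
    "\<And>y. y \<in> A \<Longrightarrow> U z - \<psi> z \<le> U y - \<psi> y"
  shows "G z (U z) (D z) \<ge> 0"
  using assms unfolding super_test_def by blast

lemma sub_test_cong:
  assumes "\<And>z. z \<in> A \<Longrightarrow> U z = V z"
  shows "sub_test A G U = sub_test A G V"
  unfolding sub_test_def by (intro all_cong1 imp_cong) (auto simp: assms)

lemma super_test_cong:
  assumes "\<And>z. z \<in> A \<Longrightarrow> U z = V z"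
  shows "super_test A G U = super_test A G V"
  unfolding super_test_def by (intro all_cong1 imp_cong) (auto simp: assms)

lemma GDERIV_norm_diff_sq: "GDERIV (\<lambda>y. (y - z) \<bullet> (y - z)) y :> 2 *\<^sub>R (y - z)"
  unfolding gderiv_def
  by (auto intro!: derivative_eq_intros simp: inner_commute algebra_simps)

lemma gradient_eq_at_max:
  fixes f g :: "'a::euclidean_space \<Rightarrow> real"
  assumes A: "open A" "y \<in> A" and f: "GDERIV f y :> a" and g: "GDERIV g y :> b"
    and max: "\<And>x. x \<in> A \<Longrightarrow> f x - g x \<le> f y - g y"
  shows "a = b"
proof -
  have "((\<lambda>x. f x - g x) has_derivative (\<lambda>h. h \<bullet> (a - b))) (at y)"
    using has_derivative_diff[of f "\<lambda>h. h \<bullet> a" "at y" g "\<lambda>h. h \<bullet> b"] f g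
    by (simp add: gderiv_def inner_diff_right)
  from differential_zero_maxmin[OF A(2,1) this] have "(\<lambda>h. h \<bullet> (a - b)) = (\<lambda>v. 0)"
    using max by blast
  then have "(a - b) \<bullet> (a - b) = 0" by metis
  then show ?thesis by simp
qed

lemma GDERIV_continuous_on:
  assumes "\<And>y. y \<in> A \<Longrightarrow> GDERIV \<psi> y :> D y"
  shows "continuous_on A \<psi>"
  using assms unfolding gderiv_def
  by (meson continuous_at_imp_continuous_on has_derivative_continuous)

lemma eventually_closeness:
  fixes f :: "'a::metric_space \<Rightarrow> 'b::metric_space"
  assumes "continuous_on A f" "open A" "z \<in> A" "e > 0"
  shows "\<forall>\<^sub>F y in nhds z. dist (f y) (f z) < e"
proof -
  have "isCont f z" using assms continuous_on_eq_continuous_at by blast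
  then have "(f \<longlongrightarrow> f z) (nhds z)" unfolding isCont_def tendsto_at_iff_tendsto_nhds .
  then show ?thesis using assms(4) by (rule tendstoD)
qed

lemma eventually_nhds_cball:
  fixes z :: "'a::metric_space"
  assumes "eventually P (nhds z)"
  obtains r where "r > 0" "\<And>y. y \<in> cball z r \<Longrightarrow> P y"
proof -
  obtain d where d: "d > 0" "\<And>y. dist y z < d \<Longrightarrow> P y"
    using assms unfolding eventually_nhds_metric by blast
  show thesis by (rule that[of "d/2"]) (use d in \<open>auto simp: dist_commute\<close>)
qed

lemma continuous_G_near:
  fixes G :: "'a::euclidean_space \<Rightarrow> real \<Rightarrow> 'a \<Rightarrow> real"
  assumes G: "continuous_on (A \<times> UNIV) (\<lambda>(z, u, p). G z u p)" and A: "open A" "z \<in> A"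
    and W: "open W" "G z u p \<in> W"
  obtains \<eta> where "\<eta> > 0"
    "\<And>y a q. y \<in> A \<Longrightarrow> dist y z < \<eta> \<Longrightarrow> \<bar>a - u\<bar> < \<eta> \<Longrightarrow> dist q p < \<eta> \<Longrightarrow> G y a q \<in> W"
proof -
  define P where "P = (\<lambda>(z, u, p). G z u p) -` W \<inter> (A \<times> (UNIV :: (real \<times> 'a) set))"
  have "open P" unfolding P_def
    using G W(1) continuous_on_open_vimage[OF open_Times[OF A(1) open_UNIV], of "\<lambda>(z, u, p). G z u p"] by blast
  moreover have "(z, u, p) \<in> P" using A W by (simp add: P_def)
  ultimately obtain e where e: "e > 0" "ball (z, u, p) e \<subseteq> P" using open_contains_ball by blast
  show thesis
  proof (rule that[of "e/3"])
    fix y a q assume y: "y \<in> A" "dist y z < e/3" "\<bar>a - u\<bar> < e/3" "dist q p < e/3"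
    have "dist (z, u, p) (y, a, q) \<le> dist z y + dist (u, p) (a, q)"
      unfolding dist_Pair_Pair[of z _ y] by (rule sqrt_sum_squares_le_sum) auto
    also have "dist (u, p) (a, q) \<le> dist u a + dist p q"
      unfolding dist_Pair_Pair by (rule sqrt_sum_squares_le_sum) auto
    finally have "(y, a, q) \<in> ball (z, u, p) e"
      using y by (simp add: dist_commute dist_real_def abs_minus_commute)
    then show "G y a q \<in> W" using e(2) by (auto simp: P_def)
  qed (use e in simp)
qed

text \<open>A test function touches the envelope of the supremum and not the members of
  \<open>F\<close>. Adding |y - z|^2 makes the contact strict, so a member that nearly attains the
  value at z has a contact point of its own near z; its subsolution inequality there contradicts G >
  0 around z.\<close>

lemma sup_is_subsolution:
  fixes G :: "'a::euclidean_space \<Rightarrow> real \<Rightarrow> 'a \<Rightarrow> real"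
  assumes A: "open A" and G: "continuous_on (A \<times> UNIV) (\<lambda>(z, u, p). G z u p)"
    and lb: "locally_bounded_on A \<phi>" and lbF: "\<And>u. u \<in> F \<Longrightarrow> locally_bounded_on A u"
    and sub: "\<And>u. u \<in> F \<Longrightarrow> sub_test A G (usc_envelope A u)"
    and le: "\<And>u z. u \<in> F \<Longrightarrow> z \<in> A \<Longrightarrow> u z \<le> \<phi> z"
    and sup: "\<And>z a. z \<in> A \<Longrightarrow> a < \<phi> z \<Longrightarrow> \<exists>u\<in>F. a < u z"
  shows "sub_test A G (usc_envelope A \<phi>)"
  unfolding sub_test_def
proof (intro allI impI, elim conjE)
  fix \<psi> D z
  let ?U = "usc_envelope A \<phi>"
  assume \<psi>: "\<forall>y\<in>A. GDERIV \<psi> y :> D y" and D: "continuous_on A D" and z: "z \<in> A"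
    and max: "\<forall>y\<in>A. ?U y - \<psi> y \<le> ?U z - \<psi> z"
  show "G z (?U z) (D z) \<le> 0"
  proof (rule ccontr)
    assume "\<not> G z (?U z) (D z) \<le> 0"
    then have "G z (?U z) (D z) \<in> {0<..}" by simp
    then obtain \<eta> where \<eta>: "\<eta> > 0"
      "\<And>y a q. y \<in> A \<Longrightarrow> dist y z < \<eta> \<Longrightarrow> \<bar>a - ?U z\<bar> < \<eta> \<Longrightarrow> dist q (D z) < \<eta> \<Longrightarrow> G y a q \<in> {0<..}"
      using continuous_G_near[OF G A z open_greaterThan] by blast
    define \<psi>' where "\<psi>' y = \<psi> y + (y - z) \<bullet> (y - z)" for y
    define D' where "D' y = D y + 2 *\<^sub>R (y - z)" for y
    have \<psi>': "GDERIV \<psi>' y :> D' y" if "y \<in> A" for y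
      unfolding \<psi>'_def D'_def by (rule GDERIV_add) (use \<psi> that GDERIV_norm_diff_sq in auto)
    have D': "continuous_on A D'" unfolding D'_def by (intro continuous_intros D)
    have \<psi>'c: "continuous_on A \<psi>'" by (rule GDERIV_continuous_on) (rule \<psi>')
    have z': "\<psi>' z = \<psi> z" "D' z = D z" by (simp_all add: \<psi>'_def D'_def)
    have "\<forall>\<^sub>F y in nhds z. y \<in> A \<and> dist y z < \<eta> \<and> dist (\<psi>' y) (\<psi>' z) < \<eta>/2 \<and> dist (D' y) (D' z) < \<eta>"
      using \<eta>(1) by (intro eventually_conj eventually_closeness[OF \<psi>'c A z]
        eventually_closeness[OF D' A z] eventually_nhds_in_open[OF A z])
        (auto simp: eventually_nhds_metric)
    then obtain r where r: "r > 0" "\<And>y. y \<in> cball z r \<Longrightarrow>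
        y \<in> A \<and> dist y z < \<eta> \<and> dist (\<psi>' y) (\<psi>' z) < \<eta>/2 \<and> dist (D' y) (D' z) < \<eta>"
      by (rule eventually_nhds_cball) blast
    have rA: "cball z r \<subseteq> A" using r(2) by blast
    \<comment> \<open>\<open>3 * \<epsilon>\<close> collects three errors: from the envelope to
      \<phi> at \<open>y0\<close>, from \<phi> to the member \<open>u\<close>, and the variation of
      \<open>\<psi>'\<close>. Being below \<open>r\<^sup>2\<close> it makes the maximum over the
      ball global; being below \<open>\<eta>/2\<close> it keeps the value at the contact point in
      the range where G > 0.\<close>
    define \<epsilon> where "\<epsilon> = min (r\<^sup>2) (\<eta>/2) / 4"
    have \<epsilon>: "\<epsilon> > 0" "3 * \<epsilon> < r\<^sup>2" "3 * \<epsilon> < \<eta>/2" using r \<eta> by (auto simp: \<epsilon>_def min_def)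
    obtain \<rho> where \<rho>: "\<rho> > 0" "\<And>y. y \<in> cball z \<rho> \<Longrightarrow> dist (\<psi>' y) (\<psi>' z) < \<epsilon>"
      by (rule eventually_nhds_cball[OF eventually_closeness[OF \<psi>'c A z \<epsilon>(1)]]) blast
    obtain y0 where y0: "y0 \<in> A" "y0 \<in> cball z (min r \<rho>)" "?U z - \<epsilon> < \<phi> y0"
      using usc_envelope_approx[OF lb z, of "?U z - \<epsilon>" "min r \<rho>"] \<epsilon> r \<rho> by auto
    obtain u where u: "u \<in> F" "\<phi> y0 - \<epsilon> < u y0" using sup[OF y0(1), of "\<phi> y0 - \<epsilon>"] \<epsilon> by auto
    let ?u = "usc_envelope A u"
    have u_le: "?u y \<le> ?U y" if "y \<in> A" for y
    proof (rule usc_envelope_least[OF lbF[OF u(1)] usc_envelope_usc[OF lb] _ that])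
      fix w assume w: "w \<in> A"
      show "u w \<le> ?U w" using le[OF u(1) w] usc_envelope_ge[OF lb w] by linarith
    qed
    have y0_val: "?u y0 - \<psi>' y0 > ?U z - \<psi> z - 3 * \<epsilon>"
      using usc_envelope_ge[OF lbF[OF u(1)] y0(1)] u(2) y0 \<rho>(2)[of y0] z'
      by (auto simp: dist_real_def)
    have uscf: "usc_on (cball z r) (\<lambda>y. ?u y + (- \<psi>' y))"
      by (intro usc_on_add usc_on_subset[OF usc_envelope_usc[OF lbF[OF u(1)]] rA]
          continuous_imp_usc_on continuous_on_minus continuous_on_subset[OF \<psi>'c rA])
    have "cball z r \<noteq> {}" using r(1) by simp
    from usc_attains_max[OF compact_cball this uscf]
    obtain x where x: "x \<in> cball z r" "\<And>y. y \<in> cball z r \<Longrightarrow> ?u y + - \<psi>' y \<le> ?u x + - \<psi>' x"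
      by blast
    have xA: "x \<in> A" using x rA by blast
    have x_ge: "?u x - \<psi>' x \<ge> ?u y0 - \<psi>' y0" using x(2)[of y0] y0 by auto
    \<comment> \<open>The test condition compares on all of \<open>A\<close>. Outside the ball the
      quadratic term costs at least \<open>r\<^sup>2\<close>, more than the
      \<open>3 * \<epsilon>\<close> lost at \<open>y0\<close>.\<close>
    have x_max: "?u y - \<psi>' y \<le> ?u x - \<psi>' x" if y: "y \<in> A" for y
    proof (cases "y \<in> cball z r")
      case True then show ?thesis using x(2) by simp
    next
      case False
      then have "r\<^sup>2 \<le> (norm (y - z))\<^sup>2" using r by (intro power_mono) (auto simp: dist_norm norm_minus_commute)
      then have "?u y - \<psi>' y \<le> ?U z - \<psi> z - r\<^sup>2"
        using u_le[OF y] max y by (auto simp: \<psi>'_def dot_square_norm dest!: bspec)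
      then show ?thesis using x_ge y0_val \<epsilon> by simp
    qed
    have "G x (?u x) (D' x) \<le> 0"
      by (rule sub_testD[OF sub[OF u(1)] \<psi>' D' xA x_max])
    moreover have "G x (?u x) (D' x) \<in> {0<..}"
    proof (rule \<eta>(2)[OF xA])
      have "?u x - \<psi> x \<le> ?U z - \<psi> z" using u_le[OF xA] max xA by force
      moreover have "\<psi> x \<le> \<psi>' x" by (simp add: \<psi>'_def)
      moreover have "dist (\<psi>' x) (\<psi>' z) < \<eta>/2" using r(2)[OF x(1)] by blast
      ultimately show "\<bar>?u x - ?U z\<bar> < \<eta>"
        using x_ge y0_val \<epsilon>(3) z'(1) unfolding dist_real_def by linarith
    qed (use r(2)[OF x(1)] z' in auto)
    ultimately show False by simp
  qed
qed

text \<open>If \<open>lsc_envelope A \<phi>\<close> fails the supersolution test at \<open>z\<close> with test function \<open>\<psi>\<close>, then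
  \<open>\<beta> y = \<psi> y - \<psi> z + lsc_envelope A \<phi> z + \<delta> - |y - z|\<^sup>2\<close> is a strict subsolution near \<open>z\<close> and lies
  below \<open>\<phi>\<close> away from \<open>z\<close>, so that \<open>max \<phi> \<beta>\<close> contradicts the maximality of \<open>\<phi>\<close>.\<close>

theorem perron_method:
  fixes G :: "'a::euclidean_space \<Rightarrow> real \<Rightarrow> 'a \<Rightarrow> real"
  assumes A: "open A" and G: "continuous_on (A \<times> UNIV) (\<lambda>(z, u, p). G z u p)"
    and s: "continuous_on A s" and S: "continuous_on A S" and sS: "\<And>z. z \<in> A \<Longrightarrow> s z \<le> S z"
    and s_sub: "sub_test A G s" and S_super: "super_test A G S"
  obtains \<phi> where "\<And>z. z \<in> A \<Longrightarrow> s z \<le> \<phi> z" "\<And>z. z \<in> A \<Longrightarrow> \<phi> z \<le> S z"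
    "sub_test A G (usc_envelope A \<phi>)" "super_test A G (lsc_envelope A \<phi>)"
proof -
  define F where "F = {u. (\<forall>z\<in>A. s z \<le> u z \<and> u z \<le> S z) \<and> sub_test A G (usc_envelope A u)}"
  have sF: "s \<in> F" using sS s_sub sub_test_cong[of A "usc_envelope A s" s G] usc_envelope_continuous[OF A s]
    by (simp add: F_def)
  have F_between: "s z \<le> u z \<and> u z \<le> S z" if "u \<in> F" "z \<in> A" for u z using that by (simp add: F_def)
  have lbF: "locally_bounded_on A u" if "u \<in> F" for u
    by (rule locally_bounded_on_between[OF A s S F_between[OF that]])
  define \<phi> where "\<phi> z = (SUP u\<in>F. u z)" for z
  have bdd: "bdd_above ((\<lambda>u. u z) ` F)" if "z \<in> A" for z
    by (rule bdd_aboveI[of _ "S z"]) (use F_between that in auto)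
  have \<phi>_ge: "u z \<le> \<phi> z" if "u \<in> F" "z \<in> A" for u z
    unfolding \<phi>_def by (rule cSUP_upper[OF that(1) bdd[OF that(2)]])
  have s\<phi>: "s z \<le> \<phi> z" and \<phi>S: "\<phi> z \<le> S z" if "z \<in> A" for z
  proof -
    show "s z \<le> \<phi> z" by (rule \<phi>_ge[OF sF that])
    show "\<phi> z \<le> S z" unfolding \<phi>_def by (rule cSUP_least) (use sF F_between that in auto)
  qed
  have lb: "locally_bounded_on A \<phi>"
    by (rule locally_bounded_on_between[OF A s S]) (use s\<phi> \<phi>S in auto)
  have sub: "sub_test A G (usc_envelope A \<phi>)"
  proof (rule sup_is_subsolution[where F=F, OF A G lb])
    show "\<exists>u\<in>F. a < u z" if "z \<in> A" "a < \<phi> z" for z a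
      using that less_cSUP_iff[OF _ bdd[OF that(1)], of a] sF by (auto simp: \<phi>_def)
  qed (auto simp: F_def intro: lbF \<phi>_ge)
  let ?V = "lsc_envelope A \<phi>"
  have V: "?V z = - usc_envelope A (\<lambda>y. - \<phi> y) z" if "z \<in> A" for z
    by (rule lsc_envelope_uminus[OF lb that])
  have V_le: "?V z \<le> \<phi> z" if "z \<in> A" for z
    using usc_envelope_ge[OF locally_bounded_on_uminus[OF lb] that] V[OF that] by simp
  have super: "super_test A G ?V"
    unfolding super_test_def
  proof (intro allI impI, elim conjE)
    fix \<psi> D z
    assume \<psi>: "\<forall>y\<in>A. GDERIV \<psi> y :> D y" and D: "continuous_on A D" and z: "z \<in> A"
      and min: "\<forall>y\<in>A. ?V z - \<psi> z \<le> ?V y - \<psi> y"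
    show "0 \<le> G z (?V z) (D z)"
    proof (rule ccontr)
      assume neg: "\<not> 0 \<le> G z (?V z) (D z)"
      have \<psi>c: "continuous_on A \<psi>" by (rule GDERIV_continuous_on) (use \<psi> in auto)
      \<comment> \<open>If the lower envelope met \<open>S\<close> at z, then \<psi> would touch
        \<open>S\<close> from below as well, and \<open>S\<close> passes the supersolution test. The
        gap \<gamma> leaves room for a bump below \<open>S\<close>.\<close>
      have "?V z < S z"
      proof (rule ccontr)
        assume "\<not> ?V z < S z"
        then have eq: "?V z = S z" using V_le[OF z] \<phi>S[OF z] by simp
        have "0 \<le> G z (S z) (D z)"
        proof (rule super_testD[OF S_super, of \<psi> D z])
          fix y assume y: "y \<in> A"
          show "S z - \<psi> z \<le> S y - \<psi> y" using min y V_le[OF y] \<phi>S[OF y] eq by force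
        qed (use \<psi> D z in auto)
        then show False using neg eq by simp
      qed
      define \<gamma> where "\<gamma> = S z - ?V z"
      have \<gamma>: "\<gamma> > 0" using \<open>?V z < S z\<close> by (simp add: \<gamma>_def)
      from neg have "G z (?V z) (D z) \<in> {..<0}" by simp
      then obtain \<eta> where \<eta>: "\<eta> > 0"
        "\<And>y a q. y \<in> A \<Longrightarrow> dist y z < \<eta> \<Longrightarrow> \<bar>a - ?V z\<bar> < \<eta> \<Longrightarrow> dist q (D z) < \<eta> \<Longrightarrow> G y a q \<in> {..<0}"
        using continuous_G_near[OF G A z open_lessThan] by blast
      define q where "q y = \<psi> y - (y - z) \<bullet> (y - z)" for y
      define D' where "D' y = D y - 2 *\<^sub>R (y - z)" for y
      have q: "GDERIV q y :> D' y" if "y \<in> A" for y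
        unfolding q_def D'_def by (rule GDERIV_diff) (use \<psi> that GDERIV_norm_diff_sq in auto)
      have D': "continuous_on A D'" unfolding D'_def by (intro continuous_intros D)
      have qc: "continuous_on A q" by (rule GDERIV_continuous_on) (rule q)
      have z': "q z = \<psi> z" "D' z = D z" by (simp_all add: q_def D'_def)
      have pos: "min (\<eta>/2) (\<gamma>/4) > 0" using \<eta> \<gamma> by simp
      have "\<forall>\<^sub>F y in nhds z. y \<in> A \<and> dist y z < \<eta> \<and> dist (q y) (q z) < min (\<eta>/2) (\<gamma>/4)
          \<and> dist (D' y) (D' z) < \<eta> \<and> dist (S y) (S z) < \<gamma>/4"
        using \<eta>(1) \<gamma> pos by (intro eventually_conj eventually_closeness[OF qc A z]
          eventually_closeness[OF D' A z] eventually_closeness[OF S A z] eventually_nhds_in_open[OF A z])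
          (auto simp: eventually_nhds_metric)
      then obtain r where r: "r > 0" "\<And>y. y \<in> cball z r \<Longrightarrow>
          y \<in> A \<and> dist y z < \<eta> \<and> dist (q y) (q z) < min (\<eta>/2) (\<gamma>/4) \<and> dist (D' y) (D' z) < \<eta> \<and> dist (S y) (S z) < \<gamma>/4"
        by (rule eventually_nhds_cball) blast
      \<comment> \<open>\<open>\<delta> < r\<^sup>2\<close> puts \<beta> below the lower envelope
        outside the ball, \<open>\<delta> < \<eta>/2\<close> keeps its values where G < 0, and
        \<open>\<delta> < \<gamma>/4\<close> keeps it below \<open>S\<close>.\<close>
      define \<delta> where "\<delta> = min (r\<^sup>2) (min (\<eta>/2) (\<gamma>/4)) / 2"
      have \<delta>: "\<delta> > 0" "\<delta> < r\<^sup>2" "\<delta> < \<eta>/2" "\<delta> < \<gamma>/4"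
        using r \<eta> \<gamma> by (auto simp: \<delta>_def min_def)
      define \<beta> where "\<beta> y = q y + (?V z + \<delta> - \<psi> z)" for y
      have \<beta>: "GDERIV \<beta> y :> D' y" if "y \<in> A" for y
        using GDERIV_add[OF q[OF that] GDERIV_const] by (simp add: \<beta>_def[abs_def])
      have \<beta>c: "continuous_on A \<beta>" by (rule GDERIV_continuous_on) (rule \<beta>)
      have \<beta>_far: "\<beta> y < ?V y" if y: "y \<in> A" "y \<notin> cball z r" for y
      proof -
        have "r\<^sup>2 \<le> (norm (y - z))\<^sup>2" using r y by (intro power_mono) (auto simp: dist_norm norm_minus_commute)
        moreover have "?V z - \<psi> z \<le> ?V y - \<psi> y" using min y by blast
        ultimately show ?thesis using \<delta> by (simp add: \<beta>_def q_def dot_square_norm)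
      qed
      have \<beta>S: "\<beta> y \<le> S y" if y: "y \<in> A" for y
      proof (cases "y \<in> cball z r")
        case True
        then have "dist (q y) (q z) < \<gamma>/4" "dist (S y) (S z) < \<gamma>/4" using r(2)[OF True] by simp_all
        then have "q y - q z < \<gamma>/4" "S z - S y < \<gamma>/4"
          unfolding dist_real_def by (simp_all only: abs_less_iff minus_diff_eq)
        then show ?thesis using z'(1) \<delta>(4) \<gamma> \<gamma>_def unfolding \<beta>_def by linarith
      next
        case False
        then show ?thesis using \<beta>_far[OF y] V_le[OF y] \<phi>S[OF y] by simp
      qed
      define U where "U y = max (\<phi> y) (\<beta> y)" for y
      have U_between: "s y \<le> U y \<and> U y \<le> S y" if "y \<in> A" for y
        using s\<phi>[OF that] \<phi>S[OF that] \<beta>S[OF that] by (simp add: U_def)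
      have lbU: "locally_bounded_on A U" by (rule locally_bounded_on_between[OF A s S U_between])
      have lb\<beta>: "locally_bounded_on A \<beta>" by (rule locally_bounded_on_between[OF A \<beta>c \<beta>c]) auto
      have U_env: "usc_envelope A U y = max (usc_envelope A \<phi> y) (\<beta> y)" if y: "y \<in> A" for y
      proof (rule antisym)
        show "usc_envelope A U y \<le> max (usc_envelope A \<phi> y) (\<beta> y)"
        proof (rule usc_envelope_least[OF lbU usc_on_max[OF usc_envelope_usc[OF lb] continuous_imp_usc_on[OF \<beta>c]] _ y])
          fix w assume w: "w \<in> A"
          show "U w \<le> max (usc_envelope A \<phi> w) (\<beta> w)"
            using usc_envelope_ge[OF lb w] by (auto simp: U_def)
        qed
        have U_ge: "U w \<le> usc_envelope A U w" if "w \<in> A" for w by (rule usc_envelope_ge[OF lbU that])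
        have "usc_envelope A \<phi> y \<le> usc_envelope A U y"
        proof (rule usc_envelope_least[OF lb usc_envelope_usc[OF lbU] _ y])
          fix w assume "w \<in> A"
          then show "\<phi> w \<le> usc_envelope A U w" using U_ge[of w] by (auto simp: U_def)
        qed
        moreover have "\<beta> y \<le> usc_envelope A U y" using U_ge[OF y] by (auto simp: U_def)
        ultimately show "max (usc_envelope A \<phi> y) (\<beta> y) \<le> usc_envelope A U y" by simp
      qed
      have "sub_test A G (usc_envelope A U)"
        unfolding sub_test_def
      proof (intro allI impI, elim conjE)
        fix \<theta> E y
        assume \<theta>: "\<forall>w\<in>A. GDERIV \<theta> w :> E w" and E: "continuous_on A E" and y: "y \<in> A"
          and max: "\<forall>w\<in>A. usc_envelope A U w - \<theta> w \<le> usc_envelope A U y - \<theta> y"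
        show "G y (usc_envelope A U y) (E y) \<le> 0"
        \<comment> \<open>The test function touches either the envelope of \<phi>, which passes the
          test, or the bump \<beta>; in the second case y lies in the ball, the gradients agree and
          G < 0.\<close>
        proof (cases "\<beta> y \<le> usc_envelope A \<phi> y")
          case True
          then have eq: "usc_envelope A U y = usc_envelope A \<phi> y" using U_env[OF y] by simp
          have "G y (usc_envelope A \<phi> y) (E y) \<le> 0"
          proof (rule sub_testD[OF sub, of \<theta> E y])
            fix w assume w: "w \<in> A"
            show "usc_envelope A \<phi> w - \<theta> w \<le> usc_envelope A \<phi> y - \<theta> y"
              using max w U_env[OF w] eq by force
          qed (use \<theta> E y in auto)
          then show ?thesis using eq by simp
        next
          case False
          then have eq: "usc_envelope A U y = \<beta> y" using U_env[OF y] by simp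
          have yr: "y \<in> cball z r"
          proof (rule ccontr)
            assume "y \<notin> cball z r"
            then have "\<beta> y < ?V y" using \<beta>_far y by blast
            also have "\<dots> \<le> usc_envelope A \<phi> y"
              using V_le[OF y] usc_envelope_ge[OF lb y] by simp
            finally show False using False by simp
          qed
          have "D' y = E y"
          proof (rule gradient_eq_at_max[OF A y \<beta>[OF y]])
            show "GDERIV \<theta> y :> E y" using \<theta> y by blast
            fix w assume w: "w \<in> A"
            show "\<beta> w - \<theta> w \<le> \<beta> y - \<theta> y" using max w U_env[OF w] eq by force
          qed
          moreover have "G y (\<beta> y) (D' y) \<in> {..<0}"
          proof (rule \<eta>(2)[OF y])
            have "dist (q y) (q z) < \<eta>/2" using r(2)[OF yr] by simp
            then have "q y - q z < \<eta>/2" "q z - q y < \<eta>/2"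
              unfolding dist_real_def by (simp_all only: abs_less_iff minus_diff_eq)
            then show "\<bar>\<beta> y - ?V z\<bar> < \<eta>"
              using z'(1) \<delta>(1,3) unfolding \<beta>_def abs_less_iff by linarith
          qed (use r(2)[OF yr] z' in auto)
          ultimately show ?thesis using eq by simp
        qed
      qed
      then have "U \<in> F" using U_between by (simp add: F_def)
      then have \<beta>\<phi>: "\<beta> y \<le> \<phi> y" if "y \<in> A" for y using \<phi>_ge[OF _ that, of U] by (simp add: U_def)
      \<comment> \<open>At z the bump exceeds the lower envelope of \<phi> by \<delta>; but a
        continuous function below \<phi> is below its lower envelope.\<close>
      have "- \<beta> z < usc_envelope A (\<lambda>y. - \<phi> y) z"
        using V[OF z] \<delta> z' by (simp add: \<beta>_def)
      then have "- ?V z > - \<beta> z" using V[OF z] by simp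
      moreover have "usc_envelope A (\<lambda>y. - \<phi> y) z \<le> - \<beta> z"
        by (rule usc_envelope_least[OF locally_bounded_on_uminus[OF lb] continuous_imp_usc_on _ z])
          (use \<beta>\<phi> \<beta>c in \<open>auto intro: continuous_on_minus\<close>)
      ultimately show False using V[OF z] by simp
    qed
  qed
  from that[OF s\<phi> \<phi>S sub super] show thesis .
qed

section \<open>The comparison principle\<close>

text \<open>Negation turns the equation into one of the same form with R(t,x,-p), so a single
  inequality for subsolutions serves both variables of the doubled problem.\<close>

lemma super_test_uminus:
  assumes "super_test A (level_set_G v R) w"
  shows "sub_test A (level_set_G v (\<lambda>t x p. R t x (- p))) (\<lambda>z. - w z)"
  unfolding sub_test_def
proof (intro allI impI, elim conjE)
  fix \<psi> D and z :: "real \<times> (real^3)"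
  assume \<psi>: "\<forall>y\<in>A. GDERIV \<psi> y :> D y" and D: "continuous_on A D" and z: "z \<in> A"
    and max: "\<forall>y\<in>A. - w y - \<psi> y \<le> - w z - \<psi> z"
  have "0 \<le> level_set_G v R z (w z) (- D z)"
  proof (rule super_testD[OF assms, of "\<lambda>y. - \<psi> y" "\<lambda>y. - D y"])
    show "GDERIV (\<lambda>y. - \<psi> y) y :> - D y" if "y \<in> A" for y using \<psi> that by (intro GDERIV_minus) auto
    show "w z - - \<psi> z \<le> w y - - \<psi> y" if "y \<in> A" for y using max that by force
  qed (use D z in \<open>auto intro: continuous_on_minus\<close>)
  then show "level_set_G v (\<lambda>t x p. R t x (- p)) z (- w z) (D z) \<le> 0"
    by (cases z; cases "D z") (simp add: level_set_G_def algebra_simps)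
qed

text \<open>The test function is \<open>exp (\<lambda> * t)\<close> times the penalty, which turns the
  zeroth-order term \<open>- u * R\<close> into the strictly monotone \<open>\<lambda> * u - u * R\<close>.\<close>

lemma penalized_max_inequality:
  fixes u :: "real \<times> (real^3) \<Rightarrow> real" and y :: "real^3"
  assumes sub: "sub_test A (level_set_G v R) u"
    and A: "\<And>z. z \<in> A \<Longrightarrow> fst z < T" and z: "(t, x) \<in> A"
    and max: "\<And>z. z \<in> A \<Longrightarrow>
      exp (- l * fst z) * u z - \<sigma> / (T - fst z) - (a * ((snd z - y) \<bullet> (snd z - y)) + b * (fst z - s)\<^sup>2)
      \<le> exp (- l * t) * u (t, x) - \<sigma> / (T - t) - (a * ((x - y) \<bullet> (x - y)) + b * (t - s)\<^sup>2)"
    and \<sigma>: "\<sigma> \<ge> 0"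
  shows "l * (exp (- l * t) * u (t, x)) + 2 * b * (t - s) + v t x \<bullet> ((2 * a) *\<^sub>R (x - y))
    - exp (- l * t) * u (t, x) * R t x (exp (l * t) *\<^sub>R ((2 * a) *\<^sub>R (x - y))) \<le> 0"
proof -
  \<comment> \<open>The constant that makes exp(lt) q touch \<open>u\<close> from above at
    (t,x).\<close>
  define k where "k = exp (- l * t) * u (t, x) - \<sigma> / (T - t) - (a * ((x - y) \<bullet> (x - y)) + b * (t - s)\<^sup>2)"
  define q where "q z = k + \<sigma> / (T - fst z) + (a * ((snd z - y) \<bullet> (snd z - y)) + b * (fst z - s)\<^sup>2)" for z :: "real \<times> (real^3)"
  define D where "D z = (l * (exp (l * fst z) * q z) + exp (l * fst z) * (\<sigma> / (T - fst z)\<^sup>2 + 2 * b * (fst z - s)),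
      exp (l * fst z) *\<^sub>R ((2 * a) *\<^sub>R (snd z - y)))" for z :: "real \<times> (real^3)"
  have ue: "exp (l * r) * (exp (- l * r) * c) = c" for r c :: real
    by (simp flip: exp_add mult.assoc)
  have q_cont: "continuous_on A q"
    unfolding q_def by (intro continuous_intros) (use A in force)+
  have qz: "q (t, x) = exp (- l * t) * u (t, x)" by (simp add: q_def k_def)
  have "level_set_G v R (t, x) (u (t, x)) (D (t, x)) \<le> 0"
  proof (rule sub_testD[OF sub, of "\<lambda>z. exp (l * fst z) * q z" D])
    fix z assume z: "z \<in> A"
    have nz: "T - fst z \<noteq> 0" using A[OF z] by simp
    have "(q has_derivative (\<lambda>h. \<sigma> * fst h / (T - fst z)\<^sup>2
        + (2 * a * (snd h \<bullet> (snd z - y)) + 2 * b * (fst z - s) * fst h))) (at z)"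
      unfolding q_def
      by (rule derivative_eq_intros refl nz)+
        (simp add: divide_inverse power2_eq_square inner_commute mult_ac)
    moreover have "((\<lambda>z. exp (l * fst z)) has_derivative (\<lambda>h. exp (l * fst z) * (l * fst h))) (at z)"
      by (auto intro!: derivative_eq_intros)
    ultimately have "((\<lambda>z. exp (l * fst z) * q z) has_derivative (\<lambda>h. exp (l * fst z) *
        (\<sigma> * fst h / (T - fst z)\<^sup>2 + (2 * a * (snd h \<bullet> (snd z - y)) + 2 * b * (fst z - s) * fst h))
        + exp (l * fst z) * (l * fst h) * q z)) (at z)"
      by (rule has_derivative_mult[rotated])
    then show "GDERIV (\<lambda>z. exp (l * fst z) * q z) z :> D z"
      unfolding gderiv_def D_def inner_prod_def
      by (rule has_derivative_eq_rhs) (simp add: fun_eq_iff algebra_simps)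
    have "exp (- l * fst z) * u z \<le> q z" using max[OF z] by (simp add: q_def k_def)
    then have "exp (l * fst z) * (exp (- l * fst z) * u z) \<le> exp (l * fst z) * q z"
      by (intro mult_left_mono) auto
    then show "u z - exp (l * fst z) * q z \<le> u (t, x) - exp (l * fst (t, x)) * q (t, x)"
      unfolding qz by (simp only: ue fst_conv)
  next
    show "continuous_on A D"
      unfolding D_def by (intro continuous_intros q_cont) (use A in force)+
  qed (rule z)
  moreover have "level_set_G v R (t, x) (u (t, x)) (D (t, x)) =
      exp (l * t) * (l * (exp (- l * t) * u (t, x)) + \<sigma> / (T - t)\<^sup>2 + 2 * b * (t - s) + v t x \<bullet> ((2 * a) *\<^sub>R (x - y))
      - exp (- l * t) * u (t, x) * R t x (exp (l * t) *\<^sub>R ((2 * a) *\<^sub>R (x - y))))"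
  proof -
    have "exp (l * t) * exp (- (l * t)) = 1" by (simp flip: exp_add)
    then show ?thesis by (simp add: level_set_G_def D_def qz algebra_simps)
  qed
  ultimately have "l * (exp (- l * t) * u (t, x)) + \<sigma> / (T - t)\<^sup>2 + 2 * b * (t - s) + v t x \<bullet> ((2 * a) *\<^sub>R (x - y))
      - exp (- l * t) * u (t, x) * R t x (exp (l * t) *\<^sub>R ((2 * a) *\<^sub>R (x - y))) \<le> 0"
    by (simp only: mult_le_0_iff) auto
  \<comment> \<open>The time derivative of \<open>\<sigma> / (T - t)\<close> has the favourable sign
    and is dropped.\<close>
  moreover have "\<sigma> / (T - t)\<^sup>2 \<ge> 0" using \<sigma> by simp
  ultimately show ?thesis by linarith
qed

text \<open>Each variable is frozen in turn at its maximising value. On addition the time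
  derivatives 2b(t - s) and 2b(s - t) of the penalty cancel, and both space gradients are multiples
  of the same vector 2a(x - y).\<close>

lemma doubled_max_inequality:
  fixes u w :: "real \<times> (real^3) \<Rightarrow> real" and x y :: "real^3"
  assumes sub: "sub_test A (level_set_G v R) u" and super: "super_test A (level_set_G v R) w"
    and A: "\<And>z. z \<in> A \<Longrightarrow> fst z < T" and z: "(t, x) \<in> A" "(s, y) \<in> A"
    and max: "\<And>z z'. z \<in> A \<Longrightarrow> z' \<in> A \<Longrightarrow>
      (exp (- l * fst z) * u z - \<sigma> / (T - fst z)) + (exp (- l * fst z') * - w z' - \<sigma> / (T - fst z'))
        - (a * ((snd z - snd z') \<bullet> (snd z - snd z')) + b * (fst z - fst z')\<^sup>2)
      \<le> (exp (- l * t) * u (t, x) - \<sigma> / (T - t)) + (exp (- l * s) * - w (s, y) - \<sigma> / (T - s))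
        - (a * ((x - y) \<bullet> (x - y)) + b * (t - s)\<^sup>2)"
    and \<sigma>: "\<sigma> \<ge> 0"
  shows "l * (exp (- l * t) * u (t, x) - exp (- l * s) * w (s, y)) + (v t x - v s y) \<bullet> ((2 * a) *\<^sub>R (x - y))
    - exp (- l * t) * u (t, x) * R t x (exp (l * t) *\<^sub>R ((2 * a) *\<^sub>R (x - y)))
    + exp (- l * s) * w (s, y) * R s y (exp (l * s) *\<^sub>R ((2 * a) *\<^sub>R (x - y))) \<le> 0"
proof -
  have "l * (exp (- l * t) * u (t, x)) + 2 * b * (t - s) + v t x \<bullet> ((2 * a) *\<^sub>R (x - y))
    - exp (- l * t) * u (t, x) * R t x (exp (l * t) *\<^sub>R ((2 * a) *\<^sub>R (x - y))) \<le> 0"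
    by (rule penalized_max_inequality[OF sub A z(1) _ \<sigma>]) (use max[OF _ z(2)] in force)+
  moreover have "l * (exp (- l * s) * - w (s, y)) + 2 * b * (s - t) + v s y \<bullet> ((2 * a) *\<^sub>R (y - x))
    - exp (- l * s) * - w (s, y) * R s y (- (exp (l * s) *\<^sub>R ((2 * a) *\<^sub>R (y - x)))) \<le> 0"
  proof (rule penalized_max_inequality[OF super_test_uminus[OF super] A z(2) _ \<sigma>])
    fix z assume "z \<in> A"
    have sym: "(p - q) \<bullet> (p - q) = (q - p) \<bullet> (q - p)" "(c - d)\<^sup>2 = (d - c)\<^sup>2" for p q :: "real^3" and c d :: real
      by (simp_all add: inner_diff algebra_simps inner_commute power2_eq_square)
    show "exp (- l * fst z) * - w z - \<sigma> / (T - fst z) - (a * ((snd z - x) \<bullet> (snd z - x)) + b * (fst z - t)\<^sup>2)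
      \<le> exp (- l * s) * - w (s, y) - \<sigma> / (T - s) - (a * ((y - x) \<bullet> (y - x)) + b * (s - t)\<^sup>2)"
      using max[OF z(1) \<open>z \<in> A\<close>] unfolding sym(1)[of "snd z"] sym(1)[of y] sym(2)[of "fst z"] sym(2)[of s] by simp
  qed
  ultimately show ?thesis
    by (simp add: algebra_simps inner_diff_left inner_diff_right scaleR_diff_right)
qed


text \<open>Since \<open>v\<close> is only continuous in time, the penalties \<open>a n * |x - y|\<^sup>2\<close> and \<open>b n * (t - s)\<^sup>2\<close> need
  separate parameters: \<open>b n\<close> is so large that \<open>a n * |x - y| * |v t y - v s y|\<close> still tends to \<open>0\<close>.
  The terms \<open>\<sigma> / (T - t)\<close> keep the maximum points away from \<open>t = T\<close>.\<close>

theorem viscosity_comparison: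
  fixes \<Omega> :: "(real^3) set" and u w :: "real \<times> (real^3) \<Rightarrow> real"
    and v :: "real \<Rightarrow> real^3 \<Rightarrow> real^3" and R :: "real \<Rightarrow> real^3 \<Rightarrow> real^3 \<Rightarrow> real"
  assumes \<Omega>: "open \<Omega>" "bounded \<Omega>" and T: "T > 0"
    and u_usc: "usc_on ({0..<T} \<times> closure \<Omega>) u"
    and w_lsc: "usc_on ({0..<T} \<times> closure \<Omega>) (\<lambda>z. - w z)"
    and u_bd: "\<And>z. z \<in> {0..<T} \<times> closure \<Omega> \<Longrightarrow> \<bar>u z\<bar> \<le> C"
    and w_bd: "\<And>z. z \<in> {0..<T} \<times> closure \<Omega> \<Longrightarrow> \<bar>w z\<bar> \<le> C"
    and sub: "sub_test ({0<..<T} \<times> \<Omega>) (level_set_G v R) u"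
    and super: "super_test ({0<..<T} \<times> \<Omega>) (level_set_G v R) w"
    and bdry: "\<And>z. z \<in> {0..<T} \<times> closure \<Omega> \<Longrightarrow> z \<notin> {0<..<T} \<times> \<Omega> \<Longrightarrow> u z \<le> w z"
    and v_cont: "continuous_on ({0..T} \<times> closure \<Omega>) (\<lambda>(t, x). v t x)"
    and v_lip: "\<And>t x y. t \<in> {0..T} \<Longrightarrow> x \<in> closure \<Omega> \<Longrightarrow> y \<in> closure \<Omega> \<Longrightarrow> norm (v t x - v t y) \<le> L * norm (x - y)"
    and R_cont: "continuous_on ({0..T} \<times> closure \<Omega> \<times> UNIV) (\<lambda>(t, x, p). R t x p)"
    and R_bd: "\<And>t x p. t \<in> {0..T} \<Longrightarrow> x \<in> closure \<Omega> \<Longrightarrow> \<bar>R t x p\<bar> \<le> M"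
    and R_supp: "\<And>t x p. t \<in> {0..T} \<Longrightarrow> x \<in> closure \<Omega> \<Longrightarrow> norm p \<ge> P \<Longrightarrow> R t x p = 0"
    and z1: "z1 \<in> {0..<T} \<times> closure \<Omega>"
  shows "u z1 \<le> w z1"
proof (rule ccontr)
  assume contra: "\<not> u z1 \<le> w z1"
  define Q where "Q = {0..<T} \<times> closure \<Omega>"
  define A where "A = {0<..<T} \<times> \<Omega>"
  have cl: "compact (closure \<Omega>)" using \<Omega> by simp
  have M0: "M \<ge> 0" using R_bd[of "fst z1" "snd z1" 0] z1 by (auto simp: mem_Times_iff)
  have C0: "C \<ge> 0" using u_bd[OF z1] by simp
  have AQ: "A \<subseteq> Q" using closure_subset by (fastforce simp: A_def Q_def)
  have Aopen: "open A" unfolding A_def by (intro open_Times \<Omega>) auto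
  have Q_lt: "fst z < T" "fst z \<ge> 0" "snd z \<in> closure \<Omega>" if "z \<in> Q" for z using that by (auto simp: Q_def)
  \<comment> \<open>One more than the bound on \<open>R\<close>: in the end the surplus leaves
    \<open>W1 - W2\<close> itself on the left.\<close>
  define l where "l = M + 1"
  have l0: "l > 0" using M0 by (simp add: l_def)
  define e1 where "e1 = exp (- l * fst z1) * (u z1 - w z1)"
  have e1: "e1 > 0" using contra by (simp add: e1_def)
  have t1: "T - fst z1 > 0" using z1 by auto
  \<comment> \<open>The two terms with \<sigma> then cost \<open>e1 / 2\<close> together, so that U
    + V is still positive at \<open>z1\<close>.\<close>
  define \<sigma> where "\<sigma> = e1 * (T - fst z1) / 4"
  have \<sigma>: "\<sigma> > 0" using e1 t1 by (simp add: \<sigma>_def)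
  define U where "U z = exp (- l * fst z) * u z - \<sigma> / (T - fst z)" for z
  define V where "V z = exp (- l * fst z) * - w z - \<sigma> / (T - fst z)" for z
  have exp_le: "\<bar>exp (- l * fst z) * c\<bar> \<le> C" if "z \<in> Q" "\<bar>c\<bar> \<le> C" for z c
  proof -
    have "exp (- l * fst z) \<le> 1" using Q_lt[OF that(1)] l0 by simp
    then have "exp (- l * fst z) * \<bar>c\<bar> \<le> 1 * C" using that(2) by (intro mult_mono) auto
    then show ?thesis by (simp add: abs_mult)
  qed
  have U_le: "U z \<le> C - \<sigma> / (T - fst z)" and V_le: "V z \<le> C - \<sigma> / (T - fst z)" if "z \<in> Q" for z
    using exp_le[OF that, of "u z"] exp_le[OF that, of "- w z"] u_bd[of z] w_bd[of z] that
    by (auto simp: U_def V_def Q_def abs_le_iff)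
  have pos\<sigma>: "\<sigma> / (T - fst z) > 0" if "z \<in> Q" for z using Q_lt[OF that] \<sigma> by simp
  \<comment> \<open>Within \<open>d0\<close> of the final time one term with \<sigma> outweighs the
    bound 2C on the rest, so relevant points lie in the compact set \<open>K\<close>; the minimum
    with \<open>T/2\<close> keeps its time interval nonempty.\<close>
  define d0 where "d0 = min (T/2) (\<sigma> / (2 * C + 1))"
  have d0: "d0 > 0" using T \<sigma> C0 by (simp add: d0_def)
  have "d0 \<le> T / 2" unfolding d0_def by (rule min.cobounded1)
  then have d0T: "d0 < T" using T by simp
  define K where "K = {0..T - d0} \<times> closure \<Omega>"
  have K: "compact K" unfolding K_def by (intro compact_Times cl) auto
  have KQ: "K \<subseteq> Q" using d0 d0T by (auto simp: K_def Q_def)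
  have late: "\<sigma> / (T - fst z) > 2 * C + 1" if "z \<in> Q" "z \<notin> K" for z
  proof -
    have "T - fst z < d0" using that by (auto simp: K_def Q_def)
    also have "\<dots> \<le> \<sigma> / (2 * C + 1)" by (simp add: d0_def)
    finally show ?thesis using Q_lt[OF that(1)] C0 by (simp add: field_simps)
  qed
  have far: "U z + V z' < 0" if "z \<in> Q" "z' \<in> Q" "\<not> (z \<in> K \<and> z' \<in> K)" for z z'
    using U_le[OF that(1)] V_le[OF that(2)] pos\<sigma>[OF that(1)] pos\<sigma>[OF that(2)]
      late[OF that(1)] late[OF that(2)] that(3) C0 by fastforce
  have ec: "continuous_on Q (\<lambda>z. exp (- l * fst z))" by (intro continuous_intros)
  have sc: "continuous_on Q (\<lambda>z. - (\<sigma> / (T - fst z)))" by (intro continuous_intros) (use Q_lt in force)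
  have U_usc: "usc_on Q U"
    using usc_on_add[OF usc_on_mult_pos[OF u_usc[folded Q_def] ec] continuous_imp_usc_on[OF sc]]
    by (simp add: U_def[abs_def])
  have V_usc: "usc_on Q V"
    using usc_on_add[OF usc_on_mult_pos[OF w_lsc[folded Q_def] ec] continuous_imp_usc_on[OF sc]]
    by (simp add: V_def[abs_def])
  define f where "f p = U (fst p) + V (snd p)" for p
  have f_usc: "usc_on (K \<times> K) f"
    unfolding f_def
    by (intro usc_on_add usc_on_compose[OF usc_on_subset[OF U_usc KQ]] usc_on_compose[OF usc_on_subset[OF V_usc KQ]])
      (auto intro!: continuous_intros)
  have z1Q: "z1 \<in> Q" using z1 by (simp add: Q_def)
  have UV1: "U z1 + V z1 > 0"
  proof -
    have "U z1 + V z1 = e1 - 2 * (\<sigma> / (T - fst z1))" by (simp add: U_def V_def e1_def algebra_simps)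
    also have "\<sigma> / (T - fst z1) = e1 / 4"
      by (subst nonzero_divide_eq_eq) (use t1 in \<open>auto simp: \<sigma>_def\<close>)
    finally show ?thesis using e1 by simp
  qed
  then have z1K: "z1 \<in> K" using far[OF z1Q z1Q] by fastforce
  have "usc_on K (\<lambda>z. U z + V z)"
    by (intro usc_on_add usc_on_subset[OF U_usc KQ] usc_on_subset[OF V_usc KQ])
  then obtain z0 where z0: "z0 \<in> K" "\<And>z. z \<in> K \<Longrightarrow> U z + V z \<le> U z0 + V z0"
    using usc_attains_max[OF K] z1K by blast
  define m where "m = U z0 + V z0"
  have m: "m > 0" using z0(2)[OF z1K] UV1 by (simp add: m_def)
  define a where "a n = real (Suc n)" for n
  have a: "a n \<ge> 1" for n by (simp add: a_def)
  have "uniformly_continuous_on ({0..T} \<times> closure \<Omega>) (\<lambda>(t, x). v t x)"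
    by (intro compact_uniformly_continuous v_cont compact_Times cl) auto
  then have "\<exists>d>0. \<forall>p\<in>{0..T} \<times> closure \<Omega>. \<forall>q\<in>{0..T} \<times> closure \<Omega>. dist q p < d \<longrightarrow>
      dist (case q of (t, x) \<Rightarrow> v t x) (case p of (t, x) \<Rightarrow> v t x) < 1 / a n" for n
    unfolding uniformly_continuous_on_def using a[of n] by (simp del: split_paired_All)
  then obtain d where d: "\<And>n. d n > 0" "\<And>n p q. p \<in> {0..T} \<times> closure \<Omega> \<Longrightarrow> q \<in> {0..T} \<times> closure \<Omega> \<Longrightarrow> dist q p < d n \<Longrightarrow>
      dist (case q of (t, x) \<Rightarrow> v t x) (case p of (t, x) \<Rightarrow> v t x) < 1 / a n"
    by metis
  have vd: "norm (v t y - v s y) \<le> 1 / a n" if "t \<in> {0..T}" "s \<in> {0..T}" "y \<in> closure \<Omega>" "\<bar>t - s\<bar> < d n" for t s y n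
    using d(2)[of "(s, y)" "(t, y)" n] that by (simp add: dist_Pair_Pair dist_norm)
  \<comment> \<open>The second summand turns the bound 2C on the penalty into |t - s| <
    \<open>d n\<close>, and then v varies in time by at most \<open>1 / a n\<close>. The first makes
    t - s tend to 0.\<close>
  define b where "b n = a n + (2 * C + 1) / (d n)\<^sup>2" for n
  have b: "b n \<ge> 1" "b n * (d n)\<^sup>2 > 2 * C" for n
  proof -
    show "b n \<ge> 1" using a[of n] d(1)[of n] C0 by (simp add: b_def add_increasing2)
    have "b n * (d n)\<^sup>2 = a n * (d n)\<^sup>2 + (2 * C + 1)" using d(1)[of n] by (simp add: b_def field_simps)
    moreover have "a n * (d n)\<^sup>2 \<ge> 0" using a[of n] by simp
    ultimately show "b n * (d n)\<^sup>2 > 2 * C" by linarith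
  qed
  define pen where "pen n p = a n * ((snd (fst p) - snd (snd p)) \<bullet> (snd (fst p) - snd (snd p)))
      + b n * (fst (fst p) - fst (snd p))\<^sup>2" for n and p :: "(real \<times> (real^3)) \<times> (real \<times> (real^3))"
  have pen0: "0 \<le> a n * ((snd (fst p) - snd (snd p)) \<bullet> (snd (fst p) - snd (snd p)))"
    "0 \<le> b n * (fst (fst p) - fst (snd p))\<^sup>2" for n p
    using a[of n] b(1)[of n] by (auto intro!: mult_nonneg_nonneg)
  then have pen_nonneg: "pen n p \<ge> 0" for n p unfolding pen_def by (intro add_nonneg_nonneg)
  have "\<exists>p\<in>K \<times> K. \<forall>q\<in>K \<times> K. f q - pen n q \<le> f p - pen n p" for n
  proof -
    have "continuous_on (K \<times> K) (\<lambda>p. - pen n p)" unfolding pen_def by (intro continuous_intros)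
    then have "usc_on (K \<times> K) (\<lambda>p. f p + - pen n p)" by (intro usc_on_add f_usc continuous_imp_usc_on)
    from usc_attains_max[OF compact_Times[OF K K] _ this] z0(1)
    obtain p where "p \<in> K \<times> K" "\<And>q. q \<in> K \<times> K \<Longrightarrow> f q + - pen n q \<le> f p + - pen n p" by blast
    then show ?thesis by (intro bexI[of _ p] ballI) (simp_all only: diff_conv_add_uminus)
  qed
  then obtain p where p: "\<And>n. p n \<in> K \<times> K" "\<And>n q. q \<in> K \<times> K \<Longrightarrow> f q - pen n q \<le> f (p n) - pen n (p n)"
    by metis
  have m_le: "m \<le> f (p n) - pen n (p n)" for n
    using p(2)[of "(z0, z0)" n] z0(1) by (simp add: f_def pen_def m_def)
  \<comment> \<open>The maximum over the compact set is one over all pairs, as the test functions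
    require: elsewhere f is negative, whereas the maximal value is at least m > 0.\<close>
  have p_max: "f q - pen n q \<le> f (p n) - pen n (p n)" if "q \<in> Q \<times> Q" for q n
  proof (cases "q \<in> K \<times> K")
    case True then show ?thesis by (rule p(2))
  next
    case False
    then have "f q < 0" unfolding f_def by (intro far) (use that False in \<open>auto simp only: mem_Times_iff\<close>)
    then show ?thesis using pen_nonneg[of n q] m_le[of n] m by simp
  qed
  have f_le: "f q \<le> 2 * C" if "q \<in> K \<times> K" for q
    using U_le[of "fst q"] V_le[of "snd q"] pos\<sigma>[of "fst q"] pos\<sigma>[of "snd q"] that KQ
    by (fastforce simp: f_def)
  have pen_le: "pen n (p n) \<le> 2 * C" for n using m_le[of n] m f_le[OF p(1)[of n]] by simp
  obtain q r where q: "q \<in> K \<times> K" and r: "strict_mono r" and lim: "(p \<circ> r) \<longlonglongrightarrow> q"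
    using compact_Times[OF K K] p(1) unfolding compact_def by meson
  have lim1: "(\<lambda>n. fst (p (r n))) \<longlonglongrightarrow> fst q" and lim2: "(\<lambda>n. snd (p (r n))) \<longlonglongrightarrow> snd q"
    using tendsto_fst[OF lim] tendsto_snd[OF lim] by (simp_all add: o_def)
  have "(\<lambda>n. 2 * C / a n) \<longlonglongrightarrow> 0" unfolding a_def
    using LIMSEQ_Suc[OF lim_const_over_n[of "2 * C"]] by simp
  then have aR: "(\<lambda>n. 2 * C / a (r n)) \<longlonglongrightarrow> 0"
    using LIMSEQ_subseq_LIMSEQ[OF _ r] by (fastforce simp: o_def)
  have q_eq: "fst q = snd q"
  proof (rule prod_eqI)
    let ?x = "\<lambda>n. snd (fst (p (r n))) - snd (snd (p (r n)))" and ?t = "\<lambda>n. fst (fst (p (r n))) - fst (snd (p (r n)))"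
    have "(\<lambda>n. ?x n \<bullet> ?x n) \<longlonglongrightarrow> 0"
    proof (rule tendsto_sandwich[OF _ _ tendsto_const aR])
      show "\<forall>\<^sub>F n in sequentially. ?x n \<bullet> ?x n \<le> 2 * C / a (r n)"
      proof (rule always_eventually, rule allI)
        fix n
        have "a (r n) * (?x n \<bullet> ?x n) \<le> 2 * C"
          using pen_le[of "r n"] pen0(2)[of "r n" "p (r n)"] unfolding pen_def by linarith
        then show "?x n \<bullet> ?x n \<le> 2 * C / a (r n)" using a[of "r n"] by (simp add: field_simps)
      qed
    qed auto
    moreover have "(\<lambda>n. ?x n \<bullet> ?x n) \<longlonglongrightarrow> (snd (fst q) - snd (snd q)) \<bullet> (snd (fst q) - snd (snd q))"
      by (intro tendsto_intros lim1 lim2)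
    ultimately show "snd (fst q) = snd (snd q)" using LIMSEQ_unique by fastforce
    have "(\<lambda>n. (?t n)\<^sup>2) \<longlonglongrightarrow> 0"
    proof (rule tendsto_sandwich[OF _ _ tendsto_const aR])
      show "\<forall>\<^sub>F n in sequentially. (?t n)\<^sup>2 \<le> 2 * C / a (r n)"
      proof (rule always_eventually, rule allI)
        fix n
        have "a (r n) \<le> b (r n)" using C0 by (simp add: b_def)
        then have "a (r n) * (?t n)\<^sup>2 \<le> b (r n) * (?t n)\<^sup>2" by (intro mult_right_mono) auto
        also have "\<dots> \<le> 2 * C"
          using pen_le[of "r n"] pen0(1)[of "r n" "p (r n)"] unfolding pen_def by linarith
        finally show "(?t n)\<^sup>2 \<le> 2 * C / a (r n)" using a[of "r n"] by (simp add: field_simps)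
      qed
    qed auto
    moreover have "(\<lambda>n. (?t n)\<^sup>2) \<longlonglongrightarrow> (fst (fst q) - fst (snd q))\<^sup>2"
      by (intro tendsto_intros lim1 lim2)
    ultimately show "fst (fst q) = fst (snd q)" using LIMSEQ_unique by fastforce
  qed
  have fq_le: "f q \<le> m" using z0(2)[of "fst q"] q q_eq by (auto simp: f_def m_def)
  have f_ev: "\<forall>\<^sub>F n in sequentially. f (p (r n)) < c" if "f q < c" for c
  proof -
    have "\<forall>\<^sub>F n in sequentially. p (r n) \<in> K \<times> K \<longrightarrow> f (p (r n)) < c"
      using eventually_compose_filterlim[OF usc_onD[OF f_usc q that] lim] by (simp only: o_def)
    then show ?thesis using p(1) by simp
  qed
  \<comment> \<open>Boundedness of the penalty only gives x - y \<rightarrow> 0. That the penalty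
    itself tends to 0 follows because m + penalty \<le> f, while upper semicontinuity keeps f from
    exceeding f(q) \<le> m in the limit.\<close>
  have pen_ev: "\<forall>\<^sub>F n in sequentially. pen (r n) (p (r n)) < e" if "e > 0" for e
  proof (rule eventually_mono[OF f_ev[of "m + e"]])
    show "f q < m + e" using fq_le that by simp
    show "f (p (r n)) < m + e \<Longrightarrow> pen (r n) (p (r n)) < e" for n using m_le[of "r n"] by simp
  qed
  have fq_ge: "m \<le> f q"
  proof (rule ccontr)
    assume "\<not> m \<le> f q"
    then have "\<forall>\<^sub>F n in sequentially. f (p (r n)) < m" by (intro f_ev) simp
    then obtain n where "f (p (r n)) < m" using eventually_happens by force
    then show False using m_le[of "r n"] pen_nonneg[of "r n" "p (r n)"] by simp
  qed
  \<comment> \<open>On the rest of the domain u \<le> w, and the terms with \<sigma> make U + V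
    negative there; so the limit point, and eventually the maximisers, lie in the open set where the
    equation holds.\<close>
  have qA: "fst q \<in> A"
  proof (rule ccontr)
    assume nA: "fst q \<notin> A"
    have qQ: "fst q \<in> Q" using q KQ by auto
    then have "u (fst q) \<le> w (fst q)" using bdry[of "fst q"] nA by (simp add: Q_def A_def)
    then have "exp (- l * fst (fst q)) * u (fst q) \<le> exp (- l * fst (fst q)) * w (fst q)"
      by (intro mult_left_mono) auto
    then have "f q < 0" using pos\<sigma>[OF qQ]
      unfolding f_def U_def V_def q_eq mult_minus_right by linarith
    then show False using fq_ge m by simp
  qed
  have evA: "\<forall>\<^sub>F n in sequentially. fst (p (r n)) \<in> A" "\<forall>\<^sub>F n in sequentially. snd (p (r n)) \<in> A"
    using topological_tendstoD[OF lim1 Aopen] topological_tendstoD[OF lim2 Aopen] qA q_eq by auto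
  \<comment> \<open>Absorbs the factor exp(lt), so that both occurrences of \<open>R\<close> share
    the gradient argument \<open>g\<close>.\<close>
  define S where "S = (\<lambda>(t, x, p). R t x (exp (l * t) *\<^sub>R p))"
  have S_cont: "continuous_on ({0..T} \<times> closure \<Omega> \<times> UNIV) S"
  proof -
    have "continuous_on ({0..T} \<times> closure \<Omega> \<times> UNIV)
        (\<lambda>z. (\<lambda>(t, x, p). R t x p) (fst z, fst (snd z), exp (l * fst z) *\<^sub>R snd (snd z)))"
      by (rule continuous_on_compose2[OF R_cont]) (auto intro!: continuous_intros)
    then show ?thesis by (simp add: S_def case_prod_beta)
  qed
  \<comment> \<open>Since exp(lt) \<ge> 1, the support in the gradient stays inside |k| \<le> |P|.
    The vectors 2a(x - y) may be unbounded as a grows, yet the modulus of continuity of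
    \<open>S\<close> in (t,x) is uniform over all of them.\<close>
  have S_supp: "S (t, x, k) = 0" if "t \<in> {0..T}" "x \<in> closure \<Omega>" "norm k \<ge> \<bar>P\<bar>" for t x k
  proof -
    have "1 * norm k \<le> exp (l * t) * norm k" using that l0 by (intro mult_right_mono) auto
    then show ?thesis using R_supp[OF that(1,2), of "exp (l * t) *\<^sub>R k"] that by (simp add: S_def)
  qed
  have S_bd: "\<bar>S (t, x, k)\<bar> \<le> M" if "t \<in> {0..T}" "x \<in> closure \<Omega>" for t x k
    using R_bd[OF that] by (simp add: S_def)
  have S_uc: "uniformly_continuous_on ({0..T} \<times> closure \<Omega> \<times> cball 0 \<bar>P\<bar>) S"
    by (intro compact_uniformly_continuous continuous_on_subset[OF S_cont] compact_Times cl) auto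
  define e where "e = m / (4 * (C + 1))"
  have e: "e > 0" "C * e \<le> m / 4" using m C0 by (auto simp: e_def field_simps)
  obtain ds where ds: "ds > 0" "\<And>p q. p \<in> {0..T} \<times> closure \<Omega> \<times> cball 0 \<bar>P\<bar> \<Longrightarrow> q \<in> {0..T} \<times> closure \<Omega> \<times> cball 0 \<bar>P\<bar> \<Longrightarrow>
      dist q p < ds \<Longrightarrow> dist (S q) (S p) < e"
    using S_uc e(1) unfolding uniformly_continuous_on_def by meson
  have S_diff: "\<bar>S (t, x, k) - S (s, y, k)\<bar> \<le> e"
    if "t \<in> {0..T}" "s \<in> {0..T}" "x \<in> closure \<Omega>" "y \<in> closure \<Omega>" "dist (t, x) (s, y) < ds" for t s x y k
  proof (cases "norm k \<le> \<bar>P\<bar>")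
    case True
    have "dist (t, x, k) (s, y, k) = dist (t, x) (s, y)" by (simp add: dist_Pair_Pair)
    then show ?thesis using ds(2)[of "(s, y, k)" "(t, x, k)"] that True by (simp add: dist_real_def)
  next
    case False
    then show ?thesis using S_supp[of t x k] S_supp[of s y k] that e by simp
  qed
  have "(\<lambda>n. dist (fst (p (r n))) (snd (p (r n)))) \<longlonglongrightarrow> dist (fst q) (snd q)"
    by (intro tendsto_intros lim1 lim2)
  then have dist0: "(\<lambda>n. dist (fst (p (r n))) (snd (p (r n)))) \<longlonglongrightarrow> 0" using q_eq by simp
  have ev_ds: "\<forall>\<^sub>F n in sequentially. dist (fst (p (r n))) (snd (p (r n))) < ds"
    using order_tendstoD(2)[OF dist0 ds(1)] .
  have ev_m: "\<forall>\<^sub>F n in sequentially. dist (fst (p (r n))) (snd (p (r n))) < m / 8"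
    using order_tendstoD(2)[OF dist0, of "m / 8"] m by simp
  have ev_pen: "\<forall>\<^sub>F n in sequentially. pen (r n) (p (r n)) < m / (8 * (\<bar>L\<bar> + 1))"
    using pen_ev m by simp
  obtain n where n: "fst (p (r n)) \<in> A" "snd (p (r n)) \<in> A"
    "dist (fst (p (r n))) (snd (p (r n))) < ds" "dist (fst (p (r n))) (snd (p (r n))) < m / 8"
    "pen (r n) (p (r n)) < m / (8 * (\<bar>L\<bar> + 1))"
    using eventually_happens[OF eventually_conj[OF evA(1) eventually_conj[OF evA(2) eventually_conj[OF ev_ds
      eventually_conj[OF ev_m ev_pen]]]]] by auto
  define k where "k = r n"
  obtain t x s y where txy: "p k = ((t, x), (s, y))" by (metis surj_pair)
  have inA: "(t, x) \<in> A" "(s, y) \<in> A" using n txy by (auto simp: k_def)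
  then have dom: "t \<in> {0..T}" "s \<in> {0..T}" "x \<in> closure \<Omega>" "y \<in> closure \<Omega>"
    using AQ by (auto simp: Q_def)
  define g where "g = (2 * a k) *\<^sub>R (x - y)"
  have key: "l * (exp (- l * t) * u (t, x) - exp (- l * s) * w (s, y)) + (v t x - v s y) \<bullet> g
    - exp (- l * t) * u (t, x) * S (t, x, g) + exp (- l * s) * w (s, y) * S (s, y, g) \<le> 0"
    unfolding S_def g_def prod.case
  proof (rule doubled_max_inequality[OF sub super, folded A_def, of T t x s y l \<sigma> "a k" "b k"])
    fix z z' assume zz: "z \<in> A" "z' \<in> A"
    have "f (z, z') - pen k (z, z') \<le> f (p k) - pen k (p k)" by (rule p_max) (use zz AQ in auto)
    then show "(exp (- l * fst z) * u z - \<sigma> / (T - fst z)) + (exp (- l * fst z') * - w z' - \<sigma> / (T - fst z'))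
        - (a k * ((snd z - snd z') \<bullet> (snd z - snd z')) + b k * (fst z - fst z')\<^sup>2)
      \<le> (exp (- l * t) * u (t, x) - \<sigma> / (T - t)) + (exp (- l * s) * - w (s, y) - \<sigma> / (T - s))
        - (a k * ((x - y) \<bullet> (x - y)) + b k * (t - s)\<^sup>2)"
      by (simp add: txy f_def U_def V_def pen_def)
  qed (use inA \<sigma> in \<open>auto simp: A_def\<close>)
  define W1 where "W1 = exp (- l * t) * u (t, x)"
  define W2 where "W2 = exp (- l * s) * w (s, y)"
  have Q12: "(t, x) \<in> Q" "(s, y) \<in> Q" using inA AQ by auto
  have W12: "W1 - W2 \<ge> m"
    using m_le[of k] pen_nonneg[of k "p k"] pos\<sigma>[OF Q12(1)] pos\<sigma>[OF Q12(2)]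
    by (simp add: f_def txy U_def V_def W1_def W2_def)
  have W2C: "\<bar>W2\<bar> \<le> C" using exp_le[OF Q12(2) w_bd[of "(s, y)"]] Q12(2) by (simp add: W2_def Q_def)
  have pen_k: "a k * (norm (x - y))\<^sup>2 \<le> pen k (p k)" "b k * (t - s)\<^sup>2 \<le> pen k (p k)"
    using pen0[of k "p k"] by (simp_all add: pen_def txy power2_norm_eq_inner)
  have ts: "\<bar>t - s\<bar> < d k"
  proof -
    have "b k * (t - s)\<^sup>2 < b k * (d k)\<^sup>2" using pen_k(2) pen_le[of k] b(2)[of k] by simp
    then have "(t - s)\<^sup>2 < (d k)\<^sup>2" using b(1)[of k] by (simp add: mult_less_cancel_left)
    then show ?thesis using d(1)[of k] by (metis abs_le_square_iff abs_of_pos not_le)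
  qed
  \<comment> \<open>The difference is split at (t,y). The Lipschitz part contributes a multiple of
    a|x - y|^2, which is part of the vanishing penalty; in the time part the factor a of
    \<open>g\<close> cancels against \<open>1 / a k\<close>.\<close>
  have v_est: "\<bar>(v t x - v s y) \<bullet> g\<bar> \<le> m / 2"
  proof -
    have ng: "norm g = 2 * a k * norm (x - y)" using a[of k] by (simp add: g_def)
    have "\<bar>(v t x - v s y) \<bullet> g\<bar> \<le> norm (v t x - v s y) * norm g" by (rule Cauchy_Schwarz_ineq2)
    also have "norm (v t x - v s y) \<le> norm (v t x - v t y) + norm (v t y - v s y)"
      using norm_triangle_ineq[of "v t x - v t y" "v t y - v s y"] by simp
    also have "\<dots> \<le> \<bar>L\<bar> * norm (x - y) + 1 / a k"
    proof (rule add_mono)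
      have "L * norm (x - y) \<le> \<bar>L\<bar> * norm (x - y)" by (intro mult_right_mono) auto
      then show "norm (v t x - v t y) \<le> \<bar>L\<bar> * norm (x - y)" using v_lip[OF dom(1,3,4)] by simp
      show "norm (v t y - v s y) \<le> 1 / a k" by (rule vd[OF dom(1,2,4) ts])
    qed
    also have "(\<bar>L\<bar> * norm (x - y) + 1 / a k) * norm g = 2 * \<bar>L\<bar> * (a k * (norm (x - y))\<^sup>2) + 2 * norm (x - y)"
      using a[of k] by (simp add: ng field_simps power2_eq_square)
    also have "\<dots> \<le> m / 4 + m / 4"
    proof (rule add_mono)
      have "a k * (norm (x - y))\<^sup>2 \<le> m / (8 * (\<bar>L\<bar> + 1))" using pen_k(1) n(5) by (simp add: k_def)
      then have "2 * \<bar>L\<bar> * (a k * (norm (x - y))\<^sup>2) \<le> 2 * \<bar>L\<bar> * (m / (8 * (\<bar>L\<bar> + 1)))"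
        by (intro mult_left_mono) auto
      also have "\<dots> \<le> m / 4" using m by (simp add: field_simps)
      finally show "2 * \<bar>L\<bar> * (a k * (norm (x - y))\<^sup>2) \<le> m / 4" .
      have "norm (x - y) \<le> dist (t, x) (s, y)" using dist_snd_le[of "(t, x)" "(s, y)"] by (simp add: dist_norm)
      then show "2 * norm (x - y) \<le> m / 4" using n(4) txy by (simp add: k_def)
    qed
    finally show ?thesis by (simp add: mult_right_mono)
  qed
  have S_est: "\<bar>S (t, x, g) - S (s, y, g)\<bar> \<le> e"
    by (rule S_diff) (use dom n(3) txy in \<open>auto simp: k_def\<close>)
  \<comment> \<open>Separates the two effects: the same \<open>S\<close> with different values,
    absorbed by l = M + 1, and different \<open>S\<close> with the same bounded value, which costs
    at most C e \<le> m/4.\<close>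
  have "W1 * S (t, x, g) - W2 * S (s, y, g) = (W1 - W2) * S (t, x, g) + W2 * (S (t, x, g) - S (s, y, g))"
    by (simp add: algebra_simps)
  also have "\<dots> \<le> (W1 - W2) * M + C * e"
  proof (rule add_mono)
    show "(W1 - W2) * S (t, x, g) \<le> (W1 - W2) * M"
      using S_bd[OF dom(1,3), of g] W12 m by (intro mult_left_mono) auto
    have "\<bar>W2 * (S (t, x, g) - S (s, y, g))\<bar> \<le> C * e"
      unfolding abs_mult using W2C S_est C0 by (intro mult_mono) auto
    then show "W2 * (S (t, x, g) - S (s, y, g)) \<le> C * e" by linarith
  qed
  finally have "l * (W1 - W2) \<le> m / 2 + (W1 - W2) * M + C * e"
    using key v_est unfolding W1_def[symmetric] W2_def[symmetric] by (simp add: abs_le_iff)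
  \<comment> \<open>Velocity and nonlinearity together cost 3m/4, less than the m by which the two
    values differ.\<close>
  then have "W1 - W2 \<le> m / 2 + m / 4" using e(2) by (simp add: l_def algebra_simps)
  then show False using W12 m by simp
qed

section \<open>The cut-off nonlinearity\<close>

lemma smooth_on_imp_continuous_on:
  assumes "smooth_on S f"
  shows "continuous_on S f"
proof -
  obtain U g where g: "S \<subseteq> U" "\<forall>n. Cn_on_open n U g" "\<forall>x\<in>S. g x = f x"
    using assms unfolding smooth_on_def by blast
  have "continuous_on U g" using g(2)[rule_format, of 0] by simp
  then have "continuous_on S g" using g(1) continuous_on_subset by blast
  then show ?thesis using g(3) by (simp cong: continuous_on_cong)
qed

lemma continuous_within_openin_cong:
  assumes F: "continuous_on W F" and W: "openin (top_of_set D) W" and z: "z \<in> W"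
    and eq: "\<And>y. y \<in> W \<Longrightarrow> F y = f y"
  shows "continuous (at z within D) f"
proof -
  obtain N where N: "open N" "W = D \<inter> N" using W unfolding openin_open by blast
  have "continuous (at z within W) F" using F z continuous_on_eq_continuous_within by blast
  moreover have "at z within W = at z within D"
    by (rule at_within_nhd[of _ N]) (use N z in auto)
  ultimately have "continuous (at z within D) F" by simp
  then show ?thesis using W z eq by (rule continuous_transform_within_openin)
qed

text \<open>The spatial Jacobian is the space-time derivative restricted to vectors (0,q), and
  inherits its continuity. Openness of \<Omega> turns the derivative within \<Omega> into the full
  one that \<open>jacobian\<close> refers to.\<close>

lemma jacobian_C1:
  fixes \<Omega> :: "(real^3) set" and v :: "real \<Rightarrow> real^3 \<Rightarrow> real^3"
  assumes v: "C1_on ({0..} \<times> \<Omega>) (\<lambda>(t, x). v t x)" and \<Omega>: "open \<Omega>"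
  obtains J where "continuous_on ({0..} \<times> \<Omega>) J"
    and "\<And>t x q. t \<ge> 0 \<Longrightarrow> x \<in> \<Omega> \<Longrightarrow> jacobian (v t) (at x) *v q = blinfun_apply (J (t, x)) (0 :: real, q)"
proof -
  obtain J where J: "\<And>z. z \<in> {0..} \<times> \<Omega> \<Longrightarrow>
      ((\<lambda>(t, x). v t x) has_derivative blinfun_apply (J z)) (at z within {0..} \<times> \<Omega>)"
    "continuous_on ({0..} \<times> \<Omega>) J"
    using v unfolding C1_on_def by blast
  show thesis
  proof (rule that[OF J(2)])
    fix t :: real and x q assume t: "t \<ge> 0" and x: "x \<in> \<Omega>"
    have "((\<lambda>y. (\<lambda>(t, x). v t x) (t, y)) has_derivative (\<lambda>h. blinfun_apply (J (t, x)) (0, h))) (at x within \<Omega>)"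
    proof (rule has_derivative_in_compose[where f="\<lambda>y. (t, y)" and f'="\<lambda>h. (0, h)"])
      show "((\<lambda>y. (t, y)) has_derivative (\<lambda>h. (0, h))) (at x within \<Omega>)"
        by (auto intro!: derivative_eq_intros)
      show "((\<lambda>(t, x). v t x) has_derivative blinfun_apply (J (t, x))) (at (t, x) within (\<lambda>y. (t, y)) ` \<Omega>)"
        by (rule has_derivative_subset[OF J(1)]) (use t x in auto)
    qed
    then have d: "(v t has_derivative (\<lambda>h. blinfun_apply (J (t, x)) (0, h))) (at x)"
      using at_within_open[OF x \<Omega>] by simp
    then have "jacobian (v t) (at x) = matrix (\<lambda>h. blinfun_apply (J (t, x)) (0, h))"
      by (simp add: jacobian_def frechet_derivative_at[symmetric])
    then show "jacobian (v t) (at x) *v q = blinfun_apply (J (t, x)) (0 :: real, q)"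
      using matrix_works[of "\<lambda>h. blinfun_apply (J (t, x)) (0, h)" q] has_derivative_linear[OF d]
      by (simp add: linear_matrix_vector_mul_eq)
  qed
qed

text \<open>Three relatively open sets cover the domain. Near \<partial>\<Omega> the factor
  \<open>\<eta>1\<close> is 0 and near p = 0 the factor \<open>\<eta>2\<close> is 0, so R vanishes
  identically there; on the third set the direction p/|p| and the Jacobian are continuous.\<close>

lemma cutoff_R_continuous:
  fixes \<Omega> :: "(real^3) set"
  assumes v: "C1_on ({0..} \<times> \<Omega>) (\<lambda>(t, x). v t x)" and \<Omega>: "open \<Omega>"
    and \<epsilon>: "continuous_on {0..} \<epsilon>" "\<And>t. t \<ge> 0 \<Longrightarrow> \<epsilon> t > 0"
    and \<eta>1: "continuous_on ({0..} \<times> closure \<Omega>) (\<lambda>(t, x). \<eta>1 t x)"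
      "\<And>t x. t \<ge> 0 \<Longrightarrow> x \<in> boundary_layer \<Omega> (2 * \<epsilon> t) \<Longrightarrow> \<eta>1 t x = 0"
    and \<eta>2: "continuous_on {0..} \<eta>2" "\<And>r. r \<in> {0..1/3} \<Longrightarrow> \<eta>2 r = 0"
  shows "continuous_on ({0..} \<times> closure \<Omega> \<times> UNIV) (\<lambda>(t, x, p). cutoff_R v \<eta>1 \<eta>2 t x p)"
proof -
  define D where "D = {0::real..} \<times> closure \<Omega> \<times> (UNIV :: (real^3) set)"
  define f where "f = (\<lambda>(t, x, p). cutoff_R v \<eta>1 \<eta>2 t x p)"
  obtain J where J: "continuous_on ({0..} \<times> \<Omega>) J"
    "\<And>t x q. t \<ge> 0 \<Longrightarrow> x \<in> \<Omega> \<Longrightarrow> jacobian (v t) (at x) *v q = blinfun_apply (J (t, x)) (0 :: real, q)"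
    using jacobian_C1[OF v \<Omega>] by blast
  define b where "b z = infdist (fst (snd z)) (frontier \<Omega>) - 2 * \<epsilon> (fst z)" for z :: "real \<times> (real^3) \<times> (real^3)"
  have b_cont: "continuous_on D b"
    unfolding b_def D_def
    by (intro continuous_intros continuous_on_infdist continuous_on_compose2[OF \<epsilon>(1)]) auto
  define W1 where "W1 = D \<inter> b -` {..<0}"
  define W2 where "W2 = D \<inter> (\<lambda>z. norm (snd (snd z))) -` {..<1/3}"
  define W3 where "W3 = D \<inter> (UNIV \<times> \<Omega> \<times> (- {0}))"
  have W1: "openin (top_of_set D) W1"
    unfolding W1_def by (rule continuous_openin_preimage_gen[OF b_cont]) auto
  have W2: "openin (top_of_set D) W2"
    unfolding W2_def by (rule continuous_openin_preimage_gen) (auto intro!: continuous_intros)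
  have W3: "openin (top_of_set D) W3"
    unfolding W3_def by (intro openin_open_Int open_Times \<Omega>) auto
  define F where "F z = \<eta>1 (fst z) (fst (snd z)) * \<eta>2 (norm (snd (snd z))) *
      (blinfun_apply (J (fst z, fst (snd z))) (0, snd (snd z) /\<^sub>R norm (snd (snd z))) \<bullet>
        (snd (snd z) /\<^sub>R norm (snd (snd z))))" for z
  have F: "continuous_on W3 F"
  proof -
    have "continuous_on W3 (\<lambda>z. (\<lambda>(t, x). \<eta>1 t x) (fst z, fst (snd z)))"
      by (rule continuous_on_compose2[OF \<eta>1(1)]) (auto simp: W3_def D_def intro!: continuous_intros)
    then have c1: "continuous_on W3 (\<lambda>z. \<eta>1 (fst z) (fst (snd z)))" by simp
    have c2: "continuous_on W3 (\<lambda>z. \<eta>2 (norm (snd (snd z))))"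
      by (rule continuous_on_compose2[OF \<eta>2(1)]) (auto intro!: continuous_intros)
    have c3: "continuous_on W3 (\<lambda>z. J (fst z, fst (snd z)))"
      by (rule continuous_on_compose2[OF J(1)]) (auto simp: W3_def D_def intro!: continuous_intros)
    have c4: "continuous_on W3 (\<lambda>z. snd (snd z) /\<^sub>R norm (snd (snd z)))"
      by (intro continuous_intros) (auto simp: W3_def)
    show ?thesis unfolding F_def
      by (intro continuous_intros c1 c2 c3 c4)
  qed
  have "continuous (at z within D) f" if z: "z \<in> D" for z
  proof -
    consider "z \<in> W1" | "z \<in> W2" | "z \<in> W3"
    proof -
      have "z \<in> W3" if "z \<notin> W1" "z \<notin> W2"
      proof -
        have "fst z \<ge> 0" using z by (auto simp: D_def)
        moreover have "b z \<ge> 0" using that(1) z by (auto simp: W1_def)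
        ultimately have "infdist (fst (snd z)) (frontier \<Omega>) > 0" using \<epsilon>(2)[of "fst z"] by (simp add: b_def)
        then have "fst (snd z) \<notin> frontier \<Omega>" by (metis infdist_zero less_irrefl)
        moreover have "fst (snd z) \<in> closure \<Omega>" using z by (auto simp: D_def)
        ultimately have "fst (snd z) \<in> \<Omega>" using \<Omega> by (simp add: frontier_def interior_open)
        moreover have "snd (snd z) \<noteq> 0" using that(2) z by (auto simp: W2_def)
        ultimately show ?thesis using z by (auto simp: W3_def mem_Times_iff)
      qed
      then show thesis using that by blast
    qed
    then show ?thesis
    proof cases
      case 1
      show ?thesis
      proof (rule continuous_within_openin_cong[OF continuous_on_const W1 1])
        fix y assume "y \<in> W1"
        then have "fst y \<ge> 0" "fst (snd y) \<in> boundary_layer \<Omega> (2 * \<epsilon> (fst y))"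
          by (auto simp: W1_def D_def b_def boundary_layer_def)
        then have "\<eta>1 (fst y) (fst (snd y)) = 0" by (rule \<eta>1(2))
        then show "0 = f y" by (simp add: f_def case_prod_beta cutoff_R_def)
      qed
    next
      case 2
      show ?thesis
      proof (rule continuous_within_openin_cong[OF continuous_on_const W2 2])
        fix y assume "y \<in> W2"
        then have "norm (snd (snd y)) \<in> {0..1/3}" by (auto simp: W2_def)
        then have "\<eta>2 (norm (snd (snd y))) = 0" by (rule \<eta>2(2))
        then show "0 = f y" by (simp add: f_def case_prod_beta cutoff_R_def)
      qed
    next
      case 3
      show ?thesis
      proof (rule continuous_within_openin_cong[OF F W3 3])
        fix y assume "y \<in> W3"
        then have "fst y \<ge> 0" "fst (snd y) \<in> \<Omega>" by (auto simp: W3_def D_def)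
        then show "F y = f y" by (simp add: F_def f_def case_prod_beta cutoff_R_def J(2))
      qed
    qed
  qed
  then have "continuous_on D f" by (simp add: continuous_on_eq_continuous_within)
  then show ?thesis by (simp add: D_def f_def)
qed

section \<open>Barriers\<close>

text \<open>The barriers need not be differentiable in x, as the initial datum is only continuous.
  The transport part of the equation sees a test function only through its derivative along the
  trajectory through (t,x), on which X(0,s,.) has the constant value \<xi>; so an extremum in the
  single variable s decides.\<close>

lemma (in tangential_field) characteristic_derivative:
  fixes F :: "real \<Rightarrow> 'a \<Rightarrow> real" and \<psi> :: "real \<times> 'a \<Rightarrow> real"
  assumes tx: "(t, x) \<in> {0<..<T} \<times> \<Omega>"
    and F: "((\<lambda>s. F s (flow \<Omega> v 0 t x)) has_real_derivative d) (at t)"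
    and \<psi>: "GDERIV \<psi> (t, x) :> D"
    and extremum: "(\<forall>z\<in>{0<..<T} \<times> \<Omega>. F (fst z) (flow \<Omega> v 0 (fst z) (snd z)) - \<psi> z \<le> F t (flow \<Omega> v 0 t x) - \<psi> (t, x)) \<or>
      (\<forall>z\<in>{0<..<T} \<times> \<Omega>. F t (flow \<Omega> v 0 t x) - \<psi> (t, x) \<le> F (fst z) (flow \<Omega> v 0 (fst z) (snd z)) - \<psi> z)"
  shows "fst D + v t x \<bullet> snd D = d"
proof -
  have t: "0 < t" "t < T" and x: "x \<in> \<Omega>" using tx by auto
  have xc: "x \<in> closure \<Omega>" using x closure_subset by blast
  define \<xi> where "\<xi> = flow \<Omega> v 0 t x"
  define g where "g s = F s \<xi> - \<psi> (s, flow \<Omega> v s t x)" for s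
  have self: "flow \<Omega> v t t x = x" using t xc by simp
  have "at t within {0..} = at t" using t by (intro at_within_interior) simp
  then have "((\<lambda>s. flow \<Omega> v s t x) has_vector_derivative v t x) (at t)"
    using flow_deriv[of t x t] t xc self by simp
  then have "((\<lambda>s. (s, flow \<Omega> v s t x)) has_derivative (\<lambda>h. (h, h *\<^sub>R v t x))) (at t)"
    unfolding has_vector_derivative_def by (auto intro!: derivative_eq_intros)
  from has_derivative_compose[OF this, of \<psi> "\<lambda>h. h \<bullet> D"]
  have "((\<lambda>s. \<psi> (s, flow \<Omega> v s t x)) has_derivative (\<lambda>h. (h, h *\<^sub>R v t x) \<bullet> D)) (at t)"
    using \<psi> self by (simp add: gderiv_def)
  moreover have "(\<lambda>h. (h, h *\<^sub>R v t x) \<bullet> D) = (*) (fst D + v t x \<bullet> snd D)"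
    by (cases D) (auto simp: algebra_simps)
  ultimately have "((\<lambda>s. \<psi> (s, flow \<Omega> v s t x)) has_real_derivative (fst D + v t x \<bullet> snd D)) (at t)"
    by (simp add: has_field_derivative_def)
  then have g: "(g has_real_derivative (d - (fst D + v t x \<bullet> snd D))) (at t)"
    unfolding g_def using F by (intro DERIV_diff) (simp_all add: \<xi>_def)
  have along: "g s = F (fst z) (flow \<Omega> v 0 (fst z) (snd z)) - \<psi> z" "z \<in> {0<..<T} \<times> \<Omega>"
    if "z = (s, flow \<Omega> v s t x)" "0 < s" "s < T" for s z
    using that t x xc flow_comp[of t x s 0] flow_in_domain[of t x s] by (auto simp: g_def \<xi>_def)
  have gt: "g t = F t (flow \<Omega> v 0 t x) - \<psi> (t, x)" using self by (simp add: g_def \<xi>_def)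
  define \<delta> where "\<delta> = min t (T - t)"
  have \<delta>: "\<delta> > 0" using t by (simp add: \<delta>_def)
  have near: "0 < s \<and> s < T" if "\<bar>t - s\<bar> < \<delta>" for s using that by (auto simp: \<delta>_def abs_less_iff)
  have "d - (fst D + v t x \<bullet> snd D) = 0"
    using extremum
  proof
    assume max: "\<forall>z\<in>{0<..<T} \<times> \<Omega>. F (fst z) (flow \<Omega> v 0 (fst z) (snd z)) - \<psi> z \<le> F t (flow \<Omega> v 0 t x) - \<psi> (t, x)"
    show ?thesis
    proof (rule DERIV_local_max[OF g \<delta>], intro allI impI)
      fix s assume "\<bar>t - s\<bar> < \<delta>"
      then show "g s \<le> g t" using along[OF refl] near[of s] max gt by metis
    qed
  next
    assume min: "\<forall>z\<in>{0<..<T} \<times> \<Omega>. F t (flow \<Omega> v 0 t x) - \<psi> (t, x) \<le> F (fst z) (flow \<Omega> v 0 (fst z) (snd z)) - \<psi> z"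
    show ?thesis
    proof (rule DERIV_local_min[OF g \<delta>], intro allI impI)
      fix s assume "\<bar>t - s\<bar> < \<delta>"
      then show "g t \<le> g s" using along[OF refl] near[of s] min gt by metis
    qed
  qed
  then show ?thesis by simp
qed

text \<open>The solution at time t of dy/dt = k(\<xi>) |y| with y(0) = \<phi>0(\<xi>). Writing it
  with positive and negative parts keeps it visibly continuous in \<xi>.\<close>

definition barrier :: "('a \<Rightarrow> real) \<Rightarrow> ('a \<Rightarrow> real) \<Rightarrow> real \<Rightarrow> 'a \<Rightarrow> real" where
  "barrier \<phi>0 k t \<xi> = max (\<phi>0 \<xi>) 0 * exp (k \<xi> * t) - max (- \<phi>0 \<xi>) 0 * exp (- (k \<xi> * t))"

lemma barrier_deriv:
  "((\<lambda>t. barrier \<phi>0 k t \<xi>) has_real_derivative k \<xi> * \<bar>barrier \<phi>0 k t \<xi>\<bar>) (at t)"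
proof -
  have "\<bar>barrier \<phi>0 k t \<xi>\<bar> = max (\<phi>0 \<xi>) 0 * exp (k \<xi> * t) + max (- \<phi>0 \<xi>) 0 * exp (- (k \<xi> * t))"
    by (cases "\<phi>0 \<xi> \<ge> 0") (auto simp: barrier_def max_def abs_mult)
  then show ?thesis unfolding barrier_def[abs_def]
    by (auto intro!: derivative_eq_intros simp: algebra_simps)
qed

lemma barrier_0: "barrier \<phi>0 k 0 \<xi> = \<phi>0 \<xi>"
  by (simp add: barrier_def max_def)

lemma barrier_trivial: "k \<xi> = 0 \<Longrightarrow> barrier \<phi>0 k t \<xi> = \<phi>0 \<xi>"
  by (simp add: barrier_def max_def)

lemma barrier_sign:
  "\<phi>0 \<xi> > 0 \<Longrightarrow> barrier \<phi>0 k t \<xi> > 0" "\<phi>0 \<xi> < 0 \<Longrightarrow> barrier \<phi>0 k t \<xi> < 0"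
  "\<phi>0 \<xi> = 0 \<Longrightarrow> barrier \<phi>0 k t \<xi> = 0"
  by (auto simp: barrier_def max_def mult_neg_pos)

lemma barrier_mono:
  assumes "k \<xi> \<le> k' \<xi>" "t \<ge> 0"
  shows "barrier \<phi>0 k t \<xi> \<le> barrier \<phi>0 k' t \<xi>"
  unfolding barrier_def using assms
  by (intro diff_mono mult_left_mono) (auto intro: mult_right_mono)

section \<open>Well-posedness\<close>

text \<open>Near a point outside A the function never exceeds the continuous \<open>S\<close>, so no
  upward jump can occur. This attaches boundary values to an envelope that lives on the open set
  only.\<close>

lemma usc_on_extend:
  assumes S: "continuous_on Q S" and A: "open A" "A \<subseteq> Q" and f: "usc_on A f"
    and le: "\<And>z. z \<in> A \<Longrightarrow> f z \<le> S z"
  shows "usc_on Q (\<lambda>z. if z \<in> A then f z else S z)"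
  unfolding usc_on_def
proof (intro ballI allI impI)
  fix z c assume z: "z \<in> Q" and c: "(if z \<in> A then f z else S z) < c"
  show "\<forall>\<^sub>F y in nhds z. y \<in> Q \<longrightarrow> (if y \<in> A then f y else S y) < c"
  proof (cases "z \<in> A")
    case True
    have "\<forall>\<^sub>F y in nhds z. y \<in> A \<longrightarrow> f y < c" using usc_onD[OF f True] c True by simp
    moreover have "\<forall>\<^sub>F y in nhds z. y \<in> A" using A(1) True by (rule eventually_nhds_in_open)
    ultimately show ?thesis by eventually_elim auto
  next
    case False
    then have "S z < c" using c by simp
    from continuous_on_eventually_less[OF S z this] show ?thesis
    proof eventually_elim
      case (elim y)
      then show ?case using le[of y] by auto
    qed
  qed
qed

lemma usc_lsc_imp_continuous:
  assumes f: "usc_on S f" and g: "usc_on S (\<lambda>x. - f x)"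
  shows "continuous_on S f"
  unfolding continuous_on_def
proof
  fix x assume x: "x \<in> S"
  show "(f \<longlongrightarrow> f x) (at x within S)"
  proof (rule order_tendstoI)
    fix a assume "a < f x"
    then have "\<forall>\<^sub>F y in nhds x. y \<in> S \<longrightarrow> - f y < - a" using usc_onD[OF g x, of "- a"] by simp
    then show "\<forall>\<^sub>F y in at x within S. a < f y"
      unfolding eventually_at_filter by (rule eventually_mono) auto
  next
    fix a assume "f x < a"
    then have "\<forall>\<^sub>F y in nhds x. y \<in> S \<longrightarrow> f y < a" using usc_onD[OF f x, of a] by simp
    then show "\<forall>\<^sub>F y in at x within S. f y < a"
      unfolding eventually_at_filter by (rule eventually_mono) auto
  qed
qed

text \<open>Both envelopes of a continuous function are the function itself. The two bounds are kept
  explicit since uniqueness draws on them.\<close>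

lemma viscosity_solution_continuous_iff:
  assumes A: "open A" and u: "continuous_on A u"
  shows "viscosity_solution A G u \<longleftrightarrow>
    bdd_above (u ` A) \<and> bdd_below (u ` A) \<and> sub_test A G u \<and> super_test A G u"
proof -
  have "locally_bounded_on A u" by (rule locally_bounded_on_between[OF A u u]) auto
  moreover have "usc_envelope A u ` A = u ` A" using usc_envelope_continuous[OF A u] by simp
  moreover have "lsc_envelope A u ` A = u ` A" using lsc_envelope_continuous[OF A u] by simp
  ultimately show ?thesis
    using sub_test_cong[of A "usc_envelope A u" u G] usc_envelope_continuous[OF A u]
      super_test_cong[of A "lsc_envelope A u" u G] lsc_envelope_continuous[OF A u]
    unfolding viscosity_solution_def viscosity_subsolution_def viscosity_supersolution_def
      sub_test_def[of A G "usc_envelope A u", symmetric] super_test_def[of A G "lsc_envelope A u", symmetric]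
    by auto
qed


text \<open>Extracts from the formula for R the features that the argument rests on: continuity up
  to the boundary, vanishing for gradients beyond \<open>P\<close>, and vanishing in a layer around
  \<partial>\<Omega>.\<close>

locale level_set_problem = tangential_field \<Omega> v
  for \<Omega> :: "(real^3) set" and v :: "real \<Rightarrow> real^3 \<Rightarrow> real^3" +
  fixes R :: "real \<Rightarrow> real^3 \<Rightarrow> real^3 \<Rightarrow> real" and \<phi>0 :: "real^3 \<Rightarrow> real" and \<epsilon> :: "real \<Rightarrow> real" and T P :: real
  assumes T_pos: "T > 0"
    and R_cont: "continuous_on ({0..} \<times> closure \<Omega> \<times> UNIV) (\<lambda>(t, x, p). R t x p)"
    and R_supp: "\<And>t x p. norm p \<ge> P \<Longrightarrow> R t x p = 0"
    and R_layer: "\<And>t x p. t \<ge> 0 \<Longrightarrow> x \<in> boundary_layer \<Omega> (2 * \<epsilon> t) \<Longrightarrow> R t x p = 0"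
    and \<epsilon>_cont: "continuous_on {0..} \<epsilon>" and \<epsilon>_pos: "\<And>t. t \<ge> 0 \<Longrightarrow> \<epsilon> t > 0"
    and \<phi>0_cont: "continuous_on (closure \<Omega>) \<phi>0"
begin

abbreviation "Q \<equiv> {0..<T} \<times> closure \<Omega>"
abbreviation "A \<equiv> {0<..<T} \<times> \<Omega>"

lemma A_open: "open A" and A_sub_Q: "A \<subseteq> Q"
  using open_domain closure_subset by (auto intro!: open_Times)

text \<open>Gradients with |p| \<le> |P| form a compact set, on which continuity gives a bound;
  beyond it R is 0.\<close>

lemma R_bounded:
  obtains M where "M > 0" "\<And>t x p. t \<in> {0..T} \<Longrightarrow> x \<in> closure \<Omega> \<Longrightarrow> \<bar>R t x p\<bar> \<le> M"
proof -
  have "compact ((\<lambda>(t, x, p). R t x p) ` ({0..T} \<times> closure \<Omega> \<times> cball 0 \<bar>P\<bar>))"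
    by (intro compact_continuous_image continuous_on_subset[OF R_cont] compact_Times compact_closure_domain) auto
  then obtain M where M: "M > 0" "\<forall>r\<in>(\<lambda>(t, x, p). R t x p) ` ({0..T} \<times> closure \<Omega> \<times> cball 0 \<bar>P\<bar>). norm r \<le> M"
    using compact_imp_bounded bounded_pos by metis
  have "\<bar>R t x p\<bar> \<le> M" if "t \<in> {0..T}" "x \<in> closure \<Omega>" for t x p
  proof (cases "norm p \<le> \<bar>P\<bar>")
    case True
    then have "(t, x, p) \<in> {0..T} \<times> closure \<Omega> \<times> cball 0 \<bar>P\<bar>" using that by simp
    then have "R t x p \<in> (\<lambda>(t, x, p). R t x p) ` ({0..T} \<times> closure \<Omega> \<times> cball 0 \<bar>P\<bar>)"
      by (rule rev_image_eqI) simp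
    then show ?thesis using M(2) by force
  next
    case False
    then show ?thesis using R_supp[of p t x] M(1) by simp
  qed
  then show thesis using that M(1) by blast
qed

lemma comparison:
  assumes "usc_on Q u" "usc_on Q (\<lambda>z. - w z)"
    and "\<And>z. z \<in> Q \<Longrightarrow> \<bar>u z\<bar> \<le> C" "\<And>z. z \<in> Q \<Longrightarrow> \<bar>w z\<bar> \<le> C"
    and "sub_test A (level_set_G v R) u" "super_test A (level_set_G v R) w"
    and "\<And>z. z \<in> Q \<Longrightarrow> z \<notin> A \<Longrightarrow> u z \<le> w z"
    and "z \<in> Q"
  shows "u z \<le> w z"
proof -
  obtain M where M: "M > 0" "\<And>t x p. t \<in> {0..T} \<Longrightarrow> x \<in> closure \<Omega> \<Longrightarrow> \<bar>R t x p\<bar> \<le> M"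
    by (rule R_bounded) blast
  obtain L where L: "L > 0"
    "\<And>t x y. t \<in> {0..T} \<Longrightarrow> x \<in> closure \<Omega> \<Longrightarrow> y \<in> closure \<Omega> \<Longrightarrow> norm (v t x - v t y) \<le> L * norm (x - y)"
    by (rule field_lipschitz_const[where N=T]) blast
  show ?thesis
  proof (rule viscosity_comparison[OF open_domain bounded_domain T_pos assms(1-7) field_cont_on L(2) _ M(2) R_supp assms(8)])
    show "continuous_on ({0..T} \<times> closure \<Omega> \<times> UNIV) (\<lambda>(t, x, p). R t x p)"
      by (rule continuous_on_subset[OF R_cont]) auto
  qed auto
qed

text \<open>The distance to \<open>\<partial>\<Omega>\<close> is comparable along the flow on \<open>[0,T]\<close>, so a
  multiple of it at the starting point controls \<open>R\<close>, which vanishes near \<open>\<partial>\<Omega>\<close>.\<close>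

lemma R_controlled:
  obtains c where "c \<ge> 0"
    and "\<And>t x p. t \<in> {0..T} \<Longrightarrow> x \<in> closure \<Omega> \<Longrightarrow> \<bar>R t x p\<bar> \<le> c * infdist (flow \<Omega> v 0 t x) (frontier \<Omega>)"
proof -
  obtain M where M: "M > 0" "\<And>t x p. t \<in> {0..T} \<Longrightarrow> x \<in> closure \<Omega> \<Longrightarrow> \<bar>R t x p\<bar> \<le> M"
    by (rule R_bounded) blast
  obtain L where L: "L > 0"
    "\<And>t x y. t \<in> {0..T} \<Longrightarrow> x \<in> closure \<Omega> \<Longrightarrow> y \<in> closure \<Omega> \<Longrightarrow> norm (v t x - v t y) \<le> L * norm (x - y)"
    by (rule field_lipschitz_const[where N=T]) blast
  have "\<exists>t0\<in>{0..T}. \<forall>t\<in>{0..T}. \<epsilon> t0 \<le> \<epsilon> t"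
    by (rule continuous_attains_inf) (use T_pos \<epsilon>_cont in \<open>auto intro: continuous_on_subset\<close>)
  then obtain t0 where t0: "t0 \<in> {0..T}" "\<And>t. t \<in> {0..T} \<Longrightarrow> \<epsilon> t0 \<le> \<epsilon> t" by blast
  have e0: "\<epsilon> t0 > 0" using \<epsilon>_pos t0(1) by simp
  \<comment> \<open>A trajectory that starts within r of \<partial>\<Omega> stays within the minimum
    of \<epsilon> over [0,T], hence inside the layer where R vanishes. For the other starting points
    (M / r) times the distance is at least M.\<close>
  define r where "r = \<epsilon> t0 * exp (- (L * T))"
  have r: "r > 0" using e0 by (simp add: r_def)
  show thesis
  proof (rule that[of "M / r"])
    show "M / r \<ge> 0" using M r by simp
    fix t x p assume t: "t \<in> {0..T}" and x: "x \<in> closure \<Omega>"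
    define \<xi> where "\<xi> = flow \<Omega> v 0 t x"
    have \<xi>: "\<xi> \<in> closure \<Omega>" using flow_in_closure[of t x 0] t x by (simp add: \<xi>_def)
    have x_eq: "flow \<Omega> v t 0 \<xi> = x" using flow_comp[of t x 0 t] t x by (simp add: \<xi>_def)
    show "\<bar>R t x p\<bar> \<le> M / r * infdist (flow \<Omega> v 0 t x) (frontier \<Omega>)"
    proof (cases "infdist \<xi> (frontier \<Omega>) < r")
      case True
      have "infdist x (frontier \<Omega>) \<le> exp (L * T) * infdist \<xi> (frontier \<Omega>)"
        using flow_infdist_frontier[where N=T and L=L, OF L(2,1) t \<xi>] x_eq by simp
      also have "\<dots> \<le> exp (L * T) * r" using True by (intro mult_left_mono) auto
      also have "\<dots> = \<epsilon> t0" by (simp add: r_def mult.left_commute flip: exp_add)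
      also have "\<dots> < 2 * \<epsilon> t" using t0(2)[OF t] e0 by simp
      finally have "R t x p = 0" using R_layer[of t x p] t x by (simp add: boundary_layer_def)
      moreover have "0 \<le> M / r * infdist (flow \<Omega> v 0 t x) (frontier \<Omega>)"
        using M(1) r by (intro mult_nonneg_nonneg infdist_nonneg) auto
      ultimately show ?thesis by simp
    next
      case False
      have "M * 1 \<le> M * (infdist \<xi> (frontier \<Omega>) / r)" using False r M by (intro mult_left_mono) auto
      then show ?thesis using M(2)[OF t x, of p] by (simp add: \<xi>_def)
    qed
  qed
qed

section \<open>Existence of a solution between the barriers\<close>

lemma barrier_continuous:
  assumes "continuous_on (closure \<Omega>) k"
  shows "continuous_on ({0..T} \<times> closure \<Omega>) (\<lambda>z. barrier \<phi>0 k (fst z) (flow \<Omega> v 0 (fst z) (snd z)))"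
proof -
  have X: "continuous_on ({0..T} \<times> closure \<Omega>) (\<lambda>z. flow \<Omega> v 0 (fst z) (snd z))"
    using flow_cont[of T] by (simp add: case_prod_beta)
  have "continuous_on ({0..T} \<times> closure \<Omega>) (\<lambda>z. f (flow \<Omega> v 0 (fst z) (snd z)))"
    if "continuous_on (closure \<Omega>) f" for f :: "real^3 \<Rightarrow> real"
    by (rule continuous_on_compose2[OF that X]) (auto intro!: flow_in_closure)
  from this[OF \<phi>0_cont] this[OF assms] show ?thesis
    unfolding barrier_def by (intro continuous_intros)
qed

lemma solution_exists_between:
  obtains k \<phi> where "continuous_on (closure \<Omega>) k" "\<And>\<xi>. k \<xi> \<ge> 0" "\<And>\<xi>. \<xi> \<in> frontier \<Omega> \<Longrightarrow> k \<xi> = 0"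
    and "\<And>t x. (t, x) \<in> Q \<Longrightarrow> barrier \<phi>0 (\<lambda>\<xi>. - k \<xi>) t (flow \<Omega> v 0 t x) \<le> \<phi> (t, x) \<and>
      \<phi> (t, x) \<le> barrier \<phi>0 k t (flow \<Omega> v 0 t x)"
    and "continuous_on Q \<phi>" "viscosity_solution A (level_set_G v R) \<phi>"
    and "bounded (\<phi> ` Q)"
proof -
  obtain c where c: "c \<ge> 0" "\<And>t x p. t \<in> {0..T} \<Longrightarrow> x \<in> closure \<Omega> \<Longrightarrow> \<bar>R t x p\<bar> \<le> c * infdist (flow \<Omega> v 0 t x) (frontier \<Omega>)"
    by (rule R_controlled) blast
  define k where "k \<xi> = c * infdist \<xi> (frontier \<Omega>)" for \<xi> :: "real^3"
  have k_cont: "continuous_on (closure \<Omega>) k"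
    unfolding k_def by (intro continuous_intros continuous_on_infdist)
  have k_nonneg: "k \<xi> \<ge> 0" for \<xi> using c(1) by (simp add: k_def infdist_nonneg)
  have k_fr: "k \<xi> = 0" if "\<xi> \<in> frontier \<Omega>" for \<xi> using that by (simp add: k_def)
  define S where "S z = barrier \<phi>0 k (fst z) (flow \<Omega> v 0 (fst z) (snd z))" for z
  define s where "s z = barrier \<phi>0 (\<lambda>\<xi>. - k \<xi>) (fst z) (flow \<Omega> v 0 (fst z) (snd z))" for z
  have S_contT: "continuous_on ({0..T} \<times> closure \<Omega>) S" unfolding S_def by (rule barrier_continuous[OF k_cont])
  have s_contT: "continuous_on ({0..T} \<times> closure \<Omega>) s"
    unfolding s_def by (rule barrier_continuous) (intro continuous_intros k_cont)
  have S_cont: "continuous_on Q S" by (rule continuous_on_subset[OF S_contT]) auto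
  have s_cont: "continuous_on Q s" by (rule continuous_on_subset[OF s_contT]) auto
  have S_A: "continuous_on A S" and s_A: "continuous_on A s"
    using continuous_on_subset[OF S_cont A_sub_Q] continuous_on_subset[OF s_cont A_sub_Q] .
  have sS: "s z \<le> S z" if "z \<in> Q" for z
    unfolding s_def S_def
  proof (rule barrier_mono)
    show "- k \<xi> \<le> k \<xi>" for \<xi> using k_nonneg[of \<xi>] by simp
  qed (use that in auto)
  \<comment> \<open>At time 0 both barriers equal the initial datum; on \<partial>\<Omega> the
    starting point lies on \<partial>\<Omega> too, where the rate \<open>k\<close> is 0.\<close>
  have s_eq_S: "s z = S z" if z: "z \<in> Q" "z \<notin> A" for z
  proof -
    consider "fst z = 0" | "snd z \<in> frontier \<Omega>"
      using z closure_domain by (cases z) auto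
    then show ?thesis
    proof cases
      case 1 then show ?thesis by (simp add: s_def S_def barrier_0)
    next
      case 2
      then have "k (flow \<Omega> v 0 (fst z) (snd z)) = 0" using z by (intro k_fr flow_in_frontier) auto
      then show ?thesis by (simp add: s_def S_def barrier_trivial)
    qed
  qed
  have G_cont: "continuous_on (A \<times> UNIV) (\<lambda>(z, u, p). level_set_G v R z u p)"
  proof -
    have c1: "continuous_on (A \<times> UNIV) (\<lambda>y. (\<lambda>(t, x). v t x) (fst (fst y), snd (fst y)))"
      by (rule continuous_on_compose2[OF field_cont])
        (use A_sub_Q in \<open>auto intro!: continuous_intros\<close>)
    have c2: "continuous_on (A \<times> UNIV) (\<lambda>y. (\<lambda>(t, x, p). R t x p) (fst (fst y), snd (fst y), snd (snd (snd y))))"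
      by (rule continuous_on_compose2[OF R_cont])
        (use A_sub_Q in \<open>auto intro!: continuous_intros\<close>)
    show ?thesis
      using c1 c2 unfolding level_set_G_def case_prod_beta
      by (intro continuous_intros) auto
  qed
  have R_k: "\<bar>R t x p\<bar> \<le> k (flow \<Omega> v 0 t x)" if "(t, x) \<in> A" for t x p
    using c(2)[of t x p] that closure_domain by (auto simp: k_def)
  \<comment> \<open>The right-hand side u R is dominated by k|u|, exactly the rate at which the
    barriers move along trajectories.\<close>
  have UR: "\<bar>u * R t x p\<bar> \<le> k (flow \<Omega> v 0 t x) * \<bar>u\<bar>" if "(t, x) \<in> A" for t x p u
    using mult_right_mono[OF R_k[OF that, of p], of "\<bar>u\<bar>"] by (simp add: abs_mult mult.commute)
  have s_sub: "sub_test A (level_set_G v R) s"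
    unfolding sub_test_def
  proof (intro allI impI, elim conjE)
    fix \<psi> D z
    assume \<psi>: "\<forall>y\<in>A. GDERIV \<psi> y :> D y" and z: "z \<in> A" and max: "\<forall>y\<in>A. s y - \<psi> y \<le> s z - \<psi> z"
    obtain t x where tx: "z = (t, x)" by (cases z)
    have "fst (D z) + v t x \<bullet> snd (D z) = - k (flow \<Omega> v 0 t x) * \<bar>s z\<bar>"
      unfolding s_def tx fst_conv snd_conv
      by (rule characteristic_derivative[where F="barrier \<phi>0 (\<lambda>\<xi>. - k \<xi>)" and \<psi>=\<psi>, OF _ barrier_deriv])
        (use \<psi> z max in \<open>auto simp: tx s_def\<close>)
    then show "level_set_G v R z (s z) (D z) \<le> 0"
      using UR[of t x "s z" "snd (D z)"] z by (cases "D z") (auto simp: tx level_set_G_def)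
  qed
  have S_super: "super_test A (level_set_G v R) S"
    unfolding super_test_def
  proof (intro allI impI, elim conjE)
    fix \<psi> D z
    assume \<psi>: "\<forall>y\<in>A. GDERIV \<psi> y :> D y" and z: "z \<in> A" and min: "\<forall>y\<in>A. S z - \<psi> z \<le> S y - \<psi> y"
    obtain t x where tx: "z = (t, x)" by (cases z)
    have "fst (D z) + v t x \<bullet> snd (D z) = k (flow \<Omega> v 0 t x) * \<bar>S z\<bar>"
      unfolding S_def tx fst_conv snd_conv
      by (rule characteristic_derivative[where F="barrier \<phi>0 k" and \<psi>=\<psi>, OF _ barrier_deriv])
        (use \<psi> z min in \<open>auto simp: tx S_def\<close>)
    then show "0 \<le> level_set_G v R z (S z) (D z)"
      using UR[of t x "S z" "snd (D z)"] z by (cases "D z") (auto simp: tx level_set_G_def)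
  qed
  obtain \<phi> where \<phi>: "\<And>z. z \<in> A \<Longrightarrow> s z \<le> \<phi> z" "\<And>z. z \<in> A \<Longrightarrow> \<phi> z \<le> S z"
    "sub_test A (level_set_G v R) (usc_envelope A \<phi>)" "super_test A (level_set_G v R) (lsc_envelope A \<phi>)"
    by (rule perron_method[OF A_open G_cont s_A S_A _ s_sub S_super]) (use sS A_sub_Q in blast)+
  have lb: "locally_bounded_on A \<phi>"
    by (rule locally_bounded_on_between[OF A_open s_A S_A]) (use \<phi> in auto)
  have lb': "locally_bounded_on A (\<lambda>z. - \<phi> z)" by (rule locally_bounded_on_uminus[OF lb])
  \<comment> \<open>The upper envelope is continued by the upper barrier and the lower envelope by
    the lower one, which preserves their semicontinuity; outside the open set the two continuations
    agree.\<close>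
  define u where "u z = (if z \<in> A then usc_envelope A \<phi> z else S z)" for z
  define w where "w z = (if z \<in> A then lsc_envelope A \<phi> z else s z)" for z
  have u_le: "usc_envelope A \<phi> z \<le> S z" if "z \<in> A" for z
    by (rule usc_envelope_least[OF lb continuous_imp_usc_on[OF S_A] \<phi>(2) that])
  have w_ge: "usc_envelope A (\<lambda>z. - \<phi> z) z \<le> - s z" if "z \<in> A" for z
    by (rule usc_envelope_least[OF lb' continuous_imp_usc_on _ that]) (use \<phi>(1) s_A in \<open>auto intro: continuous_on_minus\<close>)
  have u_usc: "usc_on Q u"
    unfolding u_def by (rule usc_on_extend[OF S_cont A_open A_sub_Q usc_envelope_usc[OF lb] u_le])
  have w_eq: "- w z = (if z \<in> A then usc_envelope A (\<lambda>z. - \<phi> z) z else - s z)" for z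
    using lsc_envelope_uminus[OF lb] by (simp add: w_def)
  have w_lsc: "usc_on Q (\<lambda>z. - w z)"
    unfolding w_eq by (rule usc_on_extend[OF _ A_open A_sub_Q usc_envelope_usc[OF lb'] w_ge])
      (intro continuous_on_minus s_cont)
  have env: "lsc_envelope A \<phi> z \<le> \<phi> z" "\<phi> z \<le> usc_envelope A \<phi> z" if "z \<in> A" for z
    using usc_envelope_ge[OF lb that] usc_envelope_ge[OF lb' that] lsc_envelope_uminus[OF lb that] by auto
  have between: "s z \<le> w z" "w z \<le> u z" "u z \<le> S z" if "z \<in> Q" for z
  proof -
    show "s z \<le> w z" using w_ge[of z] lsc_envelope_uminus[OF lb, of z] by (auto simp: w_def)
    show "u z \<le> S z" using u_le[of z] by (simp add: u_def)
    show "w z \<le> u z" using env[of z] sS[OF that] by (auto simp: w_def u_def)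
  qed
  have "bounded (S ` ({0..T} \<times> closure \<Omega>))" "bounded (s ` ({0..T} \<times> closure \<Omega>))"
    by (auto intro!: compact_imp_bounded compact_continuous_image S_contT s_contT compact_Times compact_closure_domain)
  then obtain b1 b2 where b12: "\<forall>z\<in>{0..T} \<times> closure \<Omega>. \<bar>S z\<bar> \<le> b1" "\<forall>z\<in>{0..T} \<times> closure \<Omega>. \<bar>s z\<bar> \<le> b2"
    unfolding bounded_iff by auto
  have bd: "\<bar>u z\<bar> \<le> \<bar>b1\<bar> + \<bar>b2\<bar>" "\<bar>w z\<bar> \<le> \<bar>b1\<bar> + \<bar>b2\<bar>" if "z \<in> Q" for z
  proof -
    have "z \<in> {0..T} \<times> closure \<Omega>" using that by auto
    then have "\<bar>S z\<bar> \<le> b1" "\<bar>s z\<bar> \<le> b2" using b12 by blast+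
    then show "\<bar>u z\<bar> \<le> \<bar>b1\<bar> + \<bar>b2\<bar>" "\<bar>w z\<bar> \<le> \<bar>b1\<bar> + \<bar>b2\<bar>" using between[OF that] by linarith+
  qed
  \<comment> \<open>Envelopes satisfy w \<le> u by construction. Comparison gives the reverse
    inequality, so both are one function, which is upper and lower semicontinuous.\<close>
  have u_w: "u z \<le> w z" if "z \<in> Q" for z
  proof (rule comparison[OF u_usc w_lsc bd _ _ _ that])
    show "sub_test A (level_set_G v R) u"
      using \<phi>(3) sub_test_cong[of A u "usc_envelope A \<phi>"] by (simp add: u_def)
    show "super_test A (level_set_G v R) w"
      using \<phi>(4) super_test_cong[of A w "lsc_envelope A \<phi>"] by (simp add: w_def)
    show "u z \<le> w z" if "z \<in> Q" "z \<notin> A" for z using s_eq_S[OF that] that by (simp add: u_def w_def)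
  qed
  then have uw: "w z = u z" if "z \<in> Q" for z using between(2)[OF that] that by (simp add: order.antisym)
  have "usc_on Q (\<lambda>z. - u z)"
    using w_lsc uw unfolding usc_on_def by (auto elim!: eventually_mono)
  then have u_cont: "continuous_on Q u" by (rule usc_lsc_imp_continuous[OF u_usc])
  show thesis
  proof (rule that[OF k_cont k_nonneg k_fr _ u_cont])
    show "barrier \<phi>0 (\<lambda>\<xi>. - k \<xi>) t (flow \<Omega> v 0 t x) \<le> u (t, x) \<and> u (t, x) \<le> barrier \<phi>0 k t (flow \<Omega> v 0 t x)"
      if "(t, x) \<in> Q" for t x
      using between[OF that] by (simp add: s_def S_def)
    show "bounded (u ` Q)" unfolding bounded_iff using bd(1) by (intro exI[of _ "\<bar>b1\<bar> + \<bar>b2\<bar>"]) auto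
    have "bounded (u ` A)" by (rule bounded_subset[OF \<open>bounded (u ` Q)\<close>]) (intro image_mono A_sub_Q)
    moreover have "sub_test A (level_set_G v R) u"
      using \<phi>(3) sub_test_cong[of A u "usc_envelope A \<phi>"] by (simp add: u_def)
    moreover have "super_test A (level_set_G v R) u"
    proof -
      have "u z = lsc_envelope A \<phi> z" if "z \<in> A" for z using uw[of z] that A_sub_Q by (auto simp: w_def)
      then show ?thesis using \<phi>(4) super_test_cong[of A u "lsc_envelope A \<phi>"] by simp
    qed
    ultimately show "viscosity_solution A (level_set_G v R) u"
      unfolding viscosity_solution_continuous_iff[OF A_open continuous_on_subset[OF u_cont A_sub_Q]]
      by (intro conjI bounded_imp_bdd_above bounded_imp_bdd_below)
  qed
qed

section \<open>Uniqueness among continuous solutions\<close>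

text \<open>Comparison in both directions. The domain lacks t = T and is not compact, so a bound for
  \<psi> has to be found first: in the interior it is part of being a viscosity solution, and
  elsewhere \<psi> equals the bounded \<phi>.\<close>

lemma viscosity_solution_unique:
  assumes cont: "continuous_on Q \<phi>" "continuous_on Q \<psi>"
    and sol: "viscosity_solution A (level_set_G v R) \<phi>" "viscosity_solution A (level_set_G v R) \<psi>"
    and bd: "bounded (\<phi> ` Q)" and eq: "\<And>z. z \<in> Q \<Longrightarrow> z \<notin> A \<Longrightarrow> \<psi> z = \<phi> z" and z: "z \<in> Q"
  shows "\<psi> z = \<phi> z"
proof -
  have sol': "bdd_above (f ` A) \<and> bdd_below (f ` A) \<and> sub_test A (level_set_G v R) f \<and> super_test A (level_set_G v R) f"
    if "continuous_on Q f" "viscosity_solution A (level_set_G v R) f" for f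
    by (rule viscosity_solution_continuous_iff[OF A_open continuous_on_subset[OF that(1) A_sub_Q], THEN iffD1, OF that(2)])
  note \<phi> = sol'[OF cont(1) sol(1)] and \<psi> = sol'[OF cont(2) sol(2)]
  obtain C1 where C1: "\<And>z. z \<in> Q \<Longrightarrow> \<bar>\<phi> z\<bar> \<le> C1" using bd unfolding bounded_iff by auto
  obtain C2 where "\<forall>y\<in>\<psi> ` A. y \<le> C2" using \<psi> unfolding bdd_above_def by blast
  moreover obtain C3 where "\<forall>y\<in>\<psi> ` A. C3 \<le> y" using \<psi> unfolding bdd_below_def by blast
  ultimately have C2: "\<And>z. z \<in> A \<Longrightarrow> \<psi> z \<le> C2" "\<And>z. z \<in> A \<Longrightarrow> C3 \<le> \<psi> z" by blast+
  define C where "C = \<bar>C1\<bar> + \<bar>C2\<bar> + \<bar>C3\<bar>"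
  have b1: "\<bar>\<phi> z\<bar> \<le> C" if "z \<in> Q" for z using C1[OF that] by (simp add: C_def)
  have b2: "\<bar>\<psi> z\<bar> \<le> C" if "z \<in> Q" for z
  proof (cases "z \<in> A")
    case True
    then show ?thesis using C2[OF True] unfolding C_def by linarith
  next
    case False
    then show ?thesis using b1[OF that] eq[OF that] by simp
  qed
  have usc: "usc_on Q f" "usc_on Q (\<lambda>z. - f z)" if "continuous_on Q f" for f
    using that by (auto intro!: continuous_imp_usc_on continuous_on_minus)
  have "\<psi> z \<le> \<phi> z"
    by (rule comparison[OF usc(1)[OF cont(2)] usc(2)[OF cont(1)] b2 b1 _ _ _ z]) (use \<phi> \<psi> eq in auto)
  moreover have "\<phi> z \<le> \<psi> z"
    by (rule comparison[OF usc(1)[OF cont(1)] usc(2)[OF cont(2)] b1 b2 _ _ _ z]) (use \<phi> \<psi> eq in auto)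
  ultimately show ?thesis by simp
qed

end

theorem theorem3p1:
  fixes \<Omega> \<Omega>p \<Omega>m \<Sigma>0 :: "(real^3) set"
    and v :: "real \<Rightarrow> real^3 \<Rightarrow> real^3"
    and X :: "real \<Rightarrow> real \<Rightarrow> real^3 \<Rightarrow> real^3"
    and \<Sigma> :: "real \<Rightarrow> (real^3) set"
    and \<phi>0 :: "real^3 \<Rightarrow> real"
    and \<epsilon> :: "real \<Rightarrow> real"
    and \<eta>1 :: "real \<Rightarrow> real^3 \<Rightarrow> real"
    and \<eta>2 :: "real \<Rightarrow> real"
    and R :: "real \<Rightarrow> real^3 \<Rightarrow> real^3 \<Rightarrow> real"
    and T :: real
  assumes domain: "bounded \<Omega>" "connected \<Omega>" "open \<Omega>"
    and v_cont: "continuous_on ({0..} \<times> closure \<Omega>) (\<lambda>(t, x). v t x)"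
    and v_C1: "C1_on ({0..} \<times> \<Omega>) (\<lambda>(t, x). v t x)"
    and v_lipschitz: "local_lipschitz {0..} (closure \<Omega>) v"
    and H2: "\<And>s x. s \<ge> 0 \<Longrightarrow> x \<in> frontier \<Omega> \<Longrightarrow>
               v s x \<in> contingent_cone (frontier \<Omega>) x \<and> - v s x \<in> contingent_cone (frontier \<Omega>) x"
    and H3: "\<And>i j :: 3. \<exists>C. \<forall>t\<ge>0. \<forall>x\<in>\<Omega>. \<bar>jacobian (v t) (at x) $ i $ j\<bar> \<le> C"
    and X_def: "X = flow \<Omega> v"
    and \<Omega>p: "open \<Omega>p" "connected \<Omega>p" "\<Omega>p \<subset> \<Omega>" "frontier \<Omega>p \<inter> frontier \<Omega> = {}"
    and \<Omega>m_def: "\<Omega>m = \<Omega> - closure \<Omega>p"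
    and \<Omega>m: "connected \<Omega>m"
    and \<Sigma>0_def: "\<Sigma>0 = frontier \<Omega>p"
    and \<Sigma>0: "\<Sigma>0 = frontier \<Omega>p \<inter> frontier \<Omega>m" "\<Sigma>0 \<subseteq> \<Omega>" "closed_surface \<Sigma>0"
    and \<phi>0_cont: "continuous_on (closure \<Omega>) \<phi>0"
    and \<phi>0_sign: "\<And>x. x \<in> \<Omega>p \<Longrightarrow> \<phi>0 x > 0" "\<And>x. x \<in> \<Omega>m \<Longrightarrow> \<phi>0 x < 0"
      "{x \<in> \<Omega>. \<phi>0 x = 0} = \<Sigma>0"
    and \<Sigma>_def: "\<Sigma> = (\<lambda>t. X t 0 ` \<Sigma>0)"
    and \<epsilon>: "smooth_on {0..} \<epsilon>" "\<And>t. t \<ge> 0 \<Longrightarrow> \<epsilon> t > 0"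
      "\<And>t. t \<ge> 0 \<Longrightarrow> boundary_layer \<Omega> (3 * \<epsilon> t) \<inter> \<Sigma> t = {}"
    and \<eta>1: "smooth_on ({0..} \<times> closure \<Omega>) (\<lambda>(t, x). \<eta>1 t x)"
      "\<And>t x. t \<ge> 0 \<Longrightarrow> x \<in> closure \<Omega> \<Longrightarrow> \<eta>1 t x \<in> {0..1}"
      "\<And>t x. t \<ge> 0 \<Longrightarrow> x \<in> closure \<Omega> - boundary_layer \<Omega> (3 * \<epsilon> t) \<Longrightarrow> \<eta>1 t x = 1"
      "\<And>t x. t \<ge> 0 \<Longrightarrow> x \<in> boundary_layer \<Omega> (2 * \<epsilon> t) \<Longrightarrow> \<eta>1 t x = 0"
    and \<eta>2: "smooth_on {0..} \<eta>2"
      "\<And>r. r \<ge> 0 \<Longrightarrow> \<eta>2 r \<in> {0..1}"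
      "\<And>r. r \<in> {2/3..4/3} \<Longrightarrow> \<eta>2 r = 1"
      "\<And>r. r \<in> {0..1/3} \<union> {5/3..} \<Longrightarrow> \<eta>2 r = 0"
      "mono_on {1/3..2/3} \<eta>2" "antimono_on {4/3..5/3} \<eta>2"
    and R_def: "R = cutoff_R v \<eta>1 \<eta>2"
    and T: "T > 0"
  shows "\<exists>\<phi>. level_set_solution \<Omega> v R \<phi>0 T \<phi> \<and>
           (\<forall>\<psi>. level_set_solution \<Omega> v R \<phi>0 T \<psi> \<longrightarrow>
              (\<forall>t\<in>{0..<T}. \<forall>x\<in>closure \<Omega>. \<psi> (t, x) = \<phi> (t, x))) \<and>
           (\<forall>t\<in>{0..<T}. {x \<in> \<Omega>. \<phi> (t, x) = 0} = \<Sigma> t)"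
proof -
  have "\<Omega> \<noteq> {}" using \<Omega>p(3) by blast
  note smooth = smooth_on_imp_continuous_on[OF \<epsilon>(1)] smooth_on_imp_continuous_on[OF \<eta>1(1)] smooth_on_imp_continuous_on[OF \<eta>2(1)]
  \<comment> \<open>\<open>5/3\<close> is where \<open>\<eta>2\<close> has reached 0 for good, so R
    vanishes for all longer gradients.\<close>
  interpret level_set_problem \<Omega> v R \<phi>0 \<epsilon> T "5/3"
  proof
    show "continuous_on ({0..} \<times> closure \<Omega> \<times> UNIV) (\<lambda>(t, x, p). R t x p)"
      unfolding R_def using cutoff_R_continuous[OF v_C1 domain(3) smooth(1) \<epsilon>(2) smooth(2) \<eta>1(4) smooth(3)] \<eta>2(4)
      by blast
    show "R t x p = 0" if "norm p \<ge> 5/3" for t x p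
      using \<eta>2(4)[of "norm p"] that by (simp add: R_def cutoff_R_def)
    show "R t x p = 0" if "t \<ge> 0" "x \<in> boundary_layer \<Omega> (2 * \<epsilon> t)" for t x p
      using \<eta>1(4)[OF that] by (simp add: R_def cutoff_R_def)
  qed (use domain \<open>\<Omega> \<noteq> {}\<close> v_cont v_lipschitz H2 smooth(1) \<epsilon>(2) T \<phi>0_cont in auto)
  obtain k \<phi> where k: "\<And>\<xi>. k \<xi> \<ge> 0" "\<And>\<xi>. \<xi> \<in> frontier \<Omega> \<Longrightarrow> k \<xi> = 0"
    and between: "\<And>t x. (t, x) \<in> {0..<T} \<times> closure \<Omega> \<Longrightarrow> barrier \<phi>0 (\<lambda>\<xi>. - k \<xi>) t (flow \<Omega> v 0 t x) \<le> \<phi> (t, x) \<and>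
      \<phi> (t, x) \<le> barrier \<phi>0 k t (flow \<Omega> v 0 t x)"
    and \<phi>_cont: "continuous_on ({0..<T} \<times> closure \<Omega>) \<phi>"
    and \<phi>_sol: "viscosity_solution ({0<..<T} \<times> \<Omega>) (level_set_G v R) \<phi>"
    and \<phi>_bd: "bounded (\<phi> ` ({0..<T} \<times> closure \<Omega>))"
    by (rule solution_exists_between) blast
  have initial: "\<phi> (0, x) = \<phi>0 x" if "x \<in> \<Omega>" for x
    using between[of 0 x] that T closure_domain by (simp add: barrier_0)
  have lateral: "\<phi> (t, x) = \<phi>0 (flow \<Omega> v 0 t x)" if "t \<in> {0..<T}" "x \<in> frontier \<Omega>" for t x
  proof -
    have "k (flow \<Omega> v 0 t x) = 0" using that by (intro k(2) flow_in_frontier) auto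
    then show ?thesis using between[of t x] that closure_domain by (simp add: barrier_trivial)
  qed
  have \<phi>: "level_set_solution \<Omega> v R \<phi>0 T \<phi>"
    unfolding level_set_solution_def using \<phi>_cont \<phi>_sol initial lateral by blast
  have unique: "\<psi> (t, x) = \<phi> (t, x)"
    if \<psi>: "level_set_solution \<Omega> v R \<phi>0 T \<psi>" and tx: "t \<in> {0..<T}" "x \<in> closure \<Omega>" for \<psi> t x
  proof (rule viscosity_solution_unique[OF \<phi>_cont _ \<phi>_sol _ \<phi>_bd])
    fix z assume z: "z \<in> {0..<T} \<times> closure \<Omega>" "z \<notin> {0<..<T} \<times> \<Omega>"
    obtain s y where sy: "z = (s, y)" by (cases z)
    show "\<psi> z = \<phi> z"
    \<comment> \<open>The initial condition covers only \<Omega>; at the corner s = 0, y on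
      \<partial>\<Omega>, the value comes from the lateral condition.\<close>
    proof (cases "y \<in> \<Omega>")
      case True
      then have "s = 0" using z sy by auto
      then show ?thesis using True \<psi> initial sy by (simp add: level_set_solution_def)
    next
      case False
      then have "y \<in> frontier \<Omega>" using z sy closure_domain by auto
      then show ?thesis using z \<psi> lateral sy by (auto simp: level_set_solution_def)
    qed
  qed (use \<psi> tx in \<open>auto simp: level_set_solution_def\<close>)
  have zero: "{x \<in> \<Omega>. \<phi> (t, x) = 0} = \<Sigma> t" if t: "t \<in> {0..<T}" for t
  proof -
    \<comment> \<open>Both barriers have the sign of \<phi>0 at the starting point, and \<phi> lies
      between them; so it has this sign too.\<close>
    have \<phi>_zero: "\<phi> (t, x) = 0 \<longleftrightarrow> \<phi>0 (flow \<Omega> v 0 t x) = 0" if "x \<in> \<Omega>" for x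
    proof -
      have "(t, x) \<in> {0..<T} \<times> closure \<Omega>" using t that closure_domain by auto
      note b = between[OF this]
      show ?thesis
        using b barrier_sign[of \<phi>0 "flow \<Omega> v 0 t x" k t] barrier_sign[of \<phi>0 "flow \<Omega> v 0 t x" "\<lambda>\<xi>. - k \<xi>" t]
        by (cases "\<phi>0 (flow \<Omega> v 0 t x)" "0::real" rule: linorder_cases) auto
    qed
    show ?thesis
    proof (intro equalityI subsetI)
      fix x assume x: "x \<in> {x \<in> \<Omega>. \<phi> (t, x) = 0}"
      then have "flow \<Omega> v 0 t x \<in> \<Sigma>0"
        using \<phi>_zero[of x] \<phi>0_sign(3) flow_in_domain[of t x 0] t by auto
      moreover have "flow \<Omega> v t 0 (flow \<Omega> v 0 t x) = x"
        using flow_comp[of t x 0 t] t x closure_domain by auto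
      ultimately show "x \<in> \<Sigma> t" unfolding \<Sigma>_def X_def by (metis imageI)
    next
      fix x assume "x \<in> \<Sigma> t"
      then obtain \<xi> where \<xi>: "\<xi> \<in> \<Sigma>0" "x = flow \<Omega> v t 0 \<xi>" unfolding \<Sigma>_def X_def by blast
      have \<xi>\<Omega>: "\<xi> \<in> \<Omega>" "\<phi>0 \<xi> = 0" using \<xi>(1) \<phi>0_sign(3) by auto
      have "x \<in> \<Omega>" using flow_in_domain[of 0 \<xi> t] \<xi>\<Omega> \<xi>(2) t by simp
      moreover have "flow \<Omega> v 0 t x = \<xi>"
        using flow_comp[of 0 \<xi> t 0] \<xi>(2) \<xi>\<Omega>(1) t closure_domain by auto
      ultimately show "x \<in> {x \<in> \<Omega>. \<phi> (t, x) = 0}" using \<phi>_zero[of x] \<xi>\<Omega>(2) by simp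
    qed
  qed
  show ?thesis using \<phi> unique zero by blast
qed

end
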